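(* Let $\mu$ be a non-trivial probability measure on $\partial\mathbb{D}$ with Verblunsky coefficients $\{\alpha_k\}$ (extended to all $k\in\mathbb{Z}$ by $\alpha_{-1}=-1$ and $\alpha_k=0$ for $k\le -2$), and let $\kappa_{n,l}$, $\lambda_{n,l}$ be the coefficients of its monic orthogonal polynomials $\Phi_n$ and reversed polynomials $\Phi_n^*$. Then for every $n\in\mathbb{Z}$ and every $m\ge 1$, $$\bar\kappa_{n,n-m}=\lambda_{n,m}=\sum_{\substack{a_1+\dots+a_j=m\\ j,a_l\ge 1}}\ \sum_{\substack{k_1<n\\ k_2<k_1-a_1\\ \cdots\\ k_j<k_{j-1}-a_{j-1}}}\alpha_{k_1}\bar\alpha_{k_1-a_1}\cdots\alpha_{k_j}\bar\alpha_{k_j-a_j}.$$ If moreover $\sum_{k\ge 0}|\alpha_k|^2<\infty$, then for every $m\ge 1$ the numbers $d_m$ defined by $D(z)^{-1}=\big(\prod_{k\ge 0}\rho_k\big)^{-1}(1+d_1z+d_2z^2+\cdots)$, where $D$ is the Szegő function of $\mu$, satisfy $$d_m=\sum_{\substack{a_1+\dots+a_j=m\\ j,a_l\ge 1}}\ \sum_{\substack{k_2<k_1-a_1\\ \cdots\\ k_j<k_{j-1}-a_{j-1}}}\alpha_{k_1}\bar\alpha_{k_1-a_1}\cdots\alpha_{k_j}\bar\alpha_{k_j-a_j}.$$ In both formulas the outer sum runs over all $2^{m-1}$ ordered partitions $[a_1,\dots,a_j]$ of $m$ into positive integers and the inner sum over all integers $k_1,\dots,k_j\in\mathbb{Z}$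 satisfying the indicated inequalities (in the second formula $k_1\in\mathbb{Z}$ is unrestricted).
   Context: $\mathbb{D}=\{|z|<1\}$. A probability measure $\mu$ on $\partial\mathbb{D}$ is non-trivial if its support is infinite. $\partial\mathbb{D}$ is identified with $[0,2\pi)$ via $\theta\mapsto e^{i\theta}$, and $d\mu=w(\theta)\frac{d\theta}{2\pi}+d\mu_{\rm sing}$ with $\mu_{\rm sing}$ singular with respect to Lebesgue measure. For $n\ge 0$, $\Phi_n(z)=\sum_{l=0}^n\kappa_{n,l}z^l$ (with $\kappa_{n,n}=1$) is the $n$-th monic orthogonal polynomial of $\mu$ and $\Phi_n^*(z)=\sum_{l=0}^n\lambda_{n,l}z^l$ with $\lambda_{n,l}=\bar\kappa_{n,n-l}$ is the reversed polynomial. Put $\kappa_{n,l}=\lambda_{n,l}=0$ for $l>n\ge 0$, and for $n<0$ put $\Phi_n\equiv 0$, $\Phi_n^*\equiv 1$, i.e. $\kappa_{n,l}=0$ and $\lambda_{n,l}=\delta_{l,0}$ for $l\ge 0$; also $\kappa_{n,l}=0$ for $l<0$. The Verblunsky coefficients $\alpha_n\in\mathbb{D}$, $n\ge 0$, are defined by $\Phi_{n+1}(z)=z\Phi_n(z)-\bar\alpha_n\Phi_n^*(z)$, equivalently $\Phi_{n+1}^*(z)=\Phi_n^*(z)-\alpha_n z\Phi_n(z)$. With $\alpha_{-1}=-1$ and $\alpha_n=0$ for $n\le -2$ these recurrences hold for all $n\in\mathbb{Z}$. $\rho_k=\sqrt{1-|\alpha_k|^2}$. By Szegő's theorem $\sum_{k\ge0}|\alpha_k|^2<\infty$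 if and only if $\log w\in L^1(d\theta)$; in that case the Szegő function is $D(z)=\exp\Big(\int_0^{2\pi}\frac{e^{i\theta}+z}{e^{i\theta}-z}\log w(\theta)\,\frac{d\theta}{4\pi}\Big)$, analytic and non-vanishing in $\mathbb{D}$. (In this case the infinite inner sums in the formula for $d_m$ converge absolutely.) *)

theory Defs
  imports
    "HOL-Probability.Probability"
    "HOL-Computational_Algebra.Polynomial"
begin

section \<open>Measures on the unit circle\<close>

definition circle_borel :: "complex measure" where
  "circle_borel = restrict_space borel (sphere 0 1)"

definition circle_support :: "complex measure \<Rightarrow> complex set" where
  "circle_support \<mu> =
     {z \<in> sphere 0 1. \<forall>U. open U \<and> z \<in> U \<longrightarrow> emeasure \<mu> (U \<inter> sphere 0 1) > 0}"

text \<open>The measure \<open>d\<theta>/2\<pi>\<close> on \<open>[0, 2\<pi>)\<close>; it is transported to the circle by \<open>cis\<close>.\<close>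

definition dtheta :: "real measure" where
  "dtheta = uniform_measure lborel {0..<2 * pi}"

text \<open>\<open>d\<mu> = w(\<theta>) d\<theta>/2\<pi> + d\<mu>s\<close> with \<open>\<mu>s\<close> singular with respect to Lebesgue measure on the
  circle. Such \<open>w\<close> and \<open>\<mu>s\<close> exist for every finite \<open>\<mu>\<close>, and \<open>w\<close> is unique up to a null set.\<close>

definition circle_decomposition ::
  "complex measure \<Rightarrow> (real \<Rightarrow> real) \<Rightarrow> complex measure \<Rightarrow> bool" where
  "circle_decomposition \<mu> w \<mu>s \<longleftrightarrow>
     w \<in> borel_measurable borel \<and> (\<forall>\<theta>\<in>{0..<2 * pi}. 0 \<le> w \<theta>) \<and>
     sets \<mu>s = sets circle_borel \<and>
     (\<exists>N\<in>sets circle_borel.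
        emeasure (distr dtheta circle_borel cis) N = 0 \<and> emeasure \<mu>s (sphere 0 1 - N) = 0) \<and>
     (\<forall>A\<in>sets circle_borel.
        emeasure \<mu> A =
          emeasure (distr (density dtheta (\<lambda>\<theta>. ennreal (w \<theta>))) circle_borel cis) A
            + emeasure \<mu>s A)"

text \<open>Only used when \<open>log w\<close> is integrable, so the convention \<open>ln 0 = 0\<close> concerns a null set.\<close>

definition szego_function :: "(real \<Rightarrow> real) \<Rightarrow> complex \<Rightarrow> complex" where
  "szego_function w z =
     exp ((LINT \<theta>:{0..<2 * pi}|lborel.
             (cis \<theta> + z) / (cis \<theta> - z) * complex_of_real (ln (w \<theta>))) / (4 * pi))"

section \<open>Orthogonal polynomials and Verblunsky coefficients\<close>

definition monic_OP :: "complex measure \<Rightarrow> nat \<Rightarrow> complex poly" where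
  "monic_OP \<mu> n =
     (THE p. degree p = n \<and> lead_coeff p = 1 \<and>
        (\<forall>q. degree q < n \<longrightarrow> (LINT z|\<mu>. cnj (poly q z) * poly p z) = 0))"

text \<open>\<open>reflect_poly\<close> reverses coefficients with respect to the degree, here \<open>n\<close>.\<close>

definition reversed_OP :: "complex measure \<Rightarrow> nat \<Rightarrow> complex poly" where
  "reversed_OP \<mu> n = map_poly cnj (reflect_poly (monic_OP \<mu> n))"

definition kappa :: "complex measure \<Rightarrow> int \<Rightarrow> int \<Rightarrow> complex" where
  "kappa \<mu> n l = (if 0 \<le> n \<and> 0 \<le> l then coeff (monic_OP \<mu> (nat n)) (nat l) else 0)"

definition lambda :: "complex measure \<Rightarrow> int \<Rightarrow> nat \<Rightarrow> complex" where
  "lambda \<mu> n l =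
     (if 0 \<le> n then coeff (reversed_OP \<mu> (nat n)) l else if l = 0 then 1 else 0)"

definition verblunsky :: "complex measure \<Rightarrow> nat \<Rightarrow> complex" where
  "verblunsky \<mu> n =
     (THE a. \<forall>z. poly (monic_OP \<mu> (Suc n)) z =
                  z * poly (monic_OP \<mu> n) z - cnj a * poly (reversed_OP \<mu> n) z)"

definition alpha :: "complex measure \<Rightarrow> int \<Rightarrow> complex" where
  "alpha \<mu> k = (if 0 \<le> k then verblunsky \<mu> (nat k) else if k = -1 then -1 else 0)"

definition rho :: "complex measure \<Rightarrow> nat \<Rightarrow> real" where
  "rho \<mu> k = sqrt (1 - (norm (alpha \<mu> (int k)))\<^sup>2)"

section \<open>The combinatorial sums\<close>

text \<open>Tuples \<open>(a\<^sub>1, \<dots>, a\<^sub>j)\<close> and \<open>(k\<^sub>1, \<dots>, k\<^sub>j)\<close> are lists, indexed from \<open>0\<close>.\<close>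

definition ordered_partitions :: "nat \<Rightarrow> nat list set" where
  "ordered_partitions m = {a. length a \<ge> 1 \<and> (\<forall>x\<in>set a. x \<ge> 1) \<and> sum_list a = m}"

definition index_tuples :: "nat list \<Rightarrow> int list set" where
  "index_tuples a =
     {k. length k = length a \<and>
         (\<forall>i. Suc i < length a \<longrightarrow> k ! Suc i < k ! i - int (a ! i))}"

definition alpha_product :: "complex measure \<Rightarrow> nat list \<Rightarrow> int list \<Rightarrow> complex" where
  "alpha_product \<mu> a k =
     (\<Prod>i<length a. alpha \<mu> (k ! i) * cnj (alpha \<mu> (k ! i - int (a ! i))))"

end

theory Submission
  imports Defs "HOL-Complex_Analysis.Complex_Analysis"
begin

text \<open>The formula for \<open>\<lambda>\<^sub>n\<^sub>,\<^sub>m\<close> is the iterated Szego recursion. Solving the recursion for \<open>\<Phi>\<^sub>n\<close> expresses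
  \<open>\<kappa>\<^sub>n\<^sub>,\<^sub>m\<^sub>-\<^sub>1\<close> through the \<open>\<lambda>\<^sub>n\<^sub>-\<^sub>x\<^sub>,\<^sub>m\<^sub>-\<^sub>x\<close> with \<open>1 \<le> x \<le> m\<close>, and the recursion for \<open>\<Phi>\<^sub>n\<^sup>*\<close> then gives
  \<open>\<lambda>\<^sub>n\<^sub>,\<^sub>m = (\<Sum>k<n. \<Sum>x=1..m. \<alpha>\<^sub>k * cnj \<alpha>\<^sub>k\<^sub>-\<^sub>x * \<lambda>\<^sub>k\<^sub>-\<^sub>x\<^sub>,\<^sub>m\<^sub>-\<^sub>x)\<close> (\<open>lambda_eq_sum\<close>). Induction on \<open>m\<close> yields the sum over
  compositions of \<open>m\<close> (\<open>lambda_eq_tuple_sum\<close>). If \<open>\<alpha>\<close> is square summable, all sums over \<open>k\<close> converge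
  absolutely, so the coefficients of \<open>\<Phi>\<^sub>n\<^sup>*\<close> converge to the sums in the formula for \<open>d\<^sub>m\<close>
  (\<open>reversed_OP_coeff_tendsto\<close>). It remains to show that \<open>\<Phi>\<^sub>n\<^sup>*\<close> converges to \<open>(\<Prod>k. \<rho>\<^sub>k) / D\<close> locally
  uniformly in the disc, which is Szego's theorem together with Szego asymptotics.

  The first ingredient is the lower bound \<open>\<Prod>k. \<rho>\<^sub>k\<^sup>2 \<le> exp (mean of log w)\<close>. By the extremal property of
  \<open>\<Phi>\<^sub>n\<^sup>*\<close>, \<open>\<integral>|q|\<^sup>2 d\<mu> \<ge> |q 0|\<^sup>2 * (\<Prod>k. \<rho>\<^sub>k\<^sup>2)\<close> for every polynomial \<open>q\<close>. Taking \<open>q\<close> close to \<open>exp (p / 2)\<close> gives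
  \<open>\<integral>exp h d\<mu> \<ge> (\<Prod>k. \<rho>\<^sub>k\<^sup>2) * exp (mean of h)\<close> for \<open>h = Re p\<close>, hence for continuous \<open>h\<close> by the
  Stone-Weierstrass theorem, and for bounded Borel \<open>h\<close> by density of the continuous functions in \<open>L\<^sup>1\<close>
  (\<open>exp_bounded_lower_bound\<close>). Truncations of \<open>- log w\<close>, made very negative on the set carrying the
  singular part, are admissible, and they give the bound and the integrability of \<open>log w\<close>
  (\<open>szego_lower_bound\<close>).

  The second ingredient is Jensen's inequality. Since \<open>\<phi>\<^sub>n\<^sup>* = \<Phi>\<^sub>n\<^sup>* / (\<Prod>k<n. \<rho>\<^sub>k)\<close> has no zeros in the closed disc,
  \<open>log |D * \<phi>\<^sub>n\<^sup>*|\<^sup>2\<close> is the Poisson integral of \<open>log (w * |\<phi>\<^sub>n\<^sup>*|\<^sup>2)\<close>, so \<open>|D * \<phi>\<^sub>n\<^sup>*|\<^sup>2\<close> has a harmonic majorant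
  that is at most \<open>1\<close> at the origin (\<open>szego_quotient_majorant\<close>). This gives \<open>D 0 \<le> (\<Prod>k. \<rho>\<^sub>k)\<close>, so equality holds
  and \<open>D * \<phi>\<^sub>n\<^sup>*\<close> tends to \<open>1\<close> at the origin. The same majorant together with Harnack's inequality
  shows that \<open>D * \<phi>\<^sub>n\<^sup>*\<close> is close to its value at the origin on every smaller disc
  (\<open>szego_quotient_minus_le\<close>).\<close>

section \<open>Poisson integrals and Herglotz transforms on the unit disc\<close>

lemma sets_dtheta [simp, measurable_cong]: "sets dtheta = sets borel"
  by (simp add: dtheta_def)

lemma space_dtheta [simp]: "space dtheta = UNIV"
  by (simp add: dtheta_def)

lemma prob_space_dtheta: "prob_space dtheta"
  unfolding dtheta_def by (rule prob_space_uniform_measure) auto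

interpretation dtheta: prob_space dtheta
  by (rule prob_space_dtheta)

lemma dtheta_density:
  "dtheta = density lborel (\<lambda>\<theta>. ennreal (indicator {0..<2 * pi} \<theta> / (2 * pi)))"
  unfolding dtheta_def uniform_measure_def
proof (rule density_cong)
  show "AE \<theta> in lborel. indicator {0..<2 * pi} \<theta> / emeasure lborel {0..<2 * pi} =
          ennreal (indicator {0..<2 * pi} \<theta> / (2 * pi))"
    by (intro AE_I2) (auto simp: indicator_def divide_ennreal simp flip: ennreal_1)
qed auto

lemma AE_dtheta: "AE \<theta> in dtheta. \<theta> \<in> {0..<2 * pi}"
  unfolding dtheta_def by (rule AE_uniform_measureI) auto

lemma integral_dtheta:
  fixes f :: "real \<Rightarrow> 'a :: {banach, second_countable_topology}"
  assumes [measurable]: "f \<in> borel_measurable borel"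
  shows "(LINT \<theta>|dtheta. f \<theta>) = (LINT \<theta>:{0..<2 * pi}|lborel. f \<theta>) /\<^sub>R (2 * pi)"
proof -
  have "(LINT \<theta>|dtheta. f \<theta>) = (LINT \<theta>|lborel. (indicator {0..<2 * pi} \<theta> / (2 * pi)) *\<^sub>R f \<theta>)"
    unfolding dtheta_density by (rule integral_density) auto
  also have "\<dots> = (LINT \<theta>|lborel. (1 / (2 * pi)) *\<^sub>R (indicator {0..<2 * pi} \<theta> *\<^sub>R f \<theta>))"
    by (intro Bochner_Integration.integral_cong) auto
  also have "\<dots> = (LINT \<theta>:{0..<2 * pi}|lborel. f \<theta>) /\<^sub>R (2 * pi)"
    unfolding set_lebesgue_integral_def
    by (subst Bochner_Integration.integral_scaleR_right) (simp add: inverse_eq_divide)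
  finally show ?thesis .
qed

lemma integral_dtheta_continuous:
  fixes f :: "real \<Rightarrow> complex"
  assumes cont: "continuous_on UNIV f" and int: "(f has_integral I) {0..2 * pi}"
  shows "(LINT \<theta>|dtheta. f \<theta>) = I / (2 * pi)"
proof -
  have meas [measurable]: "f \<in> borel_measurable borel"
    using cont by (rule borel_measurable_continuous_onI)
  have "set_integrable lborel {0..2 * pi} f"
    using cont by (intro borel_integrable_atLeastAtMost') (auto intro: continuous_on_subset)
  then have "(LINT \<theta>:{0..2 * pi}|lborel. f \<theta>) = I"
    using int by (simp add: set_borel_integral_eq_integral(2) integral_unique)
  moreover have "(LINT \<theta>:{0..2 * pi}|lborel. f \<theta>) = (LINT \<theta>:{0..<2 * pi}|lborel. f \<theta>)"
    unfolding set_lebesgue_integral_def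
  proof (rule integral_cong_AE)
    have "AE \<theta> in lborel. \<theta> \<noteq> 2 * pi"
      by (rule AE_lborel_singleton)
    then show "AE \<theta> in lborel. indicat_real {0..2 * pi} \<theta> *\<^sub>R f \<theta> = indicat_real {0..<2 * pi} \<theta> *\<^sub>R f \<theta>"
      by eventually_elim (auto simp: indicator_def)
  qed auto
  ultimately show ?thesis
    by (simp add: integral_dtheta scaleR_conv_of_real field_simps)
qed

text \<open>The kernels are parametrised by the angle \<^term>\<open>\<theta>\<close> of the boundary point \<^term>\<open>cis \<theta>\<close>; the
  Poisson kernel is the real part of the Herglotz kernel.\<close>

definition herglotz_kernel :: "complex \<Rightarrow> real \<Rightarrow> complex" where
  "herglotz_kernel z \<theta> = (cis \<theta> + z) / (cis \<theta> - z)"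

definition poisson_kernel :: "complex \<Rightarrow> real \<Rightarrow> real" where
  "poisson_kernel z \<theta> = (1 - (norm z)\<^sup>2) / (norm (cis \<theta> - z))\<^sup>2"

lemma cis_minus_nonzero: "norm z < 1 \<Longrightarrow> cis \<theta> - z \<noteq> 0"
  by auto

lemma norm_cis_minus_ge: "1 - norm z \<le> norm (cis \<theta> - z)"
  by (metis norm_cis norm_triangle_ineq2)

lemma Re_herglotz_kernel: "Re (herglotz_kernel z \<theta>) = poisson_kernel z \<theta>"
proof -
  have "herglotz_kernel z \<theta> = (cis \<theta> + z) * cnj (cis \<theta> - z) / (norm (cis \<theta> - z))\<^sup>2"
    unfolding herglotz_kernel_def by (rule complex_div_cnj)
  then have "Re (herglotz_kernel z \<theta>) = Re ((cis \<theta> + z) * cnj (cis \<theta> - z)) / (norm (cis \<theta> - z))\<^sup>2"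
    by (simp only: Re_divide_of_real flip: of_real_power)
  also have "Re ((cis \<theta> + z) * cnj (cis \<theta> - z)) = (cos \<theta>)\<^sup>2 + (sin \<theta>)\<^sup>2 - (norm z)\<^sup>2"
    unfolding cmod_power2 by (simp add: algebra_simps power2_eq_square)
  finally show ?thesis
    by (simp add: poisson_kernel_def)
qed

lemma norm_herglotz_kernel_le:
  assumes "norm z \<le> r" "r < 1"
  shows "norm (herglotz_kernel z \<theta>) \<le> (1 + r) / (1 - r)"
  unfolding herglotz_kernel_def norm_divide
proof (rule frac_le)
  show "norm (cis \<theta> + z) \<le> 1 + r"
    using norm_triangle_ineq[of "cis \<theta>" z] assms by simp
  show "1 - r \<le> norm (cis \<theta> - z)"
    using norm_cis_minus_ge[of z \<theta>] assms by simp
qed (use assms order_trans[OF norm_ge_zero[of z] assms(1)] in auto)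

lemma poisson_kernel_pos: "norm z < 1 \<Longrightarrow> 0 < poisson_kernel z \<theta>"
  unfolding poisson_kernel_def using cis_minus_nonzero[of z \<theta>]
  by (auto intro!: divide_pos_pos simp: power_less_one_iff abs_square_less_1)

lemma poisson_kernel_le:
  assumes "norm z \<le> r" "r < 1"
  shows "poisson_kernel z \<theta> \<le> (1 + r) / (1 - r)"
  using complex_Re_le_cmod[of "herglotz_kernel z \<theta>"] norm_herglotz_kernel_le[OF assms, of \<theta>]
  by (simp add: Re_herglotz_kernel)

lemma herglotz_kernel_measurable [measurable]: "herglotz_kernel z \<in> borel_measurable borel"
  unfolding herglotz_kernel_def[abs_def] by (intro borel_measurable_divide borel_measurable_add
    borel_measurable_diff borel_measurable_continuous_onI continuous_intros)

lemma poisson_kernel_measurable [measurable]: "poisson_kernel z \<in> borel_measurable borel"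
  unfolding Re_herglotz_kernel[symmetric, abs_def] by measurable

text \<open>Poisson's formula: Cauchy's formula at \<^term>\<open>z\<close> for the function
  \<open>u \<mapsto> f u * (1 - |z|\<^sup>2) / (1 - cnj z * u)\<close>, which agrees with \<^term>\<open>f\<close> at \<^term>\<open>z\<close>.\<close>

lemma poisson_formula:
  fixes f :: "complex \<Rightarrow> complex"
  assumes f: "f holomorphic_on ball 0 R" and R: "1 < R" and z: "norm z < 1"
  shows "(LINT \<theta>|dtheta. poisson_kernel z \<theta> * f (cis \<theta>)) = f z"
proof -
  define g where "g u = f u * ((1 - (norm z)\<^sup>2) / (1 - cnj z * u))" for u
  have nz: "1 - cnj z * u \<noteq> 0" if "norm u \<le> 1" for u
  proof
    assume "1 - cnj z * u = 0"
    then have "norm (cnj z * u) = 1" by simp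
    moreover have "norm (cnj z * u) \<le> norm z"
      using that mult_left_mono[OF that norm_ge_zero[of z]] by (simp add: norm_mult)
    ultimately show False using z by simp
  qed
  have g: "g holomorphic_on cball 0 1"
    unfolding g_def using nz R
    by (intro holomorphic_intros holomorphic_on_subset[OF f]) auto
  have gz: "g z = f z"
  proof -
    have "1 - cnj z * z = complex_of_real (1 - (norm z)\<^sup>2)"
      using complex_norm_square[of z] by (simp add: mult.commute)
    then show ?thesis
      unfolding g_def using nz[of z] z by simp
  qed
  have *: "g (cis \<theta>) / (cis \<theta> - z) * \<i> * cis \<theta> = \<i> * (poisson_kernel z \<theta> * f (cis \<theta>))" for \<theta>
  proof -
    have "cis \<theta> * cnj (cis \<theta>) = 1"
      using complex_norm_square[of "cis \<theta>"] by simp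
    then have eq: "1 - cnj z * cis \<theta> = cis \<theta> * cnj (cis \<theta> - z)"
      by (simp add: algebra_simps)
    have "(1 - cnj z * cis \<theta>) * (cis \<theta> - z) = cis \<theta> * complex_of_real ((norm (cis \<theta> - z))\<^sup>2)"
      unfolding eq using complex_norm_square[of "cis \<theta> - z"] by (simp add: mult_ac)
    moreover have "g (cis \<theta>) / (cis \<theta> - z) * \<i> * cis \<theta> =
        \<i> * f (cis \<theta>) * (1 - (norm z)\<^sup>2) * (cis \<theta> / ((1 - cnj z * cis \<theta>) * (cis \<theta> - z)))"
      unfolding g_def by simp
    ultimately show ?thesis
      by (simp add: poisson_kernel_def)
  qed
  have "((\<lambda>u. g u / (u - z)) has_contour_integral 2 * of_real pi * \<i> * g z) (circlepath 0 1)"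
    using Cauchy_integral_circlepath_simple[OF g] z by simp
  then have "((\<lambda>\<theta>. g (cis \<theta>) / (cis \<theta> - z) * \<i> * cis \<theta>) has_integral 2 * of_real pi * \<i> * g z) {0..2 * pi}"
    unfolding circlepath_def by (subst (asm) has_contour_integral_part_circlepath_iff) auto
  then have "((\<lambda>\<theta>. \<i> * (poisson_kernel z \<theta> * f (cis \<theta>))) has_integral 2 * of_real pi * \<i> * f z) {0..2 * pi}"
    unfolding * gz .
  from has_integral_mult_right[OF this, of "-\<i>"]
  have int: "((\<lambda>\<theta>. poisson_kernel z \<theta> * f (cis \<theta>)) has_integral 2 * of_real pi * f z) {0..2 * pi}"
    by (simp add: mult_ac)
  have "continuous_on UNIV (\<lambda>\<theta>. f (cis \<theta>))"
    using R by (intro continuous_on_compose2[OF holomorphic_on_imp_continuous_on[OF f]] continuous_intros) auto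
  then have "continuous_on UNIV (\<lambda>\<theta>. poisson_kernel z \<theta> * f (cis \<theta>))"
    unfolding poisson_kernel_def using z by (intro continuous_intros) auto
  from integral_dtheta_continuous[OF this int] show ?thesis by simp
qed

lemma poisson_kernel_0 [simp]: "poisson_kernel 0 \<theta> = 1"
  by (simp add: poisson_kernel_def)

lemma mean_value_formula:
  fixes f :: "complex \<Rightarrow> complex"
  assumes "f holomorphic_on ball 0 R" "1 < R"
  shows "(LINT \<theta>|dtheta. f (cis \<theta>)) = f 0"
  using poisson_formula[OF assms, of 0] by simp

lemma integrable_poisson_kernel_mult:
  assumes "integrable dtheta g" "norm z < 1"
  shows "integrable dtheta (\<lambda>\<theta>. poisson_kernel z \<theta> * g \<theta>)"
proof (rule Bochner_Integration.integrable_bound)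
  show "integrable dtheta (\<lambda>\<theta>. (1 + norm z) / (1 - norm z) * g \<theta>)"
    using assms by auto
  show "AE \<theta> in dtheta. norm (poisson_kernel z \<theta> * g \<theta>) \<le> norm ((1 + norm z) / (1 - norm z) * g \<theta>)"
    using poisson_kernel_pos[OF assms(2)] poisson_kernel_le[of z "norm z"] assms(2)
    by (intro AE_I2) (simp add: abs_mult less_imp_le mult_right_mono del: times_divide_eq_left)
qed (use assms in measurable)

lemma integral_poisson_kernel:
  assumes "norm z < 1" shows "integral\<^sup>L dtheta (poisson_kernel z) = 1"
proof -
  have "complex_of_real (integral\<^sup>L dtheta (poisson_kernel z)) = 1"
    using poisson_formula[of "\<lambda>_. 1" 2 z] assms by (simp flip: integral_complex_of_real)
  then show ?thesis by (simp only: of_real_eq_1_iff)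
qed

text \<open>Jensen's inequality for the exponential function and the probability measure with density
  \<^term>\<open>poisson_kernel z\<close>, obtained by integrating the tangent line of \<open>exp\<close> at the mean.\<close>

lemma poisson_jensen:
  assumes g: "integrable dtheta g" and eg: "integrable dtheta (\<lambda>\<theta>. exp (g \<theta>))" and z: "norm z < 1"
  shows "exp (LINT \<theta>|dtheta. poisson_kernel z \<theta> * g \<theta>) \<le> (LINT \<theta>|dtheta. poisson_kernel z \<theta> * exp (g \<theta>))"
proof -
  define m where "m = (LINT \<theta>|dtheta. poisson_kernel z \<theta> * g \<theta>)"
  note int = integrable_poisson_kernel_mult[OF g z] integrable_poisson_kernel_mult[OF eg z]
    integrable_poisson_kernel_mult[of "\<lambda>_. 1", OF _ z, simplified]
  have "exp m = (LINT \<theta>|dtheta. exp m * ((1 - m) * poisson_kernel z \<theta> + poisson_kernel z \<theta> * g \<theta>))"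
    using int by (simp add: integral_poisson_kernel[OF z] m_def[symmetric])
  also have "\<dots> \<le> (LINT \<theta>|dtheta. poisson_kernel z \<theta> * exp (g \<theta>))"
  proof (rule integral_mono)
    fix \<theta>
    have "exp m * (1 + (g \<theta> - m)) \<le> exp m * exp (g \<theta> - m)"
      by (intro mult_left_mono exp_ge_add_one_self) auto
    then have "exp m * (1 - m + g \<theta>) \<le> exp (g \<theta>)"
      by (simp add: exp_diff algebra_simps)
    then have "poisson_kernel z \<theta> * (exp m * (1 - m + g \<theta>)) \<le> poisson_kernel z \<theta> * exp (g \<theta>)"
      using poisson_kernel_pos[OF z, of \<theta>] by (intro mult_left_mono) auto
    then show "exp m * ((1 - m) * poisson_kernel z \<theta> + poisson_kernel z \<theta> * g \<theta>) \<le> poisson_kernel z \<theta> * exp (g \<theta>)"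
      by (simp add: algebra_simps)
  qed (use int in auto)
  finally show ?thesis unfolding m_def .
qed

text \<open>The Herglotz transform of a density \<^term>\<open>g\<close> with respect to normalised arc length. For real
  \<^term>\<open>g\<close> its real part is the Poisson integral of \<^term>\<open>g\<close>.\<close>

definition herglotz :: "(real \<Rightarrow> complex) \<Rightarrow> complex \<Rightarrow> complex" where
  "herglotz g z = (LINT \<theta>|dtheta. herglotz_kernel z \<theta> * g \<theta>)"

lemma integrable_herglotz_kernel_mult:
  assumes "integrable dtheta g" "norm z < 1"
  shows "integrable dtheta (\<lambda>\<theta>. herglotz_kernel z \<theta> * g \<theta>)"
proof (rule Bochner_Integration.integrable_bound)
  show "integrable dtheta (\<lambda>\<theta>. (1 + norm z) / (1 - norm z) * norm (g \<theta>))"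
    using assms by auto
  show "AE \<theta> in dtheta. norm (herglotz_kernel z \<theta> * g \<theta>) \<le> norm ((1 + norm z) / (1 - norm z) * norm (g \<theta>))"
    using norm_herglotz_kernel_le[of z "norm z"] assms(2)
    by (intro AE_I2) (simp add: norm_mult abs_mult mult_right_mono del: times_divide_eq_left)
qed (use assms in measurable)

text \<open>Expand the kernel as \<open>1 + 2 * (\<Sum>k\<ge>1. cnj (cis \<theta>) ^ k * z ^ k)\<close> and integrate term by term.\<close>

lemma herglotz_holomorphic:
  assumes g: "integrable dtheta g"
  shows "herglotz g holomorphic_on ball 0 1"
proof -
  define c where "c k = (LINT \<theta>|dtheta. (if k = 0 then 1 else 2 * cnj (cis \<theta>) ^ k) * g \<theta>)" for k
  note [measurable] = borel_measurable_integrable[OF g]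
  have [measurable]: "(\<lambda>\<theta>. cnj (cis \<theta>)) \<in> borel_measurable borel"
    by (intro borel_measurable_continuous_onI continuous_intros)
  have "((\<lambda>k. c k * (z - 0) ^ k) sums herglotz g z)" if z: "z \<in> ball 0 1" for z
  proof -
    define t where "t k \<theta> = (if k = 0 then 1 else 2 * cnj (cis \<theta>) ^ k) * g \<theta> * z ^ k" for k \<theta>
    have z1: "norm z < 1" using z by simp
    have tn: "norm (t k \<theta>) \<le> 2 * norm z ^ k * norm (g \<theta>)" for k \<theta>
      using norm_ge_zero[of "g \<theta>"] by (auto simp: t_def norm_mult norm_power)
    have int: "integrable dtheta (t k)" for k
    proof (rule Bochner_Integration.integrable_bound)
      show "integrable dtheta (\<lambda>\<theta>. 2 * norm z ^ k * norm (g \<theta>))" using g by auto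
      show "t k \<in> borel_measurable dtheta" unfolding t_def by measurable
      show "AE \<theta> in dtheta. norm (t k \<theta>) \<le> norm (2 * norm z ^ k * norm (g \<theta>))"
        using tn by (intro AE_I2) auto
    qed
    have tsums: "(\<lambda>k. t k \<theta>) sums (herglotz_kernel z \<theta> * g \<theta>)" for \<theta>
    proof -
      define x where "x = cnj (cis \<theta>) * z"
      have x1: "norm x < 1" using z1 by (simp add: x_def norm_mult)
      have "(\<lambda>k. 2 * x ^ k - (if k = 0 then 1 else 0)) sums (2 * (1 / (1 - x)) - 1)"
        by (intro sums_diff sums_mult geometric_sums x1 sums_single)
      moreover have "2 * (1 / (1 - x)) - 1 = herglotz_kernel z \<theta>"
      proof -
        have c: "cis \<theta> * cnj (cis \<theta>) = 1" using complex_norm_square[of "cis \<theta>"] by simp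
        have "(1 - x) \<noteq> 0" using x1 by auto
        then have "2 * (1 / (1 - x)) - 1 = (1 + x) / (1 - x)" by (simp add: field_simps)
        also have "\<dots> = (cis \<theta> * (1 + x)) / (cis \<theta> * (1 - x))" by simp
        also have "cis \<theta> * (1 + x) = cis \<theta> + z" using c by (simp add: x_def algebra_simps)
        also have "cis \<theta> * (1 - x) = cis \<theta> - z" using c by (simp add: x_def algebra_simps)
        finally show ?thesis by (simp add: herglotz_kernel_def)
      qed
      ultimately have "(\<lambda>k. (2 * x ^ k - (if k = 0 then 1 else 0)) * g \<theta>) sums (herglotz_kernel z \<theta> * g \<theta>)"
        by (intro sums_mult2) simp
      moreover have "(2 * x ^ k - (if k = 0 then 1 else 0)) * g \<theta> = t k \<theta>" for k
        by (auto simp: t_def x_def power_mult_distrib)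
      ultimately show ?thesis by simp
    qed
    have "(\<lambda>k. integral\<^sup>L dtheta (t k)) sums (LINT \<theta>|dtheta. (\<Sum>k. t k \<theta>))"
    proof (rule sums_integral)
      show "AE \<theta> in dtheta. summable (\<lambda>k. norm (t k \<theta>))"
      proof (rule AE_I2, rule summable_comparison_test)
        fix \<theta>
        show "summable (\<lambda>k. 2 * norm z ^ k * norm (g \<theta>))"
          using z1 by (intro summable_mult2 summable_mult summable_geometric) auto
        show "\<exists>N. \<forall>n\<ge>N. norm (norm (t n \<theta>)) \<le> 2 * norm z ^ n * norm (g \<theta>)"
          using tn by auto
      qed
      show "summable (\<lambda>k. LINT \<theta>|dtheta. norm (t k \<theta>))"
      proof (rule summable_comparison_test)
        show "summable (\<lambda>k. 2 * norm z ^ k * (LINT \<theta>|dtheta. norm (g \<theta>)))"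
          using z1 by (intro summable_mult2 summable_mult summable_geometric) auto
        have "(LINT \<theta>|dtheta. norm (t k \<theta>)) \<le> (LINT \<theta>|dtheta. 2 * norm z ^ k * norm (g \<theta>))" for k
          using int g tn by (intro integral_mono) auto
        then show "\<exists>N. \<forall>k\<ge>N. norm (LINT \<theta>|dtheta. norm (t k \<theta>)) \<le> 2 * norm z ^ k * (LINT \<theta>|dtheta. norm (g \<theta>))"
          by auto
      qed
    qed (rule int)
    moreover have "(\<Sum>k. t k \<theta>) = herglotz_kernel z \<theta> * g \<theta>" for \<theta>
      using tsums by (rule sums_unique[symmetric])
    moreover have "integral\<^sup>L dtheta (t k) = c k * z ^ k" for k
      unfolding t_def c_def by simp
    ultimately show ?thesis by (simp add: herglotz_def)
  qed
  then show ?thesis by (rule power_series_holomorphic)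
qed

lemma Re_herglotz:
  assumes g: "integrable dtheta (g :: real \<Rightarrow> real)" and z: "norm z < 1"
  shows "Re (herglotz (\<lambda>\<theta>. of_real (g \<theta>)) z) = (LINT \<theta>|dtheta. poisson_kernel z \<theta> * g \<theta>)"
proof -
  have "integrable dtheta (\<lambda>\<theta>. herglotz_kernel z \<theta> * of_real (g \<theta>))"
    using g z by (intro integrable_herglotz_kernel_mult) auto
  then show ?thesis
    unfolding herglotz_def by (subst integral_Re[symmetric]) (auto simp: Re_herglotz_kernel)
qed

lemma norm_herglotz_le:
  assumes g: "integrable dtheta g" and z: "norm z \<le> r" "r < 1"
  shows "norm (herglotz g z) \<le> (1 + r) / (1 - r) * (LINT \<theta>|dtheta. norm (g \<theta>))"
proof -
  have "norm (herglotz g z) \<le> (LINT \<theta>|dtheta. (1 + r) / (1 - r) * norm (g \<theta>))"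
    unfolding herglotz_def
  proof (rule Bochner_Integration.integral_norm_bound[THEN order_trans])
    show "(LINT \<theta>|dtheta. norm (herglotz_kernel z \<theta> * g \<theta>)) \<le> (LINT \<theta>|dtheta. (1 + r) / (1 - r) * norm (g \<theta>))"
      using g z integrable_norm[OF integrable_herglotz_kernel_mult[OF g, of z]] norm_herglotz_kernel_le[OF z]
      by (intro integral_mono) (auto simp: norm_mult intro!: mult_right_mono simp del: times_divide_eq_left)
  qed
  then show ?thesis by simp
qed

text \<open>Harnack's inequality, from Poisson's formula on a slightly smaller circle.\<close>

lemma harnack:
  assumes H: "H holomorphic_on ball 0 1" and pos: "\<And>z. norm z < 1 \<Longrightarrow> 0 \<le> Re (H z)"
    and z: "norm z \<le> r" and r: "r < 1"
  shows "Re (H z) \<le> (3 + r) / (1 - r) * Re (H 0)"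
proof -
  \<comment> \<open>with the smaller circle of radius \<open>s = (1 + r) / 2\<close>, the rescaled point has modulus
    at most \<open>2 r / (1 + r)\<close>\<close>
  have r0: "0 \<le> r" using z norm_ge_zero[of z] by linarith
  define s where "s = (1 + r) / 2"
  have s: "0 < s" "s < 1" "r < s" using r r0 by (auto simp: s_def)
  define f where "f u = H (of_real s * u)" for u
  have f: "f holomorphic_on ball 0 (1 / s)"
    unfolding f_def[abs_def]
  proof (rule holomorphic_on_compose_gen[OF _ H, unfolded comp_def])
    show "(*) (complex_of_real s) ` ball 0 (1 / s) \<subseteq> ball 0 1"
      using s by (auto simp: norm_mult field_simps)
  qed (intro holomorphic_intros)
  have s1: "1 < 1 / s" using s by simp
  define q where "q = r / s"
  have q0: "0 \<le> q" using s r0 by (simp add: q_def)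
  have q: "q < 1" using s by (simp add: q_def)
  have zq: "norm (z / of_real s) \<le> q"
    using z s by (simp add: q_def norm_divide divide_right_mono)
  then have zs: "norm (z / of_real s) < 1" using q by linarith
  have cont: "continuous_on UNIV (\<lambda>\<theta>. f (cis \<theta>))"
    using s1 by (intro continuous_on_compose2[OF holomorphic_on_imp_continuous_on[OF f]] continuous_intros) auto
  obtain B where B: "\<And>u. norm u = 1 \<Longrightarrow> norm (f u) \<le> B"
  proof -
    have "compact (f ` sphere 0 1)"
      using s1 by (intro compact_continuous_image continuous_on_subset[OF holomorphic_on_imp_continuous_on[OF f]]) auto
    then have "bounded (f ` sphere 0 1)" by (rule compact_imp_bounded)
    then show ?thesis using that by (force simp: bounded_iff)
  qed
  have int: "integrable dtheta (\<lambda>\<theta>. f (cis \<theta>))"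
  proof (rule dtheta.integrable_const_bound)
    show "AE \<theta> in dtheta. norm (f (cis \<theta>)) \<le> B" using B by auto
    show "(\<lambda>\<theta>. f (cis \<theta>)) \<in> borel_measurable dtheta"
      using borel_measurable_continuous_onI[OF cont] by simp
  qed
  have intP: "integrable dtheta (\<lambda>\<theta>. poisson_kernel (z / of_real s) \<theta> * Re (f (cis \<theta>)))"
    using integrable_poisson_kernel_mult[OF integrable_Re[OF int] zs] .
  have intC: "integrable dtheta (\<lambda>\<theta>. complex_of_real (poisson_kernel (z / of_real s) \<theta>) * f (cis \<theta>))"
  proof (rule Bochner_Integration.integrable_bound)
    show "integrable dtheta (\<lambda>\<theta>. (1 + q) / (1 - q) * norm (f (cis \<theta>)))" using int by auto
    show "AE \<theta> in dtheta. norm (complex_of_real (poisson_kernel (z / of_real s) \<theta>) * f (cis \<theta>))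
            \<le> norm ((1 + q) / (1 - q) * norm (f (cis \<theta>)))"
      using poisson_kernel_le[OF zq q] poisson_kernel_pos[OF zs] q0 q
      by (intro AE_I2) (simp add: norm_mult abs_mult less_imp_le mult_right_mono del: times_divide_eq_left)
  qed (use borel_measurable_integrable[OF int] in measurable)
  have "f (z / of_real s) = (LINT \<theta>|dtheta. poisson_kernel (z / of_real s) \<theta> * f (cis \<theta>))"
    using poisson_formula[OF f s1 zs] by simp
  then have "Re (H z) = (LINT \<theta>|dtheta. poisson_kernel (z / of_real s) \<theta> * Re (f (cis \<theta>)))"
    using s intC by (simp add: f_def integral_Re[symmetric])
  also have "\<dots> \<le> (LINT \<theta>|dtheta. (1 + q) / (1 - q) * Re (f (cis \<theta>)))"
  proof (rule integral_mono)
    fix \<theta>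
    have "0 \<le> Re (f (cis \<theta>))"
      unfolding f_def using s by (intro pos) (auto simp: norm_mult)
    then show "poisson_kernel (z / of_real s) \<theta> * Re (f (cis \<theta>)) \<le> (1 + q) / (1 - q) * Re (f (cis \<theta>))"
      using poisson_kernel_le[OF zq q] by (intro mult_right_mono)
  qed (use int intP in auto)
  also have "\<dots> = (1 + q) / (1 - q) * Re (f 0)"
    using mean_value_formula[OF f s1] int by (simp add: integral_Re)
  also have "\<dots> \<le> (3 + r) / (1 - r) * Re (f 0)"
  proof (rule mult_right_mono)
    have "(1 + q) / (1 - q) = (s + r) / (s - r)" using s by (simp add: q_def field_simps)
    also have "\<dots> = (1 + 3 * r) / (1 - r)" using r by (simp add: s_def divide_simps) (simp add: algebra_simps)
    also have "\<dots> \<le> (3 + r) / (1 - r)" using r by (intro divide_right_mono) auto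
    finally show "(1 + q) / (1 - q) \<le> (3 + r) / (1 - r)" .
    show "0 \<le> Re (f 0)" using pos[of 0] by (simp add: f_def)
  qed
  finally show ?thesis by (simp add: f_def)
qed

section \<open>Orthogonal polynomials on the unit circle\<close>

text \<open>Reversal \<open>p \<mapsto> p\<^sup>*\<close> with respect to the degree of \<^term>\<open>p\<close>; on the unit circle it is
  \<open>z ^ degree p * cnj (p z)\<close>.\<close>

definition conj_reverse :: "complex poly \<Rightarrow> complex poly" where
  "conj_reverse p = map_poly cnj (reflect_poly p)"

lemma coeff_conj_reverse:
  "coeff (conj_reverse p) k = (if k \<le> degree p then cnj (coeff p (degree p - k)) else 0)"
  by (simp add: conj_reverse_def coeff_map_poly coeff_reflect_poly)

lemma degree_conj_reverse_le: "degree (conj_reverse p) \<le> degree p"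
  by (rule degree_le) (simp add: coeff_conj_reverse)

lemma poly_conj_reverse:
  assumes "norm z = 1"
  shows "poly (conj_reverse p) z = z ^ degree p * cnj (poly p z)"
proof -
  have "z * cnj z = 1" using assms complex_norm_square[of z] by simp
  then have "cnj z * z = 1" by (simp only: mult.commute)
  then have inv: "inverse (cnj z) = z" by (rule inverse_unique)
  have nz: "cnj z \<noteq> 0" using assms by auto
  have "poly (reflect_poly p) (cnj z) = cnj z ^ degree p * poly p z"
    unfolding poly_reflect_poly_nz[OF nz] inv ..
  moreover have "poly (conj_reverse p) z = cnj (poly (reflect_poly p) (cnj z))"
    using poly_cnj[of "reflect_poly p" "cnj z"] by (simp add: conj_reverse_def)
  ultimately show ?thesis by simp
qed

lemma poly_conj_reverse_0: "poly (conj_reverse p) 0 = cnj (lead_coeff p)"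
  by (simp add: poly_0_coeff_0 coeff_conj_reverse)

lemma reversed_OP_eq: "reversed_OP \<mu> n = conj_reverse (monic_OP \<mu> n)"
  by (simp add: reversed_OP_def conj_reverse_def)

text \<open>A probability measure on the unit circle with infinite support.\<close>

locale nontrivial_circle_measure = prob_space \<mu> for \<mu> :: "complex measure" +
  assumes sets_eq: "sets \<mu> = sets circle_borel"
    and infinite_support: "infinite (circle_support \<mu>)"
begin

lemma space_eq: "space \<mu> = sphere 0 1"
  using sets_eq_imp_space_eq[OF sets_eq] by (simp add: circle_borel_def space_restrict_space)

lemma measurable_circle:
  assumes "f \<in> borel_measurable borel" shows "f \<in> borel_measurable \<mu>"
  unfolding measurable_cong_sets[OF sets_eq refl] circle_borel_def
  using assms by (rule measurable_restrict_space1)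

lemma integrable_continuous:
  fixes f :: "complex \<Rightarrow> 'b :: {banach, second_countable_topology}"
  assumes "continuous_on UNIV f" shows "integrable \<mu> f"
proof -
  have "compact (f ` sphere 0 1)"
    using assms by (intro compact_continuous_image) (auto intro: continuous_on_subset)
  then have "bounded (f ` sphere 0 1)" by (rule compact_imp_bounded)
  then obtain B where "\<And>z. z \<in> sphere 0 1 \<Longrightarrow> norm (f z) \<le> B"
    by (force simp: bounded_iff)
  then show ?thesis
    using assms by (intro integrable_const_bound[of _ B])
      (auto simp: space_eq intro!: measurable_circle borel_measurable_continuous_onI AE_I2)
qed

text \<open>The inner product of \<open>L\<^sup>2(\<mu>)\<close> on polynomials, conjugate linear in the first argument, and the
  associated squared norm.\<close>

definition ip :: "complex poly \<Rightarrow> complex poly \<Rightarrow> complex" where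
  "ip p q = (LINT z|\<mu>. cnj (poly p z) * poly q z)"

definition nsq :: "complex poly \<Rightarrow> real" where
  "nsq p = (LINT z|\<mu>. (norm (poly p z))\<^sup>2)"

lemma integrable_ip: "integrable \<mu> (\<lambda>z. cnj (poly p z) * poly q z)"
  by (intro integrable_continuous continuous_intros)

lemma ip_add_left: "ip (p + q) r = ip p r + ip q r"
  and ip_add_right: "ip p (q + r) = ip p q + ip p r"
  and ip_diff_left: "ip (p - q) r = ip p r - ip q r"
  and ip_diff_right: "ip p (q - r) = ip p q - ip p r"
  and ip_smult_left: "ip (smult c p) r = cnj c * ip p r"
  and ip_smult_right: "ip p (smult c r) = c * ip p r"
  using integrable_ip by (simp_all add: ip_def algebra_simps)

lemma ip_0_left [simp]: "ip 0 p = 0" and ip_0_right [simp]: "ip p 0 = 0"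
  by (simp_all add: ip_def)

lemma ip_commute: "ip q p = cnj (ip p q)"
proof -
  have "cnj (ip p q) = (LINT z|\<mu>. cnj (cnj (poly p z) * poly q z))"
    unfolding ip_def by (rule Bochner_Integration.integral_cnj[symmetric])
  then show ?thesis by (simp add: ip_def mult.commute)
qed

lemma ip_self: "ip p p = of_real (nsq p)"
  unfolding ip_def nsq_def using complex_norm_square
  by (subst integral_complex_of_real[symmetric]) (simp add: mult.commute)

lemma ip_shift: "ip (pCons 0 p) (pCons 0 q) = ip p q"
  unfolding ip_def
proof (rule Bochner_Integration.integral_cong)
  fix z assume "z \<in> space \<mu>"
  then have "norm z = 1" by (simp add: space_eq)
  then have "z * cnj z = 1" using complex_norm_square[of z] by simp
  then show "cnj (poly (pCons 0 p) z) * poly (pCons 0 q) z = cnj (poly p z) * poly q z"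
    by (simp add: algebra_simps)
qed simp

text \<open>If \<^term>\<open>p\<close> vanishes almost everywhere, every point of the support is a root of \<^term>\<open>p\<close>.\<close>

lemma nsq_pos:
  assumes "p \<noteq> 0" shows "0 < nsq p"
proof -
  have int: "integrable \<mu> (\<lambda>z. (norm (poly p z))\<^sup>2)"
    by (intro integrable_continuous continuous_intros)
  have "nsq p \<noteq> 0"
  proof
    assume "nsq p = 0"
    then have AE: "AE z in \<mu>. poly p z = 0"
      using integral_nonneg_eq_0_iff_AE[OF int] by (auto simp: nsq_def)
    have "circle_support \<mu> \<subseteq> {z. poly p z = 0}"
    proof
      fix z assume z: "z \<in> circle_support \<mu>"
      show "z \<in> {z. poly p z = 0}"
      proof (rule ccontr)
        assume nz: "z \<notin> {z. poly p z = 0}"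
        define U where "U = {u. poly p u \<noteq> 0}"
        have U: "open U"
          unfolding U_def by (intro open_Collect_neq continuous_intros)
        have "emeasure \<mu> (U \<inter> sphere 0 1) > 0"
          using z nz U unfolding circle_support_def by (auto simp: U_def)
        moreover have "U \<inter> sphere 0 1 = {z \<in> space \<mu>. poly p z \<noteq> 0}"
          by (auto simp: U_def space_eq)
        then have "emeasure \<mu> (U \<inter> sphere 0 1) = 0"
          using AE by (simp add: emeasure_eq_0_AE)
        ultimately show False by simp
      qed
    qed
    then show False
      using infinite_support poly_roots_finite[OF assms] finite_subset by blast
  qed
  moreover have "0 \<le> nsq p" by (simp add: nsq_def)
  ultimately show ?thesis by simp
qed

text \<open>The property defining the \<^term>\<open>n\<close>-th monic orthogonal polynomial; for \<open>n = 0\<close> the orthogonality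
  condition is vacuous.\<close>

definition is_monic_OP :: "nat \<Rightarrow> complex poly \<Rightarrow> bool" where
  "is_monic_OP n p \<longleftrightarrow> degree p = n \<and> lead_coeff p = 1 \<and> (\<forall>q. degree q < n \<longrightarrow> ip q p = 0)"

lemma is_monic_OP_unique:
  assumes "is_monic_OP n p" "is_monic_OP n q" shows "p = q"
proof (rule ccontr)
  assume ne: "p \<noteq> q"
  have "degree (p - q) < n"
  proof -
    have "n \<noteq> 0"
    proof
      assume "n = 0"
      then have "degree p = 0" "degree q = 0" using assms by (auto simp: is_monic_OP_def)
      then obtain a b where "p = [:a:]" "q = [:b:]" by (elim degree_eq_zeroE)
      then show False using ne assms by (simp add: is_monic_OP_def)
    qed
    moreover have "coeff (p - q) k = 0" if "k \<ge> n" for k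
    proof (cases "k = n")
      case False
      then show ?thesis using that assms by (simp add: is_monic_OP_def coeff_eq_0)
    qed (use assms in \<open>auto simp: is_monic_OP_def\<close>)
    ultimately show ?thesis
      by (metis leading_coeff_0_iff less_nat_zero_code not_le_imp_less right_minus_eq ne)
  qed
  then have "ip (p - q) (p - q) = 0"
    using assms by (simp add: is_monic_OP_def ip_diff_right)
  then show False using nsq_pos[of "p - q"] ne by (simp add: ip_self)
qed

text \<open>The reversed orthogonal polynomial is orthogonal to \<open>z, \<dots>, z ^ n\<close>: on the circle, pairing it
  with \<^term>\<open>q\<close> is pairing the reversal of \<^term>\<open>q\<close> at degree \<^term>\<open>n\<close> with \<^term>\<open>p\<close>.\<close>

lemma ip_conj_reverse:
  assumes p: "is_monic_OP n p" and q: "degree q \<le> n"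
  shows "ip q (conj_reverse p) = cnj (coeff q 0) * nsq p"
proof -
  define t where "t = monom 1 (n - degree q) * conj_reverse q"
  define r where "r = t - smult (cnj (coeff q 0)) p"
  have t: "poly t z = z ^ n * cnj (poly q z)" if "norm z = 1" for z
    using q that by (simp add: t_def poly_monom poly_conj_reverse flip: power_add mult.assoc)
  have coeff_t: "coeff t k = 0" if "k > n" for k
    using q that by (auto simp: t_def coeff_monom_mult coeff_conj_reverse)
  have "coeff t n = cnj (coeff q 0)"
    using q by (simp add: t_def coeff_monom_mult coeff_conj_reverse)
  then have "coeff r k = 0" if "k \<ge> n" for k
    using coeff_t[of k] that p by (cases "k = n") (auto simp: r_def is_monic_OP_def coeff_eq_0)
  then have "r = 0 \<or> degree r < n"
    by (metis leading_coeff_0_iff not_le_imp_less)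
  then have "ip r p = 0" using p by (auto simp: is_monic_OP_def)
  then have "ip p r = 0" by (simp add: ip_commute[of p r])
  moreover have "ip q (conj_reverse p) = ip p t"
    unfolding ip_def
  proof (rule Bochner_Integration.integral_cong)
    fix z assume "z \<in> space \<mu>"
    then have "norm z = 1" by (simp add: space_eq)
    then show "cnj (poly q z) * poly (conj_reverse p) z = cnj (poly p z) * poly t z"
      using p by (simp add: t poly_conj_reverse is_monic_OP_def)
  qed simp
  moreover have "t = smult (cnj (coeff q 0)) p + r" by (simp add: r_def)
  ultimately show ?thesis by (simp add: ip_add_right ip_smult_right ip_self)
qed

text \<open>The Szego recursion as a construction: \<^term>\<open>c\<close> is chosen so that the new polynomial is orthogonal
  to the constants, and orthogonality to \<open>z, \<dots>, z ^ n\<close> is automatic.\<close>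

lemma is_monic_OP_step:
  assumes p: "is_monic_OP n p"
  obtains c where "is_monic_OP (Suc n) (pCons 0 p - smult c (conj_reverse p))"
proof
  define c where "c = ip 1 (pCons 0 p) / nsq p"
  define p' where "p' = pCons 0 p - smult c (conj_reverse p)"
  have p0: "p \<noteq> 0" using p by (auto simp: is_monic_OP_def)
  have dr: "degree (conj_reverse p) \<le> n"
    using degree_conj_reverse_le[of p] p by (simp add: is_monic_OP_def)
  have cn: "coeff p' (Suc n) = 1"
  proof -
    have "coeff (conj_reverse p) (Suc n) = 0" using dr by (intro coeff_eq_0) simp
    moreover have "coeff p n = 1" using p by (auto simp: is_monic_OP_def)
    ultimately show ?thesis by (simp add: p'_def)
  qed
  have "degree p' \<le> Suc n"
    unfolding p'_def using dr p p0
    by (intro degree_diff_le) (auto simp: is_monic_OP_def intro: order_trans[OF degree_smult_le])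
  then have deg: "degree p' = Suc n"
    using cn by (metis le_degree antisym zero_neq_one)
  have "ip q p' = 0" if "degree q < Suc n" for q
  proof -
    obtain a q1 where q1: "q = pCons a q1" by (cases q)
    then have q: "q = smult a 1 + pCons 0 q1" by (simp add: one_pCons)
    have "q1 = 0 \<or> degree q1 < n" using that q1 by (auto split: if_splits)
    then have "ip q1 p = 0" using p by (auto simp: is_monic_OP_def)
    then have "ip q (pCons 0 p) = cnj a * ip 1 (pCons 0 p)"
      unfolding q ip_add_left by (simp only: ip_smult_left ip_shift) simp
    moreover have "ip q (conj_reverse p) = cnj a * nsq p"
      using ip_conj_reverse[OF p, of q] that q1 by simp
    ultimately show ?thesis
      using nsq_pos[OF p0] by (simp add: p'_def ip_diff_right ip_smult_right c_def)
  qed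
  then show "is_monic_OP (Suc n) (pCons 0 p - smult c (conj_reverse p))"
    unfolding p'_def[symmetric] using deg cn by (simp add: is_monic_OP_def)
qed

abbreviation \<Phi> :: "nat \<Rightarrow> complex poly" where "\<Phi> \<equiv> monic_OP \<mu>"
abbreviation \<Phi>s :: "nat \<Rightarrow> complex poly" where "\<Phi>s \<equiv> reversed_OP \<mu>"
abbreviation \<alpha> :: "nat \<Rightarrow> complex" where "\<alpha> \<equiv> verblunsky \<mu>"

lemma ex_monic_OP: "\<exists>p. is_monic_OP n p"
proof (induction n)
  case 0
  have "is_monic_OP 0 1" by (simp add: is_monic_OP_def)
  then show ?case ..
next
  case (Suc n)
  then show ?case by (metis is_monic_OP_step)
qed

lemma monic_OP: "is_monic_OP n (\<Phi> n)"
proof -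
  obtain p where p: "is_monic_OP n p" using ex_monic_OP by blast
  have "\<Phi> n = (THE p. is_monic_OP n p)"
    unfolding monic_OP_def is_monic_OP_def ip_def by simp
  also have "\<dots> = p" using p is_monic_OP_unique by blast
  finally show ?thesis using p by simp
qed

lemma degree_OP [simp]: "degree (\<Phi> n) = n"
  and lead_coeff_OP [simp]: "coeff (\<Phi> n) n = 1"
  and ip_OP: "degree q < n \<Longrightarrow> ip q (\<Phi> n) = 0"
  using monic_OP[of n] by (auto simp: is_monic_OP_def)

lemma OP_nonzero [simp]: "\<Phi> n \<noteq> 0"
  using lead_coeff_OP[of n] by force

lemma OP_0 [simp]: "\<Phi> 0 = 1"
  using is_monic_OP_unique[OF monic_OP[of 0], of 1] by (simp add: is_monic_OP_def)

lemma reversed_OP_0 [simp]: "\<Phi>s 0 = 1"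
  by (rule poly_eqI) (simp add: reversed_OP_eq coeff_conj_reverse)

lemma poly_reversed_OP_0 [simp]: "poly (\<Phi>s n) 0 = 1"
  by (simp add: reversed_OP_eq poly_conj_reverse_0)

lemma coeff_reversed_OP: "coeff (\<Phi>s n) k = (if k \<le> n then cnj (coeff (\<Phi> n) (n - k)) else 0)"
  by (simp add: reversed_OP_eq coeff_conj_reverse)

lemma degree_reversed_OP_le: "degree (\<Phi>s n) \<le> n"
  using degree_conj_reverse_le[of "\<Phi> n"] by (simp add: reversed_OP_eq)

lemma norm_reversed_OP: "norm z = 1 \<Longrightarrow> norm (poly (\<Phi>s n) z) = norm (poly (\<Phi> n) z)"
  by (simp add: reversed_OP_eq poly_conj_reverse norm_mult norm_power)

lemma szego_recursion: "\<Phi> (Suc n) = pCons 0 (\<Phi> n) - smult (cnj (\<alpha> n)) (\<Phi>s n)"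
proof -
  obtain c where "is_monic_OP (Suc n) (pCons 0 (\<Phi> n) - smult c (\<Phi>s n))"
    using is_monic_OP_step[OF monic_OP[of n]] by (auto simp: reversed_OP_eq)
  then have eq: "\<Phi> (Suc n) = pCons 0 (\<Phi> n) - smult c (\<Phi>s n)"
    using is_monic_OP_unique monic_OP by blast
  have "\<alpha> n = cnj c"
    unfolding verblunsky_def
  proof (rule the_equality)
    show "\<forall>z. poly (\<Phi> (Suc n)) z = z * poly (\<Phi> n) z - cnj (cnj c) * poly (\<Phi>s n) z"
      by (simp add: eq)
    fix a assume "\<forall>z. poly (\<Phi> (Suc n)) z = z * poly (\<Phi> n) z - cnj a * poly (\<Phi>s n) z"
    then have "poly (\<Phi> (Suc n)) 0 = - cnj a" by simp
    moreover have "poly (\<Phi> (Suc n)) 0 = - c" by (simp add: eq)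
    ultimately show "a = cnj c" by (metis complex_cnj_cnj neg_equal_iff_equal)
  qed
  then show ?thesis by (simp add: eq)
qed

lemma szego_recursion_reversed: "\<Phi>s (Suc n) = \<Phi>s n - smult (\<alpha> n) (pCons 0 (\<Phi> n))"
proof (rule poly_eqI)
  fix k
  consider "k = 0" | "1 \<le> k" "k \<le> n" | "k = Suc n" | "k > Suc n" by linarith
  then show "coeff (\<Phi>s (Suc n)) k = coeff (\<Phi>s n - smult (\<alpha> n) (pCons 0 (\<Phi> n))) k"
  proof cases
    case 1
    then show ?thesis by (simp add: coeff_reversed_OP)
  next
    case 2
    then obtain j where j: "k = Suc j" "j < n" by (cases k) auto
    have "Suc n - k = Suc (n - Suc j)" "n - (n - j) = j" using j by auto
    then show ?thesis
      using j by (simp add: coeff_reversed_OP szego_recursion)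
  next
    case 3
    then show ?thesis by (simp add: coeff_reversed_OP szego_recursion)
  next
    case 4
    then show ?thesis by (auto simp: coeff_reversed_OP coeff_pCons coeff_eq_0 split: nat.splits)
  qed
qed

lemma nsq_shift: "nsq (pCons 0 p) = nsq p"
  using ip_shift[of p p] by (simp add: ip_self)

lemma nsq_reversed_OP: "nsq (\<Phi>s n) = nsq (\<Phi> n)"
  unfolding nsq_def
  by (intro Bochner_Integration.integral_cong) (auto simp: space_eq norm_reversed_OP)

lemma nsq_OP_Suc: "nsq (\<Phi> (Suc n)) = (1 - (norm (\<alpha> n))\<^sup>2) * nsq (\<Phi> n)"
proof -
  have orth: "ip (\<Phi>s n) (\<Phi> (Suc n)) = 0"
    using degree_reversed_OP_le[of n] by (intro ip_OP) simp
  then have orth': "ip (\<Phi> (Suc n)) (\<Phi>s n) = 0"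
    by (simp add: ip_commute[of "\<Phi> (Suc n)"])
  have "ip (pCons 0 (\<Phi> n)) (pCons 0 (\<Phi> n)) = ip (\<Phi> (Suc n)) (\<Phi> (Suc n)) + \<alpha> n * cnj (\<alpha> n) * ip (\<Phi>s n) (\<Phi>s n)"
  proof -
    have "pCons 0 (\<Phi> n) = \<Phi> (Suc n) + smult (cnj (\<alpha> n)) (\<Phi>s n)" by (simp add: szego_recursion)
    then show ?thesis
      using orth orth' by (simp add: ip_add_left ip_add_right ip_smult_left ip_smult_right)
  qed
  then have "complex_of_real (nsq (\<Phi> n)) = of_real (nsq (\<Phi> (Suc n)) + (norm (\<alpha> n))\<^sup>2 * nsq (\<Phi> n))"
    unfolding ip_self nsq_shift nsq_reversed_OP complex_norm_square[symmetric] by simp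
  then have "nsq (\<Phi> n) = nsq (\<Phi> (Suc n)) + (norm (\<alpha> n))\<^sup>2 * nsq (\<Phi> n)"
    by (simp only: of_real_eq_iff)
  then show ?thesis by (simp add: algebra_simps)
qed

lemma norm_verblunsky_less_1: "norm (\<alpha> n) < 1"
proof -
  have "0 < (1 - (norm (\<alpha> n))\<^sup>2) * nsq (\<Phi> n)"
    using nsq_pos[of "\<Phi> (Suc n)"] by (simp add: nsq_OP_Suc)
  then have "(norm (\<alpha> n))\<^sup>2 < 1"
    using nsq_pos[of "\<Phi> n"] by (simp add: zero_less_mult_iff)
  then show ?thesis by (simp add: abs_square_less_1)
qed

lemma rho_sq: "(rho \<mu> k)\<^sup>2 = 1 - (norm (\<alpha> k))\<^sup>2"
  using norm_verblunsky_less_1[of k] by (simp add: rho_def alpha_def abs_square_le_1 less_imp_le)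

lemma rho_pos: "0 < rho \<mu> k"
  using norm_verblunsky_less_1[of k] by (simp add: rho_def alpha_def abs_square_less_1)

lemma rho_le_1: "rho \<mu> k \<le> 1"
  by (simp add: rho_def real_sqrt_le_1_iff)

lemma nsq_OP: "nsq (\<Phi> n) = (\<Prod>k<n. rho \<mu> k)\<^sup>2"
proof (induction n)
  case 0
  then show ?case by (simp add: nsq_def prob_space)
next
  case (Suc n)
  then show ?case by (simp add: nsq_OP_Suc rho_sq power_mult_distrib mult.commute)
qed

text \<open>Among the polynomials of degree at most \<^term>\<open>n\<close> with a given value at the origin, the multiples
  of \<open>\<Phi>\<^sub>n\<^sup>*\<close> have the least norm.\<close>

lemma nsq_ge:
  assumes "degree q \<le> n"
  shows "(norm (poly q 0))\<^sup>2 * (\<Prod>k<n. rho \<mu> k)\<^sup>2 \<le> nsq q"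
proof -
  define c where "c = poly q 0"
  have 1: "ip q (\<Phi>s n) = cnj c * nsq (\<Phi> n)"
    using ip_conj_reverse[OF monic_OP assms] by (simp add: reversed_OP_eq c_def poly_0_coeff_0)
  then have 2: "ip (\<Phi>s n) q = c * nsq (\<Phi> n)"
    by (simp add: ip_commute[of "\<Phi>s n"])
  have "complex_of_real (nsq (q - smult c (\<Phi>s n))) = ip q q - cnj c * ip (\<Phi>s n) q - c * ip q (\<Phi>s n) + c * cnj c * ip (\<Phi>s n) (\<Phi>s n)"
    unfolding ip_self[symmetric]
    by (simp add: ip_diff_left ip_diff_right ip_smult_left ip_smult_right algebra_simps)
  also have "\<dots> = of_real (nsq q) - (c * cnj c) * of_real (nsq (\<Phi> n))"
    unfolding 1 2 ip_self nsq_reversed_OP by (simp add: algebra_simps)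
  also have "\<dots> = of_real (nsq q - (norm c)\<^sup>2 * nsq (\<Phi> n))"
    unfolding complex_norm_square[symmetric] by simp
  finally have "nsq (q - smult c (\<Phi>s n)) = nsq q - (norm c)\<^sup>2 * nsq (\<Phi> n)"
    by (simp only: of_real_eq_iff)
  moreover have "0 \<le> nsq (q - smult c (\<Phi>s n))" by (simp add: nsq_def)
  ultimately show ?thesis by (simp add: nsq_OP c_def)
qed

text \<open>The reversed polynomials have no zeros in the closed disc. With \<open>a = \<Phi>\<^sub>n\<^sup>* z\<close> and \<open>b = z * \<Phi>\<^sub>n z\<close>
  the recursion gives
  \<open>|\<Phi>\<^sub>n\<^sub>+\<^sub>1\<^sup>* z|\<^sup>2 - |\<Phi>\<^sub>n\<^sub>+\<^sub>1 z|\<^sup>2 = (1 - |\<alpha>\<^sub>n|\<^sup>2) * (|a|\<^sup>2 - |b|\<^sup>2)\<close>.\<close>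

lemma norm_OP_le:
  assumes "norm z \<le> 1"
  shows "norm (poly (\<Phi> n) z) \<le> norm (poly (\<Phi>s n) z) \<and> poly (\<Phi>s n) z \<noteq> 0"
proof (induction n)
  case 0
  then show ?case by simp
next
  case (Suc n)
  define a b where "a = poly (\<Phi>s n) z" and "b = z * poly (\<Phi> n) z"
  have ab: "norm b \<le> norm a" "a \<noteq> 0"
    using Suc.IH assms mult_mono[of "norm z" 1 "norm (poly (\<Phi> n) z)" "norm a"]
    by (auto simp: a_def b_def norm_mult)
  have S: "poly (\<Phi> (Suc n)) z = b - cnj (\<alpha> n) * a" "poly (\<Phi>s (Suc n)) z = a - \<alpha> n * b"
    by (simp_all add: szego_recursion szego_recursion_reversed a_def b_def)
  have "(norm (a - \<alpha> n * b))\<^sup>2 - (norm (b - cnj (\<alpha> n) * a))\<^sup>2 = (1 - (norm (\<alpha> n))\<^sup>2) * ((norm a)\<^sup>2 - (norm b)\<^sup>2)"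
    unfolding cmod_power2 by (simp add: power2_eq_square algebra_simps)
  moreover have "0 \<le> (1 - (norm (\<alpha> n))\<^sup>2) * ((norm a)\<^sup>2 - (norm b)\<^sup>2)"
    using ab norm_verblunsky_less_1[of n]
    by (intro mult_nonneg_nonneg) (simp_all add: abs_square_le_1 power_mono less_imp_le)
  ultimately have "(norm (b - cnj (\<alpha> n) * a))\<^sup>2 \<le> (norm (a - \<alpha> n * b))\<^sup>2"
    by linarith
  then have "norm (b - cnj (\<alpha> n) * a) \<le> norm (a - \<alpha> n * b)"
    by (rule power2_le_imp_le) simp
  moreover have "a - \<alpha> n * b \<noteq> 0"
  proof (rule notI)
    assume eq: "a - \<alpha> n * b = 0"
    have "norm (\<alpha> n * b) \<le> norm (\<alpha> n) * norm a"
      unfolding norm_mult using ab(1) by (rule mult_left_mono) simp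
    also have "\<dots> < 1 * norm a"
      using norm_verblunsky_less_1[of n] ab(2) by (intro mult_strict_right_mono) auto
    finally show False using eq by simp
  qed
  ultimately show ?case by (simp add: S)
qed

lemma reversed_OP_nonzero: "norm z \<le> 1 \<Longrightarrow> poly (\<Phi>s n) z \<noteq> 0"
  using norm_OP_le by blast

end

section \<open>Compositions and the coefficients of the orthogonal polynomials\<close>

lemma abs_summable_on_lists:
  fixes f :: "nat \<Rightarrow> int \<Rightarrow> real"
  assumes "\<And>x. f x summable_on UNIV" "\<And>x k. 0 \<le> f x k"
  shows "(\<lambda>k. \<Prod>i<length a. f (a ! i) (k ! i)) summable_on {k. length k = length a}"
proof (induction a)
  case Nil
  have "{k::int list. length k = length ([] :: nat list)} = {[]}" by auto
  then show ?case by (simp add: summable_on_finite)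
next
  case (Cons x a)
  define g where "g k = (\<Prod>i<length a. f (a ! i) (k ! i))" for k
  have g0: "0 \<le> g k" for k unfolding g_def using assms(2) by (intro prod_nonneg) auto
  have "(\<lambda>p. norm (f x (fst p) * g (snd p))) summable_on UNIV \<times> {ks. length ks = length a}"
    unfolding Infinite_Sum.abs_summable_on_Sigma_iff fst_conv snd_conv
  proof (intro conjI ballI)
    show "(\<lambda>ks. norm (f x k * g ks)) summable_on {ks. length ks = length a}" for k
      using summable_on_cmult_right[OF Cons.IH[folded g_def], of "f x k"] g0 assms(2) by simp
    have "(\<lambda>k. f x k * infsum g {ks. length ks = length a}) summable_on UNIV"
      using assms(1) by (intro summable_on_cmult_left)
    then show "(\<lambda>k. norm (\<Sum>\<^sub>\<infinity>ks\<in>{ks. length ks = length a}. norm (f x k * g ks))) summable_on UNIV"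
      using g0 assms(2) by (simp add: infsum_cmult_right' infsum_nonneg)
  qed
  then have "(\<lambda>p. f x (fst p) * g (snd p)) summable_on UNIV \<times> {ks. length ks = length a}"
    by (rule abs_summable_summable)
  moreover have "(\<lambda>p. f x (fst p) * g (snd p)) =
      (\<lambda>k. \<Prod>i<length (x # a). f ((x # a) ! i) (k ! i)) \<circ> (\<lambda>(k, ks). k # ks)"
    by (auto simp: fun_eq_iff g_def prod.lessThan_Suc_shift simp del: prod.lessThan_Suc)
  ultimately have "(\<lambda>k. \<Prod>i<length (x # a). f ((x # a) ! i) (k ! i)) summable_on
      ((\<lambda>(k, ks). k # ks) ` (UNIV \<times> {ks. length ks = length a}))"
    by (subst summable_on_reindex) (auto simp: inj_on_def)
  moreover have "(\<lambda>(k::int, ks). k # ks) ` (UNIV \<times> {ks. length ks = length a}) = {k. length k = length (x # a)}"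
    by (auto simp: length_Suc_conv image_iff)
  ultimately show ?case by simp
qed

text \<open>Unlike \<^const>\<open>ordered_partitions\<close>, this admits the empty composition of \<open>0\<close>, which makes the
  recursion on the first part start correctly.\<close>

definition compositions :: "nat \<Rightarrow> nat list set" where
  "compositions m = {a. (\<forall>x\<in>set a. x \<ge> 1) \<and> sum_list a = m}"

lemma ordered_partitions_eq: "1 \<le> m \<Longrightarrow> ordered_partitions m = compositions m"
  by (auto simp: ordered_partitions_def compositions_def Suc_le_eq)

lemma compositions_0: "compositions 0 = {[]}"
proof -
  have "a = []" if "\<forall>x\<in>set a. x \<ge> 1" "sum_list a = 0" for a :: "nat list"
    using that by (cases a) auto
  then show ?thesis by (auto simp: compositions_def)
qed

lemma compositions_rec:
  assumes "1 \<le> m"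
  shows "compositions m = (\<Union>x\<in>{1..m}. (#) x ` compositions (m - x))"
proof (intro equalityI subsetI)
  fix a assume a: "a \<in> compositions m"
  then obtain x b where "a = x # b" using assms by (cases a) (auto simp: compositions_def)
  then show "a \<in> (\<Union>x\<in>{1..m}. (#) x ` compositions (m - x))"
    using a by (intro UN_I[of x] image_eqI[of _ _ b]) (auto simp: compositions_def)
qed (auto simp: compositions_def)

lemma finite_compositions: "finite (compositions m)"
proof (induction m rule: less_induct)
  case (less m)
  show ?case
  proof (cases "m = 0")
    case False
    then show ?thesis using less.IH by (subst compositions_rec) auto
  qed (simp add: compositions_0)
qed

lemma sum_compositions:
  assumes "1 \<le> m"
  shows "(\<Sum>a\<in>compositions m. f a) = (\<Sum>x=1..m. \<Sum>a\<in>compositions (m - x). f (x # a))"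
proof -
  have "(\<Sum>a\<in>compositions m. f a) = (\<Sum>x=1..m. sum f ((#) x ` compositions (m - x)))"
    unfolding compositions_rec[OF assms]
    by (rule sum.UNION_disjoint) (auto simp: finite_compositions)
  also have "\<dots> = (\<Sum>x=1..m. \<Sum>a\<in>compositions (m - x). f (x # a))"
    by (rule sum.cong[OF refl]) (simp add: sum.reindex)
  finally show ?thesis .
qed

text \<open>The tuples of \<^term>\<open>index_tuples a\<close> with entries at least \<open>-1\<close> and first entry below \<^term>\<open>n\<close>;
  only these contribute to the inner sum, since \<open>\<alpha>\<^sub>k = 0\<close> for \<open>k < -1\<close>.\<close>

fun bounded_tuples :: "int \<Rightarrow> nat list \<Rightarrow> int list set" where
  "bounded_tuples n [] = {[]}"
| "bounded_tuples n (x # a) = (\<Union>k\<in>{-1..<n}. (#) k ` bounded_tuples (k - int x) a)"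

lemma finite_bounded_tuples: "finite (bounded_tuples n a)"
  by (induction a arbitrary: n) auto

lemma index_tuples_Cons:
  "k # ks \<in> index_tuples (x # y # b) \<longleftrightarrow> ks \<in> index_tuples (y # b) \<and> ks ! 0 < k - int x"
  by (auto simp: index_tuples_def less_Suc_eq_0_disj nth_Cons split: nat.splits)

lemma mem_bounded_tuples:
  assumes "a \<noteq> []"
  shows "k \<in> bounded_tuples n a \<longleftrightarrow> k \<in> index_tuples a \<and> k ! 0 < n \<and> (\<forall>i<length a. -1 \<le> k ! i)"
  using assms
proof (induction a arbitrary: n k)
  case (Cons x a)
  show ?case
  proof (cases "k = [] \<or> length k \<noteq> length (x # a)")
    case True
    have "length k = length a" if "k \<in> bounded_tuples n a" for k n a
      using that by (induction a arbitrary: n k) auto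
    then show ?thesis using True by (fastforce simp: index_tuples_def)
  next
    case False
    then obtain k0 ks where k: "k = k0 # ks" "length ks = length a" by (cases k) auto
    show ?thesis
    proof (cases a)
      case Nil
      then show ?thesis using k by (auto simp: index_tuples_def)
    next
      case (Cons y b)
      have "k \<in> bounded_tuples n (x # a) \<longleftrightarrow> -1 \<le> k0 \<and> k0 < n \<and> ks \<in> bounded_tuples (k0 - int x) a"
        using k by auto
      also have "\<dots> \<longleftrightarrow> -1 \<le> k0 \<and> k0 < n \<and> ks \<in> index_tuples a \<and> ks ! 0 < k0 - int x \<and> (\<forall>i<length a. -1 \<le> ks ! i)"
        using Cons.IH[of ks] Cons by simp
      also have "\<dots> \<longleftrightarrow> k \<in> index_tuples (x # a) \<and> k ! 0 < n \<and> (\<forall>i<length (x # a). -1 \<le> k ! i)"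
        using index_tuples_Cons[of k0 ks x y b] Cons k by (simp add: All_less_Suc2) blast
      finally show ?thesis .
    qed
  qed
qed simp

lemma alpha_product_Nil [simp]: "alpha_product \<mu> [] k = 1"
  by (simp add: alpha_product_def)

lemma alpha_product_Cons [simp]:
  "alpha_product \<mu> (x # a) (k # ks) = alpha \<mu> k * cnj (alpha \<mu> (k - int x)) * alpha_product \<mu> a ks"
  by (simp add: alpha_product_def prod.lessThan_Suc_shift del: prod.lessThan_Suc)

lemma alpha_product_eq_0:
  assumes "i < length a" "k ! i < -1"
  shows "alpha_product \<mu> a k = 0"
  unfolding alpha_product_def using assms by (intro prod_zero) (auto simp: alpha_def intro!: bexI[of _ i])

text \<open>The inner sum of the formula for \<open>\<lambda>\<^sub>n\<^sub>,\<^sub>m\<close>, as a finite sum.\<close>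

definition tuple_sum :: "complex measure \<Rightarrow> int \<Rightarrow> nat list \<Rightarrow> complex" where
  "tuple_sum \<mu> n a = (\<Sum>k\<in>bounded_tuples n a. alpha_product \<mu> a k)"

lemma tuple_sum_Nil [simp]: "tuple_sum \<mu> n [] = 1"
  by (simp add: tuple_sum_def)

lemma tuple_sum_Cons:
  "tuple_sum \<mu> n (x # a) = (\<Sum>k\<in>{-1..<n}. alpha \<mu> k * cnj (alpha \<mu> (k - int x)) * tuple_sum \<mu> (k - int x) a)"
proof -
  have "tuple_sum \<mu> n (x # a) = (\<Sum>k\<in>{-1..<n}. sum (alpha_product \<mu> (x # a)) ((#) k ` bounded_tuples (k - int x) a))"
    unfolding tuple_sum_def bounded_tuples.simps
    by (rule sum.UNION_disjoint) (auto simp: finite_bounded_tuples)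
  also have "\<dots> = (\<Sum>k\<in>{-1..<n}. alpha \<mu> k * cnj (alpha \<mu> (k - int x)) * tuple_sum \<mu> (k - int x) a)"
    by (rule sum.cong[OF refl]) (simp add: sum.reindex tuple_sum_def sum_distrib_left)
  finally show ?thesis .
qed

lemma infsum_index_tuples:
  assumes "a \<noteq> []"
  shows "(\<Sum>\<^sub>\<infinity>k\<in>{k \<in> index_tuples a. k ! 0 < n}. alpha_product \<mu> a k) = tuple_sum \<mu> n a"
proof -
  have "(\<Sum>\<^sub>\<infinity>k\<in>{k \<in> index_tuples a. k ! 0 < n}. alpha_product \<mu> a k) =
      (\<Sum>\<^sub>\<infinity>k\<in>bounded_tuples n a. alpha_product \<mu> a k)"
  proof (rule infsum_cong_neutral)
    fix k assume "k \<in> {k \<in> index_tuples a. k ! 0 < n} - bounded_tuples n a"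
    then obtain i where "i < length a" "k ! i < -1"
      using mem_bounded_tuples[OF assms] by (auto simp: not_le)
    then show "alpha_product \<mu> a k = 0" by (rule alpha_product_eq_0)
  qed (use mem_bounded_tuples[OF assms] in auto)
  then show ?thesis by (simp add: tuple_sum_def finite_bounded_tuples)
qed

lemma tuple_sum_tendsto:
  assumes a: "a \<noteq> []" and sum: "alpha_product \<mu> a summable_on index_tuples a"
  shows "(\<lambda>n::nat. tuple_sum \<mu> (int n) a) \<longlonglongrightarrow> infsum (alpha_product \<mu> a) (index_tuples a)"
proof -
  define T where "T = {k \<in> index_tuples a. \<forall>i<length a. -1 \<le> k ! i}"
  have "(alpha_product \<mu> a has_sum infsum (alpha_product \<mu> a) (index_tuples a)) (index_tuples a)"
    using sum by (rule has_sum_infsum)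
  then have "(alpha_product \<mu> a has_sum infsum (alpha_product \<mu> a) (index_tuples a)) T"
  proof (rule has_sum_cong_neutral[THEN iffD1, rotated -1])
    fix k assume "k \<in> index_tuples a - T"
    then obtain i where "i < length a" "k ! i < -1" by (auto simp: T_def not_le)
    then show "alpha_product \<mu> a k = 0" by (rule alpha_product_eq_0)
  qed (auto simp: T_def)
  then have "(sum (alpha_product \<mu> a) \<longlongrightarrow> infsum (alpha_product \<mu> a) (index_tuples a)) (finite_subsets_at_top T)"
    by (simp add: has_sum_def)
  moreover have "filterlim (\<lambda>n. bounded_tuples (int n) a) (finite_subsets_at_top T) sequentially"
    unfolding filterlim_finite_subsets_at_top
  proof (intro allI impI)
    fix X assume X: "finite X \<and> X \<subseteq> T"
    define N where "N = Max (insert 0 ((\<lambda>k. nat (k ! 0) + 1) ` X))"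
    have N: "nat (k ! 0) + 1 \<le> N" if "k \<in> X" for k
      unfolding N_def using X that by (intro Max_ge) auto
    show "\<forall>\<^sub>F n in sequentially. finite (bounded_tuples (int n) a) \<and> X \<subseteq> bounded_tuples (int n) a \<and> bounded_tuples (int n) a \<subseteq> T"
      using eventually_ge_at_top[of N]
    proof eventually_elim
      case (elim n)
      have "k \<in> bounded_tuples (int n) a" if "k \<in> X" for k
        using N[OF that] that X elim mem_bounded_tuples[OF a] by (auto simp: T_def)
      then show ?case
        using finite_bounded_tuples mem_bounded_tuples[OF a] by (auto simp: T_def)
    qed
  qed
  ultimately show ?thesis
    unfolding tuple_sum_def by (rule filterlim_compose)
qed

lemma alpha_sq_summable_on:
  assumes "summable (\<lambda>k. (norm (alpha \<mu> (int k)))\<^sup>2)"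
  shows "(\<lambda>k. (norm (alpha \<mu> k))\<^sup>2) summable_on UNIV"
proof -
  define h where "h n = (norm (alpha \<mu> (int n - 1)))\<^sup>2" for n
  have "h (Suc n) = (norm (alpha \<mu> (int n)))\<^sup>2" for n by (simp add: h_def)
  then have "summable (\<lambda>n. norm (h n))"
    using assms by (subst summable_Suc_iff[symmetric]) (simp add: h_def)
  then have "h summable_on UNIV" by (rule norm_summable_imp_summable_on)
  then have "((\<lambda>k. (norm (alpha \<mu> k))\<^sup>2) \<circ> (\<lambda>n. int n - 1)) summable_on UNIV"
    by (simp add: h_def[abs_def] comp_def)
  then have "(\<lambda>k. (norm (alpha \<mu> k))\<^sup>2) summable_on range (\<lambda>n. int n - 1)"
    by (subst summable_on_reindex) (auto simp: inj_on_def)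
  then show ?thesis
  proof (rule summable_on_cong_neutral[THEN iffD1, rotated -1])
    fix k assume "k \<in> UNIV - range (\<lambda>n. int n - 1)"
    then have "k \<noteq> int (nat (k + 1)) - 1" by blast
    then have "k < -1" by linarith
    then show "(norm (alpha \<mu> k))\<^sup>2 = 0" by (simp add: alpha_def)
  qed auto
qed

text \<open>Without the inequalities between the \<open>k\<^sub>i\<close> the sum of the absolute values factors into the sums
  \<open>\<Sum>k. |\<alpha>\<^sub>k * \<alpha>\<^sub>k\<^sub>-\<^sub>a|\<close>, which are finite as \<open>\<alpha>\<close> is square summable.\<close>

lemma alpha_product_abs_summable:
  assumes "summable (\<lambda>k. (norm (alpha \<mu> (int k)))\<^sup>2)"
  shows "(\<lambda>k. norm (alpha_product \<mu> a k)) summable_on index_tuples a"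
proof -
  define f where "f x k = norm (alpha \<mu> k * cnj (alpha \<mu> (k - int x)))" for x k
  have "f x summable_on UNIV" for x
  proof (rule summable_on_comparison_test)
    have "(\<lambda>k. (norm (alpha \<mu> (k - int x)))\<^sup>2) summable_on UNIV"
      using alpha_sq_summable_on[OF assms]
        summable_on_reindex_bij_betw[of "\<lambda>k. k - int x" UNIV UNIV "\<lambda>k. (norm (alpha \<mu> k))\<^sup>2"]
        bij_betw_byWitness[of UNIV "\<lambda>k. k + int x" "\<lambda>k. k - int x" UNIV] by simp
    then show "(\<lambda>k. (norm (alpha \<mu> k))\<^sup>2 + (norm (alpha \<mu> (k - int x)))\<^sup>2) summable_on UNIV"
      using alpha_sq_summable_on[OF assms] by (intro summable_on_add)
    show "f x k \<le> (norm (alpha \<mu> k))\<^sup>2 + (norm (alpha \<mu> (k - int x)))\<^sup>2" for k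
      using sum_squares_bound[of "norm (alpha \<mu> k)" "norm (alpha \<mu> (k - int x))"]
        mult_nonneg_nonneg[OF norm_ge_zero norm_ge_zero, of "alpha \<mu> k" "alpha \<mu> (k - int x)"]
      unfolding f_def norm_mult complex_mod_cnj by linarith
  qed (simp add: f_def)
  then have "(\<lambda>k. \<Prod>i<length a. f (a ! i) (k ! i)) summable_on {k. length k = length a}"
    by (rule abs_summable_on_lists) (simp add: f_def)
  moreover have "(\<lambda>k. \<Prod>i<length a. f (a ! i) (k ! i)) = (\<lambda>k. norm (alpha_product \<mu> a k))"
    by (simp add: f_def alpha_product_def prod_norm fun_eq_iff)
  ultimately show ?thesis
    by (auto simp: index_tuples_def intro: summable_on_subset_banach)
qed

context nontrivial_circle_measure
begin

text \<open>By the conventions for negative indices the Szego recursions hold for all integers \<^term>\<open>n\<close>.\<close>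

lemma kappa_rec: "kappa \<mu> (n + 1) (int l) = kappa \<mu> n (int l - 1) - cnj (alpha \<mu> n) * lambda \<mu> n l"
proof -
  consider m where "n = int m" | "n = -1" | "n < -1"
    using zero_le_imp_eq_int[of n] by fastforce
  then show ?thesis
  proof cases
    case 1
    then show ?thesis
      by (cases l) (auto simp: kappa_def lambda_def alpha_def nat_add_distrib szego_recursion)
  qed (auto simp: kappa_def lambda_def alpha_def)
qed

lemma lambda_rec: "lambda \<mu> (n + 1) l = lambda \<mu> n l - alpha \<mu> n * kappa \<mu> n (int l - 1)"
proof -
  consider m where "n = int m" | "n = -1" | "n < -1"
    using zero_le_imp_eq_int[of n] by fastforce
  then show ?thesis
  proof cases
    case 1
    then show ?thesis
      by (cases l) (auto simp: kappa_def lambda_def alpha_def nat_add_distrib szego_recursion_reversed)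
  qed (auto simp: kappa_def lambda_def alpha_def)
qed

text \<open>Iterating the recursion lowers the coefficient index down to \<open>-1\<close>, where \<open>\<kappa>\<close> vanishes.\<close>

lemma kappa_eq_sum:
  "kappa \<mu> n (int m - 1) = - (\<Sum>x=1..m. cnj (alpha \<mu> (n - int x)) * lambda \<mu> (n - int x) (m - x))"
proof (induction m arbitrary: n)
  case 0
  then show ?case by (simp add: kappa_def)
next
  case (Suc m)
  have "kappa \<mu> n (int (Suc m) - 1) = kappa \<mu> (n - 1) (int m - 1) - cnj (alpha \<mu> (n - 1)) * lambda \<mu> (n - 1) m"
    using kappa_rec[of "n - 1" m] by simp
  also have "kappa \<mu> (n - 1) (int m - 1) =
      - (\<Sum>x=1..m. cnj (alpha \<mu> (n - int (Suc x))) * lambda \<mu> (n - int (Suc x)) (Suc m - Suc x))"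
    unfolding Suc.IH by (simp add: algebra_simps)
  also have "(\<Sum>x=1..m. cnj (alpha \<mu> (n - int (Suc x))) * lambda \<mu> (n - int (Suc x)) (Suc m - Suc x)) =
      (\<Sum>x=2..Suc m. cnj (alpha \<mu> (n - int x)) * lambda \<mu> (n - int x) (Suc m - x))"
    using sum.shift_bounds_cl_Suc_ivl[of "\<lambda>x. cnj (alpha \<mu> (n - int x)) * lambda \<mu> (n - int x) (Suc m - x)" 1 m]
    by (simp add: numeral_2_eq_2)
  also have "- \<dots> - cnj (alpha \<mu> (n - 1)) * lambda \<mu> (n - 1) m =
      - (\<Sum>x=1..Suc m. cnj (alpha \<mu> (n - int x)) * lambda \<mu> (n - int x) (Suc m - x))"
    by (subst sum.atLeast_Suc_atMost[of 1]) (simp_all add: numeral_2_eq_2)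
  finally show ?case .
qed

lemma lambda_eq_sum:
  assumes "1 \<le> m"
  shows "lambda \<mu> n m = (\<Sum>k\<in>{-1..<n}. \<Sum>x=1..m.
           alpha \<mu> k * cnj (alpha \<mu> (k - int x)) * lambda \<mu> (k - int x) (m - x))"
proof (cases "n < -1")
  case True
  then show ?thesis using assms by (simp add: lambda_def)
next
  case False
  then have "-1 \<le> n" by simp
  then show ?thesis
  proof (induction n rule: int_ge_induct)
    case base
    then show ?case using assms by (simp add: lambda_def)
  next
    case (step n)
    have "{-1..<n + 1} = insert n {-1..<n}" using step.hyps by auto
    then show ?case
      using step.IH by (simp add: lambda_rec kappa_eq_sum sum_distrib_left mult.assoc)
  qed
qed

lemma lambda_0: "lambda \<mu> n 0 = 1"
  by (simp add: lambda_def coeff_reversed_OP)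

text \<open>Expanding \<open>\<lambda>\<^sub>k\<^sub>-\<^sub>x\<^sub>,\<^sub>m\<^sub>-\<^sub>x\<close> again in \<open>lambda_eq_sum\<close> produces the compositions of \<^term>\<open>m\<close> with first
  part \<^term>\<open>x\<close>, and the tuples with first entry \<^term>\<open>k\<close>.\<close>

lemma lambda_eq_tuple_sum: "lambda \<mu> n m = (\<Sum>a\<in>compositions m. tuple_sum \<mu> n a)"
proof (induction m arbitrary: n rule: less_induct)
  case (less m)
  show ?case
  proof (cases "m = 0")
    case True
    then show ?thesis by (simp add: lambda_0 compositions_0)
  next
    case False
    then have m: "1 \<le> m" by simp
    have "lambda \<mu> n m = (\<Sum>k\<in>{-1..<n}. \<Sum>x=1..m. \<Sum>a\<in>compositions (m - x).
        alpha \<mu> k * cnj (alpha \<mu> (k - int x)) * tuple_sum \<mu> (k - int x) a)"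
      unfolding lambda_eq_sum[OF m] using less.IH
      by (intro sum.cong refl) (simp add: sum_distrib_left)
    also have "\<dots> = (\<Sum>x=1..m. \<Sum>k\<in>{-1..<n}. \<Sum>a\<in>compositions (m - x).
        alpha \<mu> k * cnj (alpha \<mu> (k - int x)) * tuple_sum \<mu> (k - int x) a)"
      by (rule sum.swap)
    also have "\<dots> = (\<Sum>x=1..m. \<Sum>a\<in>compositions (m - x). tuple_sum \<mu> n (x # a))"
      unfolding tuple_sum_Cons by (intro sum.cong refl sum.swap)
    also have "\<dots> = (\<Sum>a\<in>compositions m. tuple_sum \<mu> n a)"
      by (rule sum_compositions[OF m, symmetric])
    finally show ?thesis .
  qed
qed

lemma compositions_nonempty: "1 \<le> m \<Longrightarrow> a \<in> compositions m \<Longrightarrow> a \<noteq> []"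
  by (auto simp: compositions_def)

lemma lambda_formula:
  assumes "1 \<le> m"
  shows "lambda \<mu> n m = (\<Sum>a\<in>ordered_partitions m. \<Sum>\<^sub>\<infinity>k\<in>{k \<in> index_tuples a. k ! 0 < n}. alpha_product \<mu> a k)"
  unfolding lambda_eq_tuple_sum ordered_partitions_eq[OF assms]
  using compositions_nonempty[OF assms] by (intro sum.cong refl) (simp add: infsum_index_tuples)

lemma cnj_kappa:
  assumes "1 \<le> m"
  shows "cnj (kappa \<mu> n (n - int m)) = lambda \<mu> n m"
proof (cases "0 \<le> n")
  case True
  then obtain N where "n = int N" by (metis nonneg_int_cases)
  then show ?thesis by (simp add: kappa_def lambda_def coeff_reversed_OP nat_diff_distrib)
next
  case False
  then show ?thesis using assms by (simp add: kappa_def lambda_def)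
qed

lemma reversed_OP_coeff_tendsto:
  assumes "summable (\<lambda>k. (norm (alpha \<mu> (int k)))\<^sup>2)" and m: "1 \<le> m"
  shows "(\<lambda>n. coeff (\<Phi>s n) m) \<longlonglongrightarrow>
           (\<Sum>a\<in>ordered_partitions m. \<Sum>\<^sub>\<infinity>k\<in>index_tuples a. alpha_product \<mu> a k)"
proof -
  have "coeff (\<Phi>s n) m = (\<Sum>a\<in>compositions m. tuple_sum \<mu> (int n) a)" for n
    using lambda_eq_tuple_sum[of "int n" m] by (simp add: lambda_def)
  moreover have "alpha_product \<mu> a summable_on index_tuples a" for a
    using alpha_product_abs_summable[OF assms(1)] by (rule abs_summable_summable)
  ultimately show ?thesis
    unfolding ordered_partitions_eq[OF m]
    using compositions_nonempty[OF m] by (auto intro!: tendsto_sum tuple_sum_tendsto)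
qed

end

section \<open>Density of trigonometric polynomials and of continuous functions\<close>

text \<open>Functions that agree on the unit circle with the real part of an analytic polynomial; these are
  the real trigonometric polynomials.\<close>

definition trig_poly :: "(complex \<Rightarrow> real) \<Rightarrow> bool" where
  "trig_poly g \<longleftrightarrow> (\<exists>p :: complex poly. \<forall>z. norm z = 1 \<longrightarrow> g z = Re (poly p z))"

lemma trig_poly_Re_poly: "trig_poly (\<lambda>z. Re (poly p z))"
  unfolding trig_poly_def by auto

lemma trig_poly_const: "trig_poly (\<lambda>z. c)"
  using trig_poly_Re_poly[of "[:of_real c:]"] by simp

lemma trig_poly_add: "trig_poly f \<Longrightarrow> trig_poly g \<Longrightarrow> trig_poly (\<lambda>z. f z + g z)"
  unfolding trig_poly_def by (metis plus_complex.sel(1) poly_add)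

lemma trig_poly_cmult:
  assumes "trig_poly f" shows "trig_poly (\<lambda>z. c * f z)"
proof -
  obtain p where "\<forall>z. norm z = 1 \<longrightarrow> f z = Re (poly p z)" using assms by (auto simp: trig_poly_def)
  then show ?thesis unfolding trig_poly_def by (intro exI[of _ "smult (of_real c) p"]) auto
qed

lemma trig_poly_sum: "finite I \<Longrightarrow> (\<And>i. i \<in> I \<Longrightarrow> trig_poly (f i)) \<Longrightarrow> trig_poly (\<lambda>z. \<Sum>i\<in>I. f i z)"
  by (induction I rule: finite_induct) (auto intro: trig_poly_add trig_poly_const)

lemma trig_poly_cong: "trig_poly f \<Longrightarrow> (\<And>z. norm z = 1 \<Longrightarrow> f z = g z) \<Longrightarrow> trig_poly g"
  unfolding trig_poly_def by auto

lemma trig_poly_monomial: "trig_poly (\<lambda>z. Re (c * z ^ i * cnj z ^ j))"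
proof (cases "j \<le> i")
  case True
  show ?thesis
  proof (rule trig_poly_cong[OF trig_poly_Re_poly[of "monom c (i - j)"]])
    fix z :: complex assume "norm z = 1"
    then have z: "z * cnj z = 1" using complex_norm_square[of z] by simp
    have "z ^ i * cnj z ^ j = z ^ (i - j) * (z * cnj z) ^ j"
      using True by (simp add: power_mult_distrib flip: power_add mult.assoc)
    then show "Re (poly (monom c (i - j)) z) = Re (c * z ^ i * cnj z ^ j)"
      using z by (simp add: poly_monom mult.assoc)
  qed
next
  case False
  show ?thesis
  proof (rule trig_poly_cong[OF trig_poly_Re_poly[of "monom (cnj c) (j - i)"]])
    fix z :: complex assume "norm z = 1"
    then have z: "z * cnj z = 1" using complex_norm_square[of z] by simp
    have "z ^ i * cnj z ^ j = (z * cnj z) ^ i * cnj z ^ (j - i)"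
      using False by (simp add: power_mult_distrib mult.assoc flip: power_add)
    then have "c * z ^ i * cnj z ^ j = cnj (cnj c * z ^ (j - i))"
      using z by (simp add: mult.assoc)
    then show "Re (poly (monom (cnj c) (j - i)) z) = Re (c * z ^ i * cnj z ^ j)"
      by (simp only: poly_monom cnj.sel)
  qed
qed

text \<open>Use \<open>2 * Re a * Re b = Re (a * b) + Re (a * cnj b)\<close>.\<close>

lemma trig_poly_mult:
  assumes "trig_poly f" "trig_poly g" shows "trig_poly (\<lambda>z. f z * g z)"
proof -
  obtain p q where p: "\<And>z. norm z = 1 \<Longrightarrow> f z = Re (poly p z)"
    and q: "\<And>z. norm z = 1 \<Longrightarrow> g z = Re (poly q z)"
    using assms by (auto simp: trig_poly_def)
  have "trig_poly (\<lambda>z. \<Sum>i\<le>degree p. \<Sum>j\<le>degree q. Re (coeff p i * cnj (coeff q j) * z ^ i * cnj z ^ j))"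
    by (intro trig_poly_sum trig_poly_monomial) auto
  moreover have "(\<Sum>i\<le>degree p. \<Sum>j\<le>degree q. Re (coeff p i * cnj (coeff q j) * z ^ i * cnj z ^ j)) =
      Re (poly p z * cnj (poly q z))" for z
    unfolding poly_altdef[of p] poly_altdef[of q] cnj_sum sum_product Re_sum
    by (simp add: mult_ac)
  ultimately have "trig_poly (\<lambda>z. 1/2 * (Re (poly (p * q) z) + Re (poly p z * cnj (poly q z))))"
    by (intro trig_poly_cmult trig_poly_add trig_poly_Re_poly) simp
  then show ?thesis
    by (rule trig_poly_cong) (simp add: p q)
qed

lemma real_polynomial_function_trig_poly:
  "real_polynomial_function f \<Longrightarrow> trig_poly f"
proof (induction rule: real_polynomial_function.induct)
  case (linear f)
  then interpret bounded_linear f .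
  show ?case
    unfolding trig_poly_def
  proof (intro exI[of _ "[:0, of_real (f 1) - \<i> * of_real (f \<i>):]"] allI impI)
    fix z :: complex
    have "z = Re z *\<^sub>R 1 + Im z *\<^sub>R \<i>" by (simp add: complex_eq_iff)
    then have "f z = Re z * f 1 + Im z * f \<i>" by (metis add scaleR real_scaleR_def)
    then show "f z = Re (poly [:0, of_real (f 1) - \<i> * of_real (f \<i>):] z)" by simp
  qed
qed (auto intro: trig_poly_const trig_poly_add trig_poly_mult)

lemma circle_Stone_Weierstrass:
  fixes f :: "complex \<Rightarrow> real"
  assumes "continuous_on (sphere 0 1) f" "0 < e"
  obtains p :: "complex poly" where "\<And>z. norm z = 1 \<Longrightarrow> \<bar>f z - Re (poly p z)\<bar> < e"
proof -
  obtain g where g: "real_polynomial_function g" "\<And>z. z \<in> sphere 0 1 \<Longrightarrow> \<bar>f z - g z\<bar> < e"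
    using Stone_Weierstrass_real_polynomial_function[OF _ assms] by auto
  obtain p where "\<forall>z. norm z = 1 \<longrightarrow> g z = Re (poly p z)"
    using real_polynomial_function_trig_poly[OF g(1)] by (auto simp: trig_poly_def)
  then show thesis using g(2) that[of p] by auto
qed

lemma inner_regular_approx:
  fixes M :: "complex measure"
  assumes M: "finite_measure M" "sets M = sets borel" and A: "A \<in> sets borel" and e: "0 < e"
  obtains K where "compact K" "K \<subseteq> A" "measure M A \<le> measure M K + e"
proof (cases "measure M A \<le> e")
  case True
  then show ?thesis using that[of "{}"] by simp
next
  case False
  interpret finite_measure M by fact
  have "emeasure M A = (SUP K \<in> {K. K \<subseteq> A \<and> compact K}. emeasure M K)"
    using M A by (intro inner_regular) auto
  moreover have "ennreal (measure M A - e) < emeasure M A"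
    using False e by (simp add: emeasure_eq_measure ennreal_less_iff)
  ultimately obtain K where K: "K \<subseteq> A" "compact K" "ennreal (measure M A - e) < emeasure M K"
    by (auto simp: less_SUP_iff)
  then have "measure M A - e < measure M K"
    using False by (simp add: emeasure_eq_measure ennreal_less_iff)
  then show ?thesis using K that[of K] by simp
qed

lemma indicator_L1_approx:
  fixes \<M> :: "complex measure set"
  assumes fin: "finite \<M>" and M: "\<And>M. M \<in> \<M> \<Longrightarrow> finite_measure M \<and> sets M = sets borel"
    and A: "A \<in> sets borel" and e: "0 < e"
  shows "\<exists>g. continuous_on UNIV g \<and> (\<forall>z. 0 \<le> g z \<and> g z \<le> (1::real)) \<and>
           (\<forall>M\<in>\<M>. (LINT z|M. \<bar>g z - indicator A z\<bar>) \<le> e)"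
proof -
  have "\<forall>M\<in>\<M>. \<exists>K. compact K \<and> K \<subseteq> A \<and> measure M A \<le> measure M K + e / 2"
    using inner_regular_approx[of _ A "e / 2"] M A e by (metis half_gt_zero)
  then obtain K where K: "\<And>M. M \<in> \<M> \<Longrightarrow> compact (K M) \<and> K M \<subseteq> A \<and> measure M A \<le> measure M (K M) + e / 2"
    by metis
  have "\<forall>M\<in>\<M>. \<exists>K. compact K \<and> K \<subseteq> - A \<and> measure M (- A) \<le> measure M K + e / 2"
    using inner_regular_approx[of _ "- A" "e / 2"] M A e by (metis borel_comp half_gt_zero)
  then obtain L where L: "\<And>M. M \<in> \<M> \<Longrightarrow> compact (L M) \<and> L M \<subseteq> - A \<and> measure M (- A) \<le> measure M (L M) + e / 2"
    by metis
  define KK LL where "KK = (\<Union>M\<in>\<M>. K M)" and "LL = (\<Union>M\<in>\<M>. L M)"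
  have KL: "compact KK" "compact LL" "KK \<subseteq> A" "LL \<subseteq> - A"
    unfolding KK_def LL_def using fin K L by (auto intro!: compact_UN)
  then have "closed KK" "closed LL" "KK \<inter> LL = {}" by (auto intro: compact_imp_closed)
  then obtain g :: "complex \<Rightarrow> real" where g: "continuous_on UNIV g"
    "\<And>z. g z \<in> closed_segment 1 0" "\<And>z. z \<in> KK \<Longrightarrow> g z = 1" "\<And>z. z \<in> LL \<Longrightarrow> g z = 0"
    by (rule Urysohn[where a = "1::real" and b = 0]) auto
  have g01: "0 \<le> g z" "g z \<le> 1" for z
    using g(2)[of z] by (auto simp: closed_segment_eq_real_ivl)
  have "(LINT z|M. \<bar>g z - indicator A z\<bar>) \<le> e" if "M \<in> \<M>" for M
  proof -
    interpret finite_measure M using M[OF that] by simp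
    have sM: "sets M = sets borel" using M[OF that] by simp
    have sp: "space M = UNIV" using sets_eq_imp_space_eq[OF sM] by simp
    have [measurable]: "g \<in> borel_measurable M"
      using borel_measurable_continuous_onI[OF g(1)] by (simp add: measurable_cong_sets[OF sM refl])
    have [measurable]: "A \<in> sets M" "- A \<in> sets M" "KK \<in> sets M" "LL \<in> sets M" "K M \<in> sets M" "L M \<in> sets M"
      unfolding sM using A KL K[OF that] L[OF that] by (auto intro: borel_compact)
    have "(LINT z|M. \<bar>g z - indicator A z\<bar>) \<le> (LINT z|M. indicator (A - KK) z + indicator (- A - LL) z)"
    proof (rule integral_mono)
      show "integrable M (\<lambda>z. \<bar>g z - indicator A z\<bar>)"
      proof (rule integrable_const_bound[of _ 1], rule AE_I2)
        show "norm \<bar>g z - indicator A z\<bar> \<le> 1" for z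
          using g01[of z] by (auto simp: indicator_def)
      qed measurable
      show "\<bar>g z - indicator A z\<bar> \<le> indicator (A - KK) z + indicator (- A - LL) z" for z
        using g(3,4)[of z] g01[of z] by (auto simp: indicator_def)
    qed (auto simp: less_top[symmetric])
    also have "\<dots> = measure M (A - KK) + measure M (- A - LL)"
      by (subst Bochner_Integration.integral_add) (auto simp: less_top[symmetric] sp)
    also have "measure M (A - KK) \<le> measure M (A - K M)"
      by (rule finite_measure_mono) (use that in \<open>auto simp: KK_def\<close>)
    also have "measure M (A - K M) = measure M A - measure M (K M)"
      using K[OF that] by (intro finite_measure_Diff) auto
    also have "measure M (- A - LL) \<le> measure M (- A - L M)"
      by (rule finite_measure_mono) (use that in \<open>auto simp: LL_def\<close>)
    also have "measure M (- A - L M) = measure M (- A) - measure M (L M)"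
      using L[OF that] by (intro finite_measure_Diff) auto
    finally show ?thesis using K[OF that] L[OF that] by simp
  qed
  then show ?thesis using g(1) g01 by blast
qed

lemma nonneg_L1_approx:
  fixes \<M> :: "complex measure set" and u :: "complex \<Rightarrow> real"
  assumes fin: "finite \<M>" and M: "\<And>M. M \<in> \<M> \<Longrightarrow> finite_measure M \<and> sets M = sets borel"
    and u: "u \<in> borel_measurable borel" "\<And>z. 0 \<le> u z"
  shows "(\<exists>C. \<forall>z. u z \<le> C) \<longrightarrow> (\<forall>e>0. \<exists>g. continuous_on UNIV g \<and> (\<exists>B. \<forall>z. \<bar>g z\<bar> \<le> B) \<and>
           (\<forall>M\<in>\<M>. (LINT z|M. \<bar>g z - u z\<bar>) \<le> e))"
proof -
  have meas: "f \<in> borel_measurable M" if "M \<in> \<M>" "f \<in> borel_measurable borel" for f :: "complex \<Rightarrow> real" and M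
    using M[OF that(1)] that(2) measurable_cong_sets[of M borel borel borel] by blast
  have int: "integrable M f" if "M \<in> \<M>" "f \<in> borel_measurable borel" "\<And>z. \<bar>f z\<bar> \<le> B" for f M and B :: real
  proof (rule finite_measure.integrable_const_bound[where B = B])
    show "finite_measure M" using M[OF that(1)] by simp
    show "AE z in M. norm (f z) \<le> B" using that(3) by (intro AE_I2) simp
    show "f \<in> borel_measurable M" using meas[OF that(1,2)] .
  qed
  have intc: "integrable M f" if as: "M \<in> \<M>" "continuous_on UNIV f" "\<exists>B. \<forall>z. \<bar>f z\<bar> \<le> B" for f :: "complex \<Rightarrow> real" and M
  proof -
    obtain B where "\<And>z. \<bar>f z\<bar> \<le> B" using as(3) by blast
    then show ?thesis by (rule int[OF as(1) borel_measurable_continuous_onI[OF as(2)]])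
  qed
  show ?thesis
    using u
  proof (induction rule: borel_measurable_induct_real)
    case (set A)
    then have "A \<in> sets borel" by simp
    show ?case
    proof (intro impI allI)
      fix e :: real assume "0 < e"
      then obtain g where "continuous_on UNIV g" "\<forall>z. 0 \<le> g z \<and> g z \<le> (1::real)"
        "\<forall>M\<in>\<M>. (LINT z|M. \<bar>g z - indicator A z\<bar>) \<le> e"
        using indicator_L1_approx[OF fin M \<open>A \<in> sets borel\<close>] by metis
      then show "\<exists>g. continuous_on UNIV g \<and> (\<exists>B. \<forall>z. \<bar>g z\<bar> \<le> B) \<and>
          (\<forall>M\<in>\<M>. (LINT z|M. \<bar>g z - indicator A z\<bar>) \<le> e)"
        by (intro exI[of _ g] conjI exI[of _ 1]) auto
    qed
  next
    case (mult u c)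
    show ?case
    proof (cases "c = 0")
      case True
      then show ?thesis by (auto intro!: exI[of _ "\<lambda>_. 0"])
    next
      case False
      then have c: "0 < c" using mult by simp
      show ?thesis
      proof (intro impI allI)
        fix e :: real assume e: "0 < e" and "\<exists>C. \<forall>z. c * u z \<le> C"
        then have "\<exists>C. \<forall>z. u z \<le> C" using c by (metis mult.commute pos_le_divide_eq)
        then obtain g where g: "continuous_on UNIV g" "\<exists>B. \<forall>z. \<bar>g z\<bar> \<le> B"
          "\<And>M. M \<in> \<M> \<Longrightarrow> (LINT z|M. \<bar>g z - u z\<bar>) \<le> e / c"
          using mult.IH e c by (metis divide_pos_pos)
        obtain B where "\<And>z. \<bar>g z\<bar> \<le> B" using g(2) by blast
        then have "\<bar>c * g z\<bar> \<le> c * B" for z using c by (simp add: abs_mult)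
        moreover have "(LINT z|M. \<bar>c * g z - c * u z\<bar>) \<le> e" if "M \<in> \<M>" for M
        proof -
          have "\<bar>c * g z - c * u z\<bar> = c * \<bar>g z - u z\<bar>" for z
            using c by (simp add: abs_mult flip: right_diff_distrib)
          then show ?thesis using g(3)[OF that] c by (simp add: field_simps)
        qed
        ultimately show "\<exists>g. continuous_on UNIV g \<and> (\<exists>B. \<forall>z. \<bar>g z\<bar> \<le> B) \<and>
            (\<forall>M\<in>\<M>. (LINT z|M. \<bar>g z - c * u z\<bar>) \<le> e)"
          using g(1) by (intro exI[of _ "\<lambda>z. c * g z"] conjI continuous_intros) auto
      qed
    qed
  next
    case (add u v)
    show ?case
    proof (intro impI allI)
      fix e :: real assume e: "0 < e" and "\<exists>C. \<forall>z. v z + u z \<le> C"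
      then obtain C where C: "\<And>z. v z + u z \<le> C" by blast
      have bd: "u z \<le> C" "v z \<le> C" for z using C[of z] add.hyps(2,4)[of z] by linarith+
      obtain g where g: "continuous_on UNIV g" "\<exists>B. \<forall>z. \<bar>g z\<bar> \<le> B" "\<And>M. M \<in> \<M> \<Longrightarrow> (LINT z|M. \<bar>g z - u z\<bar>) \<le> e / 2"
        using add.IH(1) e bd by (metis half_gt_zero)
      obtain k where k: "continuous_on UNIV k" "\<exists>B. \<forall>z. \<bar>k z\<bar> \<le> B" "\<And>M. M \<in> \<M> \<Longrightarrow> (LINT z|M. \<bar>k z - v z\<bar>) \<le> e / 2"
        using add.IH(2) e bd by (metis half_gt_zero)
      obtain B B' where B: "\<And>z. \<bar>g z\<bar> \<le> B" "\<And>z. \<bar>k z\<bar> \<le> B'" using g(2) k(2) by blast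
      have "\<bar>k z + g z\<bar> \<le> B' + B" for z using B(1)[of z] B(2)[of z] by linarith
      moreover have "(LINT z|M. \<bar>k z + g z - (v z + u z)\<bar>) \<le> e" if "M \<in> \<M>" for M
      proof -
        have "\<bar>u z\<bar> \<le> C" "\<bar>v z\<bar> \<le> C" for z
          using bd[of z] add.hyps(2,4)[of z] by simp_all
        then have "integrable M u" "integrable M v"
          using int[OF that add.hyps(1)] int[OF that add.hyps(3)] by blast+
        then have i: "integrable M (\<lambda>z. \<bar>g z - u z\<bar>)" "integrable M (\<lambda>z. \<bar>k z - v z\<bar>)"
          "integrable M (\<lambda>z. \<bar>k z + g z - (v z + u z)\<bar>)"
          using intc[OF that g(1,2)] intc[OF that k(1,2)] by auto
        have "(LINT z|M. \<bar>k z + g z - (v z + u z)\<bar>) \<le> (LINT z|M. \<bar>k z - v z\<bar> + \<bar>g z - u z\<bar>)"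
          using i by (intro integral_mono) auto
        then show ?thesis using i g(3)[OF that] k(3)[OF that] by simp
      qed
      ultimately show "\<exists>g. continuous_on UNIV g \<and> (\<exists>B. \<forall>z. \<bar>g z\<bar> \<le> B) \<and>
          (\<forall>M\<in>\<M>. (LINT z|M. \<bar>g z - (v z + u z)\<bar>) \<le> e)"
        using g(1) k(1) by (intro exI[of _ "\<lambda>z. k z + g z"] conjI continuous_intros) auto
    qed
  next
    case (seq U)
    show ?case
    proof (intro impI allI)
      fix e :: real assume e: "0 < e" and "\<exists>C. \<forall>z. u z \<le> C"
      then obtain C where C: "\<And>z. u z \<le> C" by blast
      have lim: "(\<lambda>i. U i z) \<longlonglongrightarrow> u z" for z using seq by simp
      have Uu: "U i z \<le> u z" for i z
        using incseq_le[OF _ lim] seq.hyps(3) by (auto simp: incseq_def le_fun_def)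
      have UC: "\<bar>U i z\<bar> \<le> C" "\<bar>u z\<bar> \<le> C" for i z
        using Uu[of i z] C[of z] seq.hyps(2)[of i z] by auto
      have "(\<lambda>i. LINT z|M. \<bar>U i z - u z\<bar>) \<longlonglongrightarrow> 0" if "M \<in> \<M>" for M
      proof -
        have "(\<lambda>i. LINT z|M. \<bar>U i z - u z\<bar>) \<longlonglongrightarrow> (LINT z|M. 0)"
        proof (rule integral_dominated_convergence[where w = "\<lambda>_. C"])
          show "(\<lambda>z. \<bar>U i z - u z\<bar>) \<in> borel_measurable M" for i
            using meas[OF that seq.hyps(1)] meas[OF that u(1)] by measurable
          show "integrable M (\<lambda>_. C)" using M[OF that] by (simp add: finite_measure.integrable_const)
          show "AE z in M. (\<lambda>i. \<bar>U i z - u z\<bar>) \<longlonglongrightarrow> 0"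
            using lim by (intro AE_I2 tendsto_rabs_zero LIM_zero)
          show "AE z in M. norm \<bar>U i z - u z\<bar> \<le> C" for i
          proof (rule AE_I2)
            fix z show "norm \<bar>U i z - u z\<bar> \<le> C"
              using Uu[of i z] UC(2)[of z] seq.hyps(2)[of i z] by auto
          qed
        qed simp
        then show ?thesis by simp
      qed
      then have "\<forall>M\<in>\<M>. \<forall>\<^sub>F i in sequentially. (LINT z|M. \<bar>U i z - u z\<bar>) < e / 2"
        using e order_tendstoD(2)[where a = "e / 2"] half_gt_zero[OF e] by blast
      then have "\<forall>\<^sub>F i in sequentially. \<forall>M\<in>\<M>. (LINT z|M. \<bar>U i z - u z\<bar>) < e / 2"
        using fin by (simp add: eventually_ball_finite)
      then obtain i where i: "\<And>M. M \<in> \<M> \<Longrightarrow> (LINT z|M. \<bar>U i z - u z\<bar>) < e / 2"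
        using eventually_happens'[OF sequentially_bot] by blast
      have "\<exists>C. \<forall>z. U i z \<le> C" using UC(1)[of i] by (meson abs_le_D1)
      then obtain g where g: "continuous_on UNIV g" "\<exists>B. \<forall>z. \<bar>g z\<bar> \<le> B" "\<And>M. M \<in> \<M> \<Longrightarrow> (LINT z|M. \<bar>g z - U i z\<bar>) \<le> e / 2"
        using seq.IH[of i] e by (metis half_gt_zero)
      have "(LINT z|M. \<bar>g z - u z\<bar>) \<le> e" if "M \<in> \<M>" for M
      proof -
        have "integrable M (U i)" "integrable M u"
          using int[OF that seq.hyps(1)] int[OF that u(1)] UC by blast+
        then have j: "integrable M (\<lambda>z. \<bar>g z - U i z\<bar>)" "integrable M (\<lambda>z. \<bar>U i z - u z\<bar>)"
          "integrable M (\<lambda>z. \<bar>g z - u z\<bar>)"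
          using intc[OF that g(1,2)] by auto
        have "(LINT z|M. \<bar>g z - u z\<bar>) \<le> (LINT z|M. \<bar>g z - U i z\<bar> + \<bar>U i z - u z\<bar>)"
          using j by (intro integral_mono) auto
        then show ?thesis using j g(3)[OF that] i[OF that] by simp
      qed
      then show "\<exists>g. continuous_on UNIV g \<and> (\<exists>B. \<forall>z. \<bar>g z\<bar> \<le> B) \<and>
          (\<forall>M\<in>\<M>. (LINT z|M. \<bar>g z - u z\<bar>) \<le> e)"
        using g by blast
    qed
  qed
qed

text \<open>Continuous functions are dense in \<open>L\<^sup>1\<close>, simultaneously for finitely many finite measures
  and preserving bounds.\<close>

lemma continuous_L1_approx:
  fixes \<M> :: "complex measure set" and h :: "complex \<Rightarrow> real"
  assumes fin: "finite \<M>" and M: "\<And>M. M \<in> \<M> \<Longrightarrow> finite_measure M \<and> sets M = sets borel"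
    and h: "h \<in> borel_measurable borel" "\<And>z. \<bar>h z\<bar> \<le> C" and e: "0 < e"
  obtains g where "continuous_on UNIV g" "\<And>z. \<bar>g z\<bar> \<le> C" "\<And>M. M \<in> \<M> \<Longrightarrow> (LINT z|M. \<bar>g z - h z\<bar>) \<le> e"
proof -
  have "\<exists>B. \<forall>z. h z + C \<le> B" using h(2) by (intro exI[of _ "2 * C"]) (auto simp: abs_le_iff)
  moreover have "(\<lambda>z. h z + C) \<in> borel_measurable borel" using h(1) by simp
  moreover have h0: "0 \<le> h z + C" "h z \<le> C" for z using h(2)[of z] by auto
  ultimately obtain g where g: "continuous_on UNIV g" "\<exists>B. \<forall>z. \<bar>g z\<bar> \<le> B"
    "\<And>M. M \<in> \<M> \<Longrightarrow> (LINT z|M. \<bar>g z - (h z + C)\<bar>) \<le> e"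
    using nonneg_L1_approx[OF fin M, of "\<lambda>z. h z + C"] e by metis
  obtain B where B: "\<And>z. \<bar>g z\<bar> \<le> B" using g(2) by blast
  define k where "k z = max (- C) (min C (g z - C))" for z
  have k: "continuous_on UNIV k" unfolding k_def by (intro continuous_intros g)
  have kC: "\<bar>k z\<bar> \<le> C" for z using h(2)[of z] by (auto simp: k_def)
  have "(LINT z|M. \<bar>k z - h z\<bar>) \<le> e" if "M \<in> \<M>" for M
  proof -
    interpret finite_measure M using M[OF that] by simp
    have [measurable]: "g \<in> borel_measurable M" "h \<in> borel_measurable M" "k \<in> borel_measurable M"
      using M[OF that] h(1) borel_measurable_continuous_onI[OF g(1)] borel_measurable_continuous_onI[OF k]
      by (simp_all cong: measurable_cong_sets)
    have "integrable M g" "integrable M h" "integrable M k"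
      using B h(2) kC by (auto intro!: integrable_const_bound AE_I2)
    then have "(LINT z|M. \<bar>k z - h z\<bar>) \<le> (LINT z|M. \<bar>g z - (h z + C)\<bar>)"
    proof (intro integral_mono)
      fix z show "\<bar>k z - h z\<bar> \<le> \<bar>g z - (h z + C)\<bar>"
        using h0[of z] by (auto simp: k_def max_def min_def abs_if)
    qed auto
    then show ?thesis using g(3)[OF that] by simp
  qed
  then show thesis using that k kC by blast
qed

section \<open>Lower bounds for integrals of exponentials\<close>

lemma Arg2pi_measurable [measurable]: "Arg2pi \<in> borel_measurable borel"
proof -
  have "continuous_on (- \<real>\<^sub>\<ge>\<^sub>0) Arg2pi"
    using continuous_at_Arg2pi by (auto intro!: continuous_at_imp_continuous_on)
  then have "(\<lambda>z. indicator (- \<real>\<^sub>\<ge>\<^sub>0) z *\<^sub>R Arg2pi z) \<in> borel_measurable borel"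
    by (intro borel_measurable_continuous_on_indicator) auto
  also have "(\<lambda>z. indicator (- \<real>\<^sub>\<ge>\<^sub>0) z *\<^sub>R Arg2pi z) = Arg2pi"
    using Arg2pi_eq_0 by (auto simp: fun_eq_iff indicator_def complex_nonneg_Reals_iff complex_is_Real_iff)
  finally show ?thesis .
qed

lemma Arg2pi_cis: "\<theta> \<in> {0..<2 * pi} \<Longrightarrow> Arg2pi (cis \<theta>) = \<theta>"
  by (rule Arg2pi_unique[of 1]) (auto simp: cis_conv_exp)

lemma cis_measurable [measurable]: "cis \<in> borel_measurable borel"
  by (intro borel_measurable_continuous_onI continuous_intros)

lemma cis_measurable_circle [measurable]: "cis \<in> measurable borel circle_borel"
  unfolding circle_borel_def by (rule measurable_restrict_space2) auto

lemma nn_integral_add_measure: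
  assumes f: "f \<in> borel_measurable M" and sets: "sets M1 = sets M" "sets M2 = sets M"
    and sum: "\<And>A. A \<in> sets M \<Longrightarrow> emeasure M A = emeasure M1 A + emeasure M2 A"
  shows "nn_integral M f = nn_integral M1 f + nn_integral M2 f"
  using f
proof (induction rule: borel_measurable_induct)
  note sp = sets_eq_imp_space_eq[OF sets(1)] sets_eq_imp_space_eq[OF sets(2)]
  case (cong f g)
  then show ?case using sp by (simp cong: nn_integral_cong_simp)
next
  case (set A)
  then show ?case using sum sets by simp
next
  note m = measurable_cong_sets[OF sets(1) refl] measurable_cong_sets[OF sets(2) refl]
  case (mult u c)
  then show ?case by (simp add: nn_integral_cmult m distrib_left)
next
  note m = measurable_cong_sets[OF sets(1) refl] measurable_cong_sets[OF sets(2) refl]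
  case (add u v)
  then show ?case by (simp add: nn_integral_add m ac_simps)
next
  case (seq U)
  have inc: "incseq (\<lambda>i. nn_integral N (U i))" for N :: "'a measure"
    using seq(3) by (auto simp: incseq_def le_fun_def intro!: nn_integral_mono)
  have "nn_integral N (\<lambda>x. SUP i. U i x) = (SUP i. nn_integral N (U i))" if "sets N = sets M" for N
  proof (rule nn_integral_monotone_convergence_SUP)
    show "U i \<in> borel_measurable N" for i
      unfolding measurable_cong_sets[OF that refl] by (rule seq)
  qed (rule seq)
  then show ?case
    using seq sets inc by (simp add: SUP_apply[abs_def] ennreal_SUP_add image_comp)
qed

lemma exp_poly_approx:
  fixes p :: "complex poly"
  obtains q :: "nat \<Rightarrow> complex poly" where
    "\<And>z. (\<lambda>N. poly (q N) z) \<longlonglongrightarrow> exp (poly p z)"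
    "\<And>N z. norm (poly (q N) z) \<le> exp (norm (poly p z))"
proof -
  define q where "q N = (\<Sum>k<N. smult (1 / fact k) (p ^ k))" for N
  have q: "poly (q N) z = (\<Sum>k<N. poly p z ^ k /\<^sub>R fact k)" for N z
    by (simp add: q_def poly_sum scaleR_conv_of_real field_simps)
  show thesis
  proof (rule that)
    show "(\<lambda>N. poly (q N) z) \<longlonglongrightarrow> exp (poly p z)" for z
      unfolding q using exp_converges[of "poly p z"] by (simp add: sums_def)
    fix N z
    have "norm (poly (q N) z) \<le> (\<Sum>k<N. norm (poly p z) ^ k /\<^sub>R fact k)"
      unfolding q by (rule order_trans[OF norm_sum]) (simp add: norm_power)
    also have "\<dots> \<le> exp (norm (poly p z))"
      unfolding exp_def using summable_exp_generic[of "norm (poly p z)"]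
      by (intro sum_le_suminf) auto
    finally show "norm (poly (q N) z) \<le> exp (norm (poly p z))" .
  qed
qed

lemma abs_exp_diff_le:
  fixes x y C :: real
  assumes "\<bar>x\<bar> \<le> C" "\<bar>y\<bar> \<le> C"
  shows "\<bar>exp x - exp y\<bar> \<le> exp C * \<bar>x - y\<bar>"
proof -
  have *: "exp b - exp a \<le> exp C * (b - a)" if "a \<le> b" "b \<le> C" for a b :: real
  proof -
    have "exp b * (1 + (a - b)) \<le> exp b * exp (a - b)"
      by (intro mult_left_mono exp_ge_add_one_self) auto
    then have "exp b - exp a \<le> exp b * (b - a)"
      by (simp add: algebra_simps flip: exp_add)
    also have "\<dots> \<le> exp C * (b - a)" using that by (intro mult_right_mono) auto
    finally show ?thesis .
  qed
  show ?thesis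
    using *[of x y] *[of y x] abs_le_D1[OF assms(1)] abs_le_D1[OF assms(2)]
    by (cases "x \<le> y") (simp_all add: abs_minus_commute[of _ y] abs_of_nonneg)
qed

context nontrivial_circle_measure
begin

text \<open>Apply the extremal property to the Taylor polynomials of \<open>exp (p / 2)\<close>. The constant \<^term>\<open>c\<close> is
  any lower bound of the products \<open>\<Prod>k<n. \<rho>\<^sub>k\<^sup>2\<close>; its intended value is their limit.\<close>

lemma exp_Re_poly_lower_bound:
  assumes c: "\<And>n. c \<le> (\<Prod>k<n. rho \<mu> k)\<^sup>2"
  shows "c * exp (Re (poly p 0)) \<le> (LINT z|\<mu>. exp (Re (poly p z)))"
proof -
  define h where "h = smult (1 / 2) p"
  have h2: "(norm (exp (poly h z)))\<^sup>2 = exp (Re (poly p z))" for z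
    by (simp add: h_def norm_exp_eq_Re power2_eq_square flip: exp_add)
  obtain q where q: "\<And>z. (\<lambda>N. poly (q N) z) \<longlonglongrightarrow> exp (poly h z)"
    "\<And>N z. norm (poly (q N) z) \<le> exp (norm (poly h z))"
    using exp_poly_approx[of h] by blast
  have "(\<lambda>N. nsq (q N)) \<longlonglongrightarrow> (LINT z|\<mu>. (norm (exp (poly h z)))\<^sup>2)"
    unfolding nsq_def
  proof (rule integral_dominated_convergence[where w = "\<lambda>z. (exp (norm (poly h z)))\<^sup>2"])
    show "integrable \<mu> (\<lambda>z. (exp (norm (poly h z)))\<^sup>2)"
      by (intro integrable_continuous continuous_intros)
    show "(\<lambda>z. (norm (exp (poly h z)))\<^sup>2) \<in> borel_measurable \<mu>"
      by (intro measurable_circle borel_measurable_continuous_onI continuous_intros)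
    show "(\<lambda>z. (norm (poly (q N) z))\<^sup>2) \<in> borel_measurable \<mu>" for N
      by (intro measurable_circle borel_measurable_continuous_onI continuous_intros)
    show "AE z in \<mu>. (\<lambda>N. (norm (poly (q N) z))\<^sup>2) \<longlonglongrightarrow> (norm (exp (poly h z)))\<^sup>2"
      by (intro AE_I2 tendsto_intros q)
    show "AE z in \<mu>. norm ((norm (poly (q N) z))\<^sup>2) \<le> (exp (norm (poly h z)))\<^sup>2" for N
      using q(2) by (intro AE_I2) (simp add: power_mono)
  qed
  moreover have "(\<lambda>N. (norm (poly (q N) 0))\<^sup>2 * c) \<longlonglongrightarrow> (norm (exp (poly h 0)))\<^sup>2 * c"
    by (intro tendsto_intros q)
  moreover have "(norm (poly (q N) 0))\<^sup>2 * c \<le> nsq (q N)" for N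
    using nsq_ge[of "q N" "degree (q N)"] c[of "degree (q N)"]
    by (meson mult_left_mono order_refl order_trans zero_le_power2)
  ultimately have "(norm (exp (poly h 0)))\<^sup>2 * c \<le> (LINT z|\<mu>. (norm (exp (poly h z)))\<^sup>2)"
    by (intro LIMSEQ_le) auto
  then show ?thesis unfolding h2 by (simp add: mult.commute)
qed

lemma integrable_dtheta_continuous:
  fixes h :: "complex \<Rightarrow> 'b :: {banach, second_countable_topology}"
  assumes "continuous_on UNIV h" shows "integrable dtheta (\<lambda>\<theta>. h (cis \<theta>))"
proof -
  have "compact (h ` sphere 0 1)"
    using assms by (intro compact_continuous_image) (auto intro: continuous_on_subset)
  then have "bounded (h ` sphere 0 1)" by (rule compact_imp_bounded)
  then obtain B where B: "\<And>z. z \<in> sphere 0 1 \<Longrightarrow> norm (h z) \<le> B"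
    by (force simp: bounded_iff)
  have [measurable]: "h \<in> borel_measurable borel"
    using assms by (rule borel_measurable_continuous_onI)
  show ?thesis
  proof (rule dtheta.integrable_const_bound)
    show "AE \<theta> in dtheta. norm (h (cis \<theta>)) \<le> B" using B by (intro AE_I2) simp
  qed measurable
qed

text \<open>By the mean value property \<open>Re (p 0)\<close> is the mean of \<open>Re p\<close> over the circle, and such functions
  are uniformly dense.\<close>

lemma exp_continuous_lower_bound:
  assumes c: "0 \<le> c" "\<And>n. c \<le> (\<Prod>k<n. rho \<mu> k)\<^sup>2" and h: "continuous_on UNIV h"
  shows "c * exp (LINT \<theta>|dtheta. h (cis \<theta>)) \<le> (LINT z|\<mu>. exp (h z))"
proof -
  define I where "I = (LINT \<theta>|dtheta. h (cis \<theta>))"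
  have *: "exp (- e) * (c * exp (I - e)) \<le> (LINT z|\<mu>. exp (h z))" if e: "0 < e" for e
  proof -
    obtain p where p: "\<And>z. norm z = 1 \<Longrightarrow> \<bar>h z - Re (poly p z)\<bar> < e"
      using circle_Stone_Weierstrass[OF continuous_on_subset[OF h] e] by blast
    have cp: "continuous_on UNIV (\<lambda>z. Re (poly p z))" by (intro continuous_intros)
    have "I - e = (LINT \<theta>|dtheta. h (cis \<theta>) - e)"
      using integrable_dtheta_continuous[OF h] by (simp add: I_def dtheta.prob_space[unfolded space_dtheta])
    also have "\<dots> \<le> (LINT \<theta>|dtheta. Re (poly p (cis \<theta>)))"
    proof (rule integral_mono)
      show "h (cis \<theta>) - e \<le> Re (poly p (cis \<theta>))" for \<theta> using p[of "cis \<theta>"] by (auto simp: abs_less_iff)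
    qed (use integrable_dtheta_continuous[OF h] integrable_dtheta_continuous[OF cp] in auto)
    also have "\<dots> = Re (LINT \<theta>|dtheta. poly p (cis \<theta>))"
      by (intro integral_Re integrable_dtheta_continuous continuous_intros)
    also have "(LINT \<theta>|dtheta. poly p (cis \<theta>)) = poly p 0"
      by (rule mean_value_formula[of _ 2]) (auto intro: holomorphic_intros)
    finally have "c * exp (I - e) \<le> c * exp (Re (poly p 0))" using c by (intro mult_left_mono) auto
    also have "\<dots> \<le> (LINT z|\<mu>. exp (Re (poly p z)))" using exp_Re_poly_lower_bound[OF c(2)] .
    finally have "exp (- e) * (c * exp (I - e)) \<le> exp (- e) * (LINT z|\<mu>. exp (Re (poly p z)))"
      by (intro mult_left_mono) auto
    also have "\<dots> = (LINT z|\<mu>. exp (- e) * exp (Re (poly p z)))" by simp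
    also have "\<dots> \<le> (LINT z|\<mu>. exp (h z))"
    proof (rule integral_mono)
      show "integrable \<mu> (\<lambda>z. exp (- e) * exp (Re (poly p z)))" "integrable \<mu> (\<lambda>z. exp (h z))"
        by (intro integrable_continuous continuous_intros h)+
      fix z assume "z \<in> space \<mu>"
      then have "norm z = 1" by (simp add: space_eq)
      then show "exp (- e) * exp (Re (poly p z)) \<le> exp (h z)"
        using p[of z] by (simp add: abs_less_iff flip: exp_add)
    qed
    finally show ?thesis .
  qed
  have "((\<lambda>e. exp (- e) * (c * exp (I - e))) \<longlongrightarrow> exp (- 0) * (c * exp (I - 0))) (at_right 0)"
    by (intro tendsto_intros)
  then have "exp (- 0) * (c * exp (I - 0)) \<le> (LINT z|\<mu>. exp (h z))"
    using * by (intro tendsto_upperbound[of _ _ "at_right 0"]) (auto simp: eventually_at_right_less eventually_at_filter)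
  then show ?thesis by (simp add: I_def)
qed

text \<open>A Borel function is approximated in \<open>L\<^sup>1\<close> for \<open>\<mu>\<close> and for arc length at the same time. On a
  Lebesgue null set that carries the singular part of \<open>\<mu>\<close>, the values of the bounded Borel function
  \<^term>\<open>h\<close> can therefore be chosen without affecting its mean on the left-hand side.\<close>

lemma exp_bounded_lower_bound:
  assumes c: "0 \<le> c" "\<And>n. c \<le> (\<Prod>k<n. rho \<mu> k)\<^sup>2"
    and h: "h \<in> borel_measurable borel" "\<And>z. \<bar>h z\<bar> \<le> C"
  shows "c * exp (LINT \<theta>|dtheta. h (cis \<theta>)) \<le> (LINT z|\<mu>. exp (h z))"
proof -
  define I where "I = (LINT \<theta>|dtheta. h (cis \<theta>))"
  define M1 M2 where "M1 = distr \<mu> borel (\<lambda>z. z)" and "M2 = distr dtheta borel cis"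
  have id: "(\<lambda>z. z) \<in> measurable \<mu> borel" by (intro measurable_circle) simp
  have M: "finite_measure M \<and> sets M = sets borel" if "M \<in> {M1, M2}" for M
    using that id prob_space_distr[OF id] dtheta.prob_space_distr[of cis borel]
    by (auto simp: M1_def M2_def prob_space.finite_measure)
  note [measurable] = h(1)
  have *: "c * exp (I - e) - exp C * e \<le> (LINT z|\<mu>. exp (h z))" if e: "0 < e" for e
  proof -
    obtain g where g: "continuous_on UNIV g" "\<And>z. \<bar>g z\<bar> \<le> C"
      "\<And>M. M \<in> {M1, M2} \<Longrightarrow> (LINT z|M. \<bar>g z - h z\<bar>) \<le> e"
      using continuous_L1_approx[of "{M1, M2}", OF _ M h e] by auto
    have [measurable]: "g \<in> borel_measurable borel"
      using g(1) by (rule borel_measurable_continuous_onI)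
    have g1: "(LINT z|\<mu>. \<bar>g z - h z\<bar>) \<le> e"
      using g(3)[of M1] id by (simp add: M1_def integral_distr)
    have g2: "(LINT \<theta>|dtheta. \<bar>g (cis \<theta>) - h (cis \<theta>)\<bar>) \<le> e"
      using g(3)[of M2] by (simp add: M2_def integral_distr)
    have i1: "integrable \<mu> (\<lambda>z. exp (h z))" "integrable \<mu> (\<lambda>z. exp (g z))" "integrable \<mu> (\<lambda>z. \<bar>g z - h z\<bar>)"
    proof -
      have *: "h z \<le> C" "g z \<le> C" "\<bar>g z - h z\<bar> \<le> 2 * C" for z using g(2)[of z] h(2)[of z] by auto
      show "integrable \<mu> (\<lambda>z. exp (h z))" "integrable \<mu> (\<lambda>z. exp (g z))"
        using * by (auto intro!: integrable_const_bound[of _ "exp C"] AE_I2 measurable_circle)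
      show "integrable \<mu> (\<lambda>z. \<bar>g z - h z\<bar>)"
        using * by (auto intro!: integrable_const_bound[of _ "2 * C"] AE_I2 measurable_circle)
    qed
    have i2: "integrable dtheta (\<lambda>\<theta>. h (cis \<theta>))" "integrable dtheta (\<lambda>\<theta>. g (cis \<theta>))"
      using g(2) h(2) by (auto intro!: dtheta.integrable_const_bound[of _ C] AE_I2)
    have "I - (LINT \<theta>|dtheta. g (cis \<theta>)) = (LINT \<theta>|dtheta. h (cis \<theta>) - g (cis \<theta>))"
      using i2 by (simp add: I_def)
    also have "\<dots> \<le> (LINT \<theta>|dtheta. \<bar>g (cis \<theta>) - h (cis \<theta>)\<bar>)"
      using i2 by (intro integral_mono) auto
    finally have "I - e \<le> (LINT \<theta>|dtheta. g (cis \<theta>))" using g2 by linarith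
    then have "c * exp (I - e) \<le> c * exp (LINT \<theta>|dtheta. g (cis \<theta>))"
      using c by (intro mult_left_mono) auto
    also have "\<dots> \<le> (LINT z|\<mu>. exp (g z))" by (rule exp_continuous_lower_bound[OF c g(1)])
    also have "\<dots> \<le> (LINT z|\<mu>. exp (h z) + exp C * \<bar>g z - h z\<bar>)"
    proof (rule integral_mono)
      fix z show "exp (g z) \<le> exp (h z) + exp C * \<bar>g z - h z\<bar>"
        using abs_exp_diff_le[OF g(2)[of z] h(2)[of z]] by linarith
    qed (use i1 in auto)
    also have "\<dots> = (LINT z|\<mu>. exp (h z)) + exp C * (LINT z|\<mu>. \<bar>g z - h z\<bar>)" using i1 by simp
    also have "\<dots> \<le> (LINT z|\<mu>. exp (h z)) + exp C * e" using g1 by simp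
    finally show ?thesis by simp
  qed
  have "((\<lambda>e. c * exp (I - e) - exp C * e) \<longlongrightarrow> c * exp (I - 0) - exp C * 0) (at_right 0)"
    by (intro tendsto_intros)
  then have "c * exp (I - 0) - exp C * 0 \<le> (LINT z|\<mu>. exp (h z))"
    using * by (intro tendsto_upperbound[of _ _ "at_right 0"]) (auto simp: eventually_at_right_less eventually_at_filter)
  then show ?thesis by (simp add: I_def)
qed

end

section \<open>Integrability of the logarithm of the density\<close>

lemma clamp_bounds:
  fixes K x :: real
  assumes "0 \<le> K"
  shows "exp (- K) \<le> max (exp (- K)) (min (exp K) x)" "max (exp (- K)) (min (exp K) x) \<le> exp K"
    "0 < max (exp (- K)) (min (exp K) x)"
proof -
  have "exp (- K) \<le> exp K" using assms by simp
  then show "exp (- K) \<le> max (exp (- K)) (min (exp K) x)" "max (exp (- K)) (min (exp K) x) \<le> exp K"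
    by (auto simp: max_def min_def)
  then show "0 < max (exp (- K)) (min (exp K) x)" using exp_gt_zero[of "- K"] by linarith
qed

text \<open>The logarithm truncated to \<open>[-K, K]\<close>. Clamping the argument rather than the value gives \<^term>\<open>-K\<close>
  for nonpositive arguments, where \<^term>\<open>ln\<close> is not meaningful.\<close>

definition clamped_ln :: "real \<Rightarrow> real \<Rightarrow> real" where
  "clamped_ln K x = ln (max (exp (- K)) (min (exp K) x))"

lemma abs_clamped_ln_le:
  assumes "0 \<le> K" shows "\<bar>clamped_ln K x\<bar> \<le> K"
proof -
  note c = clamp_bounds[OF assms, of x]
  have "- K \<le> clamped_ln K x"
    unfolding clamped_ln_def using ln_mono[OF c(1)] by simp
  moreover have "clamped_ln K x \<le> K"
    unfolding clamped_ln_def using ln_mono[OF c(2) c(3)] by simp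
  ultimately show ?thesis by auto
qed

lemma clamped_ln_measurable [measurable]: "clamped_ln K \<in> borel_measurable borel"
  unfolding clamped_ln_def[abs_def] by measurable

lemma clamped_ln_eq:
  assumes "0 < x"
  shows "clamped_ln K x = max (- K) (min K (ln x))"
proof -
  have "ln (max a b) = max (ln a) (ln b)" "ln (min a b) = min (ln a) (ln b)" if "0 < a" "0 < b" for a b :: real
    using that by (auto simp: max_def min_def)
  then show ?thesis unfolding clamped_ln_def using assms by simp
qed

lemma clamped_ln_nonpos:
  assumes "x \<le> 0" "0 \<le> K"
  shows "clamped_ln K x = - K"
proof -
  have "min (exp K) x \<le> exp (- K)" using assms exp_gt_zero[of "-K"] by (intro min.coboundedI2) linarith
  then show ?thesis by (simp add: clamped_ln_def max_absorb1)
qed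

lemma exp_minus_clamped_ln: "0 \<le> K \<Longrightarrow> exp (- clamped_ln K x) = 1 / max (exp (- K)) (min (exp K) x)"
  using clamp_bounds(3)[of K x] by (simp add: clamped_ln_def exp_minus inverse_eq_divide)

lemma mult_exp_minus_clamped_ln_le:
  assumes "0 \<le> K" "0 \<le> x"
  shows "x * exp (- clamped_ln K x) \<le> 1 + exp (- K) * x"
proof (cases "x \<le> exp K")
  case True
  then have "x \<le> max (exp (- K)) (min (exp K) x)" by simp
  then have "x * exp (- clamped_ln K x) \<le> 1"
    unfolding exp_minus_clamped_ln[OF assms(1)] using clamp_bounds(3)[OF assms(1), of x] by simp
  then show ?thesis using assms by (smt (verit) exp_gt_zero mult_nonneg_nonneg)
next
  case False
  then have "max (exp (- K)) (min (exp K) x) = exp K" using assms by simp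
  then show ?thesis
    unfolding exp_minus_clamped_ln[OF assms(1)] by (simp add: exp_minus inverse_eq_divide)
qed

context nontrivial_circle_measure
begin

context
  fixes w :: "real \<Rightarrow> real" and \<mu>s :: "complex measure"
  assumes decomp: "circle_decomposition \<mu> w \<mu>s"
begin

lemma w_measurable [measurable]: "w \<in> borel_measurable borel"
  using decomp by (simp add: circle_decomposition_def)

lemma AE_w_nonneg: "AE \<theta> in dtheta. 0 \<le> w \<theta>"
  using AE_dtheta by eventually_elim (use decomp in \<open>simp add: circle_decomposition_def\<close>)

lemma nn_integral_decomp:
  assumes f [measurable]: "f \<in> borel_measurable circle_borel"
  shows "(\<integral>\<^sup>+z. f z \<partial>\<mu>) = (\<integral>\<^sup>+\<theta>. ennreal (w \<theta>) * f (cis \<theta>) \<partial>dtheta) + (\<integral>\<^sup>+z. f z \<partial>\<mu>s)"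
proof -
  let ?M1 = "distr (density dtheta (\<lambda>\<theta>. ennreal (w \<theta>))) circle_borel cis"
  have "(\<integral>\<^sup>+z. f z \<partial>\<mu>) = (\<integral>\<^sup>+z. f z \<partial>?M1) + (\<integral>\<^sup>+z. f z \<partial>\<mu>s)"
  proof (rule nn_integral_add_measure)
    show "f \<in> borel_measurable \<mu>" by (simp cong: measurable_cong_sets add: sets_eq)
    show "emeasure \<mu> A = emeasure ?M1 A + emeasure \<mu>s A" if "A \<in> sets \<mu>" for A
      using that decomp by (simp add: sets_eq circle_decomposition_def)
  qed (use decomp in \<open>simp_all add: sets_eq circle_decomposition_def\<close>)
  also have "(\<integral>\<^sup>+z. f z \<partial>?M1) = (\<integral>\<^sup>+\<theta>. ennreal (w \<theta>) * f (cis \<theta>) \<partial>dtheta)"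
    by (simp add: nn_integral_distr nn_integral_density)
  finally show ?thesis .
qed

lemma nn_integral_w_le: "(\<integral>\<^sup>+\<theta>. ennreal (w \<theta>) \<partial>dtheta) \<le> 1"
  and emeasure_sing_le: "emeasure \<mu>s (space \<mu>s) \<le> 1"
proof -
  have "(\<integral>\<^sup>+\<theta>. ennreal (w \<theta>) \<partial>dtheta) + emeasure \<mu>s (space \<mu>s) = 1"
    using nn_integral_decomp[of "\<lambda>_. 1"] emeasure_space_1 by simp
  then show "(\<integral>\<^sup>+\<theta>. ennreal (w \<theta>) \<partial>dtheta) \<le> 1" "emeasure \<mu>s (space \<mu>s) \<le> 1"
    by (metis le_iff_add, metis le_iff_add add.commute)
qed

lemma integrable_w: "integrable dtheta w"
  using nn_integral_w_le AE_w_nonneg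
  by (intro integrableI_nonneg) (auto intro: le_less_trans)

lemma integral_w_le: "integral\<^sup>L dtheta w \<le> 1"
  using nn_integral_w_le nn_integral_eq_integral[OF integrable_w AE_w_nonneg] by simp

lemma integral_w_mult_le:
  assumes g: "continuous_on UNIV g" "\<And>z. 0 \<le> g z"
  shows "integrable dtheta (\<lambda>\<theta>. w \<theta> * g (cis \<theta>))"
    and "(LINT \<theta>|dtheta. w \<theta> * g (cis \<theta>)) \<le> (LINT z|\<mu>. g z)"
proof -
  have [measurable]: "g \<in> borel_measurable borel" using g(1) by (rule borel_measurable_continuous_onI)
  have gm: "(\<lambda>z. ennreal (g z)) \<in> borel_measurable circle_borel"
    unfolding circle_borel_def by (intro measurable_restrict_space1) measurable
  have "ennreal (LINT z|\<mu>. g z) = (\<integral>\<^sup>+z. g z \<partial>\<mu>)"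
    using integrable_continuous[OF g(1)] g(2) by (intro nn_integral_eq_integral[symmetric]) auto
  then have le: "(\<integral>\<^sup>+\<theta>. ennreal (w \<theta>) * ennreal (g (cis \<theta>)) \<partial>dtheta) \<le> ennreal (LINT z|\<mu>. g z)"
    using nn_integral_decomp[OF gm] by simp
  have eq: "(\<integral>\<^sup>+\<theta>. ennreal (w \<theta> * g (cis \<theta>)) \<partial>dtheta) = (\<integral>\<^sup>+\<theta>. ennreal (w \<theta>) * ennreal (g (cis \<theta>)) \<partial>dtheta)"
    using AE_w_nonneg by (intro nn_integral_cong_AE) (auto simp: ennreal_mult g(2) elim!: eventually_mono)
  have nn: "AE \<theta> in dtheta. 0 \<le> w \<theta> * g (cis \<theta>)"
    using AE_w_nonneg by eventually_elim (simp add: g(2))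
  show int: "integrable dtheta (\<lambda>\<theta>. w \<theta> * g (cis \<theta>))"
    using le eq nn by (intro integrableI_nonneg) (auto intro: le_less_trans)
  have "ennreal (LINT \<theta>|dtheta. w \<theta> * g (cis \<theta>)) \<le> ennreal (LINT z|\<mu>. g z)"
    using nn_integral_eq_integral[OF int nn] le eq by simp
  then show "(LINT \<theta>|dtheta. w \<theta> * g (cis \<theta>)) \<le> (LINT z|\<mu>. g z)"
    using g(2) by (subst (asm) ennreal_le_iff) auto
qed

text \<open>The test function is \<open>- log w\<close>, truncated to \<open>[-K, K]\<close>, off the Lebesgue null set that carries the
  singular part, and \<^term>\<open>-K\<close> on that set. Its exponential has \<open>\<mu>\<close>-integral at most
  \<open>1 + 2 * exp (- K)\<close>.\<close>

lemma clamped_ln_lower_bound: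
  assumes c: "0 \<le> c" "\<And>n. c \<le> (\<Prod>k<n. rho \<mu> k)\<^sup>2" and K: "0 \<le> K"
  shows "c * exp (- (LINT \<theta>|dtheta. clamped_ln K (w \<theta>))) \<le> 1 + 2 * exp (- K)"
proof -
  obtain N where N: "N \<in> sets circle_borel" "emeasure (distr dtheta circle_borel cis) N = 0"
    "emeasure \<mu>s (sphere 0 1 - N) = 0" and sets_s: "sets \<mu>s = sets circle_borel"
    using decomp by (auto simp: circle_decomposition_def)
  have [measurable]: "N \<in> sets borel"
    using N(1) by (auto simp: circle_borel_def sets_restrict_space)
  define h where "h z = (if z \<in> N then - K else - clamped_ln K (w (Arg2pi z)))" for z
  have h [measurable]: "h \<in> borel_measurable borel" unfolding h_def by measurable
  have hK: "\<bar>h z\<bar> \<le> K" for z using K abs_clamped_ln_le[OF K] by (auto simp: h_def)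
  \<comment> \<open>almost everywhere on the circle \<^term>\<open>h\<close> is the negative truncated logarithm\<close>
  have "emeasure dtheta (cis -` N) = 0"
    using N(1,2) emeasure_distr[of cis dtheta circle_borel N] cis_measurable_circle
    by (simp cong: measurable_cong_sets)
  then have "AE \<theta> in dtheta. cis \<theta> \<notin> N"
    by (intro AE_I[of _ _ "cis -` N"]) (auto intro: measurable_sets_borel[OF cis_measurable])
  then have hcis: "AE \<theta> in dtheta. h (cis \<theta>) = - clamped_ln K (w \<theta>)"
    using AE_dtheta by eventually_elim (simp add: h_def Arg2pi_cis)
  have hm: "(\<lambda>z. ennreal (exp (h z))) \<in> borel_measurable circle_borel"
    unfolding circle_borel_def by (intro measurable_restrict_space1) measurable
  have "(\<integral>\<^sup>+z. ennreal (exp (h z)) \<partial>\<mu>s) = (\<integral>\<^sup>+z. ennreal (exp (- K)) \<partial>\<mu>s)"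
  proof (rule nn_integral_cong_AE)
    have "sphere 0 1 - N \<in> sets \<mu>s"
      unfolding sets_s using N(1) sets.Diff[of "sphere 0 1" circle_borel N] sets.top[of circle_borel]
      by (simp add: circle_borel_def space_restrict_space)
    moreover have "space \<mu>s = sphere 0 1"
      using sets_eq_imp_space_eq[OF sets_s] by (simp add: circle_borel_def space_restrict_space)
    ultimately have "AE z in \<mu>s. z \<in> N"
      using N(3) by (intro AE_I[of \<mu>s _ "sphere 0 1 - N"]) (simp_all only: set_diff_eq Collect_mono_iff, blast)
    then show "AE z in \<mu>s. ennreal (exp (h z)) = ennreal (exp (- K))"
      by eventually_elim (simp add: h_def)
  qed
  also have "\<dots> \<le> ennreal (exp (- K))"
    using mult_left_mono[OF emeasure_sing_le, of "ennreal (exp (- K))"] by simp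
  finally have sing: "(\<integral>\<^sup>+z. ennreal (exp (h z)) \<partial>\<mu>s) \<le> ennreal (exp (- K))" .
  have "(\<integral>\<^sup>+\<theta>. ennreal (w \<theta>) * ennreal (exp (h (cis \<theta>))) \<partial>dtheta) \<le> (\<integral>\<^sup>+\<theta>. 1 + ennreal (exp (- K)) * ennreal (w \<theta>) \<partial>dtheta)"
  proof (rule nn_integral_mono_AE)
    show "AE \<theta> in dtheta. ennreal (w \<theta>) * ennreal (exp (h (cis \<theta>))) \<le> 1 + ennreal (exp (- K)) * ennreal (w \<theta>)"
      using hcis AE_w_nonneg
    proof eventually_elim
      case (elim \<theta>)
      then have "w \<theta> * exp (h (cis \<theta>)) \<le> 1 + exp (- K) * w \<theta>"
        using mult_exp_minus_clamped_ln_le[OF K] by simp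
      then have "ennreal (w \<theta> * exp (h (cis \<theta>))) \<le> ennreal (1 + exp (- K) * w \<theta>)" by (rule ennreal_leI)
      then show ?case using elim by (simp add: ennreal_mult)
    qed
  qed
  also have "\<dots> = 1 + ennreal (exp (- K)) * (\<integral>\<^sup>+\<theta>. ennreal (w \<theta>) \<partial>dtheta)"
    by (subst nn_integral_add) (auto simp: nn_integral_cmult dtheta.emeasure_space_1[unfolded space_dtheta])
  also have "\<dots> \<le> 1 + ennreal (exp (- K))"
    using mult_left_mono[OF nn_integral_w_le, of "ennreal (exp (- K))"] by (simp add: add_left_mono)
  finally have ac: "(\<integral>\<^sup>+\<theta>. ennreal (w \<theta>) * ennreal (exp (h (cis \<theta>))) \<partial>dtheta) \<le> 1 + ennreal (exp (- K))" .
  have int: "integrable \<mu> (\<lambda>z. exp (h z))"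
  proof (rule integrable_const_bound)
    show "AE z in \<mu>. norm (exp (h z)) \<le> exp K" using hK by (intro AE_I2) (simp add: abs_le_iff)
    show "(\<lambda>z. exp (h z)) \<in> borel_measurable \<mu>" by (intro measurable_circle) measurable
  qed
  have "ennreal (LINT z|\<mu>. exp (h z)) = (\<integral>\<^sup>+z. ennreal (exp (h z)) \<partial>\<mu>)"
    using int by (intro nn_integral_eq_integral[symmetric]) auto
  also have "\<dots> \<le> (1 + ennreal (exp (- K))) + ennreal (exp (- K))"
    unfolding nn_integral_decomp[OF hm] by (intro add_mono ac sing)
  also have "\<dots> = ennreal (1 + 2 * exp (- K))"
    by (simp flip: ennreal_plus ennreal_1)
  finally have "(LINT z|\<mu>. exp (h z)) \<le> 1 + 2 * exp (- K)"
    by (subst (asm) ennreal_le_iff) (auto intro: add_nonneg_nonneg)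
  moreover have "(LINT \<theta>|dtheta. h (cis \<theta>)) = - (LINT \<theta>|dtheta. clamped_ln K (w \<theta>))"
    using integral_cong_AE[OF _ _ hcis] by simp
  ultimately show ?thesis
    using exp_bounded_lower_bound[OF c h hK] by simp
qed

text \<open>One half of Szego's theorem: if the products \<open>\<Prod>k<n. \<rho>\<^sub>k\<^sup>2\<close> have a positive lower bound \<^term>\<open>c\<close>,
  then \<open>log w\<close> is integrable and its mean is at least \<^term>\<open>ln c\<close>. The reverse inequality for the
  limit of the products is part of \<open>exp_half_mean\<close> below.\<close>

lemma szego_lower_bound:
  assumes c: "0 < c" "\<And>n. c \<le> (\<Prod>k<n. rho \<mu> k)\<^sup>2"
  shows "AE \<theta> in dtheta. 0 < w \<theta>" and "integrable dtheta (\<lambda>\<theta>. ln (w \<theta>))"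
    and "ln c \<le> (LINT \<theta>|dtheta. ln (w \<theta>))"
proof -
  define l where "l n \<theta> = clamped_ln (real n) (w \<theta>)" for n \<theta>
  have [measurable]: "l n \<in> borel_measurable borel" for n unfolding l_def by measurable
  have ln: "\<bar>l n \<theta>\<bar> \<le> real n" for n \<theta> unfolding l_def by (rule abs_clamped_ln_le) simp
  have int: "integrable dtheta (l n)" for n
    using ln by (intro dtheta.integrable_const_bound[of _ "real n"]) auto
  have lower: "ln c - 2 * exp (- real n) \<le> integral\<^sup>L dtheta (l n)" for n
  proof -
    have "c * exp (- integral\<^sup>L dtheta (l n)) \<le> 1 + 2 * exp (- real n)"
      unfolding l_def using c by (intro clamped_ln_lower_bound) auto
    then have "ln (c * exp (- integral\<^sup>L dtheta (l n))) \<le> ln (1 + 2 * exp (- real n))"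
      using c by (intro ln_mono) auto
    also have "\<dots> \<le> 2 * exp (- real n)" by (rule ln_add_one_self_le_self) simp
    finally show ?thesis using c by (simp add: ln_mult)
  qed
  have l_le: "AE \<theta> in dtheta. l n \<theta> \<le> w \<theta>" for n
    using AE_w_nonneg
  proof eventually_elim
    case (elim \<theta>)
    show ?case
    proof (cases "0 < w \<theta>")
      case True
      then have "l n \<theta> \<le> max 0 (ln (w \<theta>))" by (auto simp: l_def clamped_ln_eq)
      then show ?thesis using True ln_le_minus_one[of "w \<theta>"] by auto
    next
      case False
      then show ?thesis using elim by (simp add: l_def clamped_ln_nonpos)
    qed
  qed
  \<comment> \<open>the negative parts increase with \<^term>\<open>n\<close> and have bounded integrals\<close>
  define m where "m n \<theta> = max 0 (- l n \<theta>)" for n \<theta>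
  have [measurable]: "m n \<in> borel_measurable borel" for n unfolding m_def by measurable
  have im: "integrable dtheta (m n)" for n unfolding m_def using int by auto
  define B where "B = 3 - ln c"
  have mB: "integral\<^sup>L dtheta (m n) \<le> B" for n
  proof -
    have "integral\<^sup>L dtheta (m n) + integral\<^sup>L dtheta (l n) = (LINT \<theta>|dtheta. m n \<theta> + l n \<theta>)"
      using int im by simp
    also have "\<dots> \<le> integral\<^sup>L dtheta w"
    proof (rule integral_mono_AE)
      show "AE \<theta> in dtheta. m n \<theta> + l n \<theta> \<le> w \<theta>"
        using l_le[of n] AE_w_nonneg by eventually_elim (auto simp: m_def)
    qed (use int im integrable_w in auto)
    also have "\<dots> \<le> 1" by (rule integral_w_le)
    finally have "integral\<^sup>L dtheta (m n) \<le> 1 - ln c + 2 * exp (- real n)" using lower[of n] by linarith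
    also have "\<dots> \<le> B" by (simp add: B_def)
    finally show ?thesis .
  qed
  have m_inc: "incseq (\<lambda>n. ennreal (m n \<theta>))" for \<theta>
  proof (rule incseq_SucI, rule ennreal_leI)
    fix n show "m n \<theta> \<le> m (Suc n) \<theta>"
      by (cases "0 < w \<theta>") (auto simp: m_def l_def clamped_ln_eq clamped_ln_nonpos)
  qed
  have "(\<integral>\<^sup>+\<theta>. (SUP n. ennreal (m n \<theta>)) \<partial>dtheta) = (SUP n. \<integral>\<^sup>+\<theta>. ennreal (m n \<theta>) \<partial>dtheta)"
    using m_inc by (intro nn_integral_monotone_convergence_SUP) (auto simp: incseq_def le_fun_def)
  also have "\<dots> \<le> ennreal B"
  proof (rule SUP_least)
    fix n
    have "(\<integral>\<^sup>+\<theta>. ennreal (m n \<theta>) \<partial>dtheta) = ennreal (integral\<^sup>L dtheta (m n))"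
      by (rule nn_integral_eq_integral[OF im]) (simp add: m_def)
    then show "(\<integral>\<^sup>+\<theta>. ennreal (m n \<theta>) \<partial>dtheta) \<le> ennreal B" using mB by (simp add: ennreal_leI)
  qed
  finally have sup: "(\<integral>\<^sup>+\<theta>. (SUP n. ennreal (m n \<theta>)) \<partial>dtheta) \<le> ennreal B" .
  then have "AE \<theta> in dtheta. (SUP n. ennreal (m n \<theta>)) \<noteq> \<infinity>"
    by (intro nn_integral_PInf_AE) (auto simp: top_unique)
  then show pos: "AE \<theta> in dtheta. 0 < w \<theta>"
  proof eventually_elim
    case (elim \<theta>)
    show ?case
    proof (rule ccontr)
      assume "\<not> 0 < w \<theta>"
      then have "m n \<theta> = real n" for n by (simp add: m_def l_def clamped_ln_nonpos)
      then have "(SUP n. ennreal (m n \<theta>)) = \<infinity>"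
        by (simp add: ennreal_SUP_of_nat_eq_top ennreal_of_nat_eq_real_of_nat[symmetric])
      then show False using elim by simp
    qed
  qed
  have neg: "integrable dtheta (\<lambda>\<theta>. max 0 (- ln (w \<theta>)))"
  proof (rule integrableI_nonneg)
    have "(\<integral>\<^sup>+\<theta>. ennreal (max 0 (- ln (w \<theta>))) \<partial>dtheta) \<le> (\<integral>\<^sup>+\<theta>. (SUP n. ennreal (m n \<theta>)) \<partial>dtheta)"
    proof (rule nn_integral_mono_AE)
      show "AE \<theta> in dtheta. ennreal (max 0 (- ln (w \<theta>))) \<le> (SUP n. ennreal (m n \<theta>))"
        using pos
      proof eventually_elim
        case (elim \<theta>)
        obtain n where "- ln (w \<theta>) \<le> real n" using real_arch_simple by blast
        then have "max 0 (- ln (w \<theta>)) \<le> m n \<theta>" using elim by (auto simp: m_def l_def clamped_ln_eq)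
        then show ?case by (intro SUP_upper2[of n]) (auto intro: ennreal_leI)
      qed
    qed
    from order_trans[OF this sup] show "(\<integral>\<^sup>+\<theta>. ennreal (max 0 (- ln (w \<theta>))) \<partial>dtheta) < \<infinity>"
      by (rule le_less_trans) simp
  qed auto
  show lnw: "integrable dtheta (\<lambda>\<theta>. ln (w \<theta>))"
  proof (rule Bochner_Integration.integrable_bound)
    show "integrable dtheta (\<lambda>\<theta>. w \<theta> + max 0 (- ln (w \<theta>)))" using neg integrable_w by auto
    show "AE \<theta> in dtheta. norm (ln (w \<theta>)) \<le> norm (w \<theta> + max 0 (- ln (w \<theta>)))"
      using pos
    proof eventually_elim
      case (elim \<theta>)
      then show ?case using ln_le_minus_one[of "w \<theta>"] by (auto simp: abs_if max_def)
    qed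
  qed measurable
  have "(\<lambda>n. integral\<^sup>L dtheta (l n)) \<longlonglongrightarrow> (LINT \<theta>|dtheta. ln (w \<theta>))"
  proof (rule integral_dominated_convergence[where w = "\<lambda>\<theta>. \<bar>ln (w \<theta>)\<bar>"])
    show "AE \<theta> in dtheta. (\<lambda>n. l n \<theta>) \<longlonglongrightarrow> ln (w \<theta>)"
      using pos
    proof eventually_elim
      case (elim \<theta>)
      obtain N where N: "\<bar>ln (w \<theta>)\<bar> \<le> real N" using real_arch_simple by blast
      have "\<forall>\<^sub>F n in sequentially. l n \<theta> = ln (w \<theta>)"
        using eventually_ge_at_top[of N]
      proof eventually_elim
        case (elim n)
        then have "\<bar>ln (w \<theta>)\<bar> \<le> real n" using N by linarith
        then show ?case using \<open>0 < w \<theta>\<close> by (auto simp: l_def clamped_ln_eq)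
      qed
      then show ?case by (rule tendsto_eventually)
    qed
    show "AE \<theta> in dtheta. norm (l n \<theta>) \<le> \<bar>ln (w \<theta>)\<bar>" for n
      using pos by eventually_elim (auto simp: l_def clamped_ln_eq)
  qed (use lnw in auto)
  moreover have "(\<lambda>n. ln c - 2 * exp (- real n)) \<longlonglongrightarrow> ln c - 2 * 0"
    by (intro tendsto_intros filterlim_compose[OF exp_at_bot] filterlim_uminus_at_bot_at_top[THEN filterlim_compose] filterlim_real_sequentially)
  ultimately show "ln c \<le> (LINT \<theta>|dtheta. ln (w \<theta>))"
    using lower by (intro LIMSEQ_le[of "\<lambda>n. ln c - 2 * exp (- real n)" "ln c"]) auto
qed

end

end

section \<open>Convergence of the reversed polynomials\<close>

lemma coeff_eq_higher_deriv:
  fixes p :: "complex poly"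
  shows "(deriv ^^ m) (poly p) 0 = fact m * coeff p m"
proof -
  have "(deriv ^^ m) (poly p) = poly ((pderiv ^^ m) p)"
  proof (induction m)
    case (Suc m)
    have "deriv (poly q) = poly (pderiv q)" for q :: "complex poly"
      by (auto intro!: DERIV_imp_deriv poly_DERIV)
    then show ?case by (simp add: Suc)
  qed simp
  then show ?thesis
    by (simp add: poly_0_coeff_0 coeff_higher_pderiv pochhammer_fact)
qed

text \<open>Poisson's formula for \<open>log |p|\<close>, as \<^term>\<open>p\<close> has a holomorphic logarithm on a
  neighbourhood of the closed disc.\<close>

lemma poisson_log_poly:
  fixes p :: "complex poly"
  assumes nz: "\<And>z. norm z \<le> 1 \<Longrightarrow> poly p z \<noteq> 0" and z: "norm z < 1"
  shows "integrable dtheta (\<lambda>\<theta>. ln (norm (poly p (cis \<theta>))))"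
    and "(LINT \<theta>|dtheta. poisson_kernel z \<theta> * ln (norm (poly p (cis \<theta>)))) = ln (norm (poly p z))"
proof -
  have p0: "p \<noteq> 0" using nz[of 0] by auto
  define R where "R = Min (insert 2 (norm ` {z. poly p z = 0}))"
  have fin: "finite (insert 2 (norm ` {z. poly p z = 0}))" using poly_roots_finite[OF p0] by simp
  have R: "1 < R"
    unfolding R_def using fin nz by (subst Min_gr_iff) (auto simp: not_le[symmetric])
  have nzR: "poly p u \<noteq> 0" if "u \<in> ball 0 R" for u
  proof
    assume "poly p u = 0"
    then have "R \<le> norm u" unfolding R_def using fin by (intro Min_le) auto
    then show False using that by simp
  qed
  obtain L where L: "L holomorphic_on ball 0 R" "\<And>u. u \<in> ball 0 R \<Longrightarrow> poly p u = exp (L u)"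
  proof (rule contractible_imp_holomorphic_log[of "poly p" "ball 0 R"])
    show "poly p holomorphic_on ball 0 R" by (auto intro: holomorphic_intros)
  qed (use nzR in \<open>auto intro: convex_imp_contractible\<close>)
  have ln: "ln (norm (poly p u)) = Re (L u)" if "u \<in> ball 0 R" for u
    using L(2)[OF that] by simp
  have cont: "continuous_on UNIV (\<lambda>\<theta>. L (cis \<theta>))"
    using R by (intro continuous_on_compose2[OF holomorphic_on_imp_continuous_on[OF L(1)]] continuous_intros) auto
  have "compact (L ` sphere 0 1)"
    using R by (intro compact_continuous_image continuous_on_subset[OF holomorphic_on_imp_continuous_on[OF L(1)]]) auto
  then have "bounded (L ` sphere 0 1)" by (rule compact_imp_bounded)
  then obtain B where B: "\<And>u. u \<in> sphere 0 1 \<Longrightarrow> norm (L u) \<le> B" by (force simp: bounded_iff)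
  have int: "integrable dtheta (\<lambda>\<theta>. L (cis \<theta>))"
  proof (rule dtheta.integrable_const_bound)
    show "AE \<theta> in dtheta. norm (L (cis \<theta>)) \<le> B" using B by (intro AE_I2) simp
    show "(\<lambda>\<theta>. L (cis \<theta>)) \<in> borel_measurable dtheta"
      using borel_measurable_continuous_onI[OF cont] by simp
  qed
  then show "integrable dtheta (\<lambda>\<theta>. ln (norm (poly p (cis \<theta>))))"
    using R by (simp add: ln integrable_Re)
  have "integrable dtheta (\<lambda>\<theta>. complex_of_real (poisson_kernel z \<theta>) * L (cis \<theta>))"
  proof (rule Bochner_Integration.integrable_bound)
    show "integrable dtheta (\<lambda>\<theta>. (1 + norm z) / (1 - norm z) * norm (L (cis \<theta>)))" using int by auto
    show "AE \<theta> in dtheta. norm (complex_of_real (poisson_kernel z \<theta>) * L (cis \<theta>))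
            \<le> norm ((1 + norm z) / (1 - norm z) * norm (L (cis \<theta>)))"
      using poisson_kernel_le[of z "norm z"] poisson_kernel_pos[OF z] z
      by (intro AE_I2) (simp add: norm_mult abs_mult less_imp_le mult_right_mono del: times_divide_eq_left)
  qed (use borel_measurable_integrable[OF int] in measurable)
  then have "Re (LINT \<theta>|dtheta. complex_of_real (poisson_kernel z \<theta>) * L (cis \<theta>)) =
      (LINT \<theta>|dtheta. poisson_kernel z \<theta> * Re (L (cis \<theta>)))"
    by (subst integral_Re[symmetric]) auto
  then show "(LINT \<theta>|dtheta. poisson_kernel z \<theta> * ln (norm (poly p (cis \<theta>)))) = ln (norm (poly p z))"
    using poisson_formula[OF L(1) R z] R z by (simp add: ln)
qed

lemma szego_function_eq:
  assumes "w \<in> borel_measurable borel"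
  shows "szego_function w z = exp (herglotz (\<lambda>\<theta>. of_real (ln (w \<theta>))) z / 2)"
proof -
  have "(\<lambda>\<theta>. herglotz_kernel z \<theta> * of_real (ln (w \<theta>))) \<in> borel_measurable borel"
    using assms by measurable
  note H = integral_dtheta[OF this]
  have "(LINT \<theta>|dtheta. herglotz_kernel z \<theta> * of_real (ln (w \<theta>))) / 2 =
      (LINT \<theta>:{0..<2 * pi}|lborel. herglotz_kernel z \<theta> * of_real (ln (w \<theta>))) / (4 * pi)"
    unfolding H scaleR_conv_of_real by (simp add: field_simps)
  then show ?thesis
    unfolding szego_function_def herglotz_def by (simp only: herglotz_kernel_def)
qed

context nontrivial_circle_measure
begin

text \<open>The norm of \<open>\<Phi>\<^sub>n\<close> in \<open>L\<^sup>2(\<mu>)\<close>.\<close>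

abbreviation rho_prod :: "nat \<Rightarrow> real" where "rho_prod n \<equiv> (\<Prod>k<n. rho \<mu> k)"

lemma rho_prod_pos: "0 < rho_prod n"
  by (intro prod_pos) (simp add: rho_pos)

lemma rho_nonzero [simp]: "rho \<mu> k \<noteq> 0"
  using rho_pos[of k] by simp

lemma rho_prod_limit:
  assumes "summable (\<lambda>k. (norm (alpha \<mu> (int k)))\<^sup>2)"
  shows "rho_prod \<longlonglongrightarrow> (\<Prod>k. rho \<mu> k)" and "0 < (\<Prod>k. rho \<mu> k)" and "(\<Prod>k. rho \<mu> k) \<le> rho_prod n"
proof -
  have "norm (rho \<mu> k - 1) \<le> (norm (alpha \<mu> (int k)))\<^sup>2" for k
  proof -
    have "rho \<mu> k * rho \<mu> k \<le> rho \<mu> k" using rho_pos[of k] rho_le_1[of k] by simp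
    moreover have "(norm (alpha \<mu> (int k)))\<^sup>2 = 1 - rho \<mu> k * rho \<mu> k"
      using rho_sq[of k] by (simp add: alpha_def power2_eq_square)
    ultimately show ?thesis using rho_le_1[of k] by simp
  qed
  then have "summable (\<lambda>k. norm (rho \<mu> k - 1))"
    using assms by (intro summable_comparison_test[OF _ assms]) auto
  then have "convergent_prod (rho \<mu>)"
    by (intro abs_convergent_prod_imp_convergent_prod) (simp add: abs_convergent_prod_conv_summable)
  then obtain L where L: "(\<lambda>n. \<Prod>k\<le>n. rho \<mu> k) \<longlonglongrightarrow> L" "L \<noteq> 0"
    using rho_pos by (subst (asm) convergent_prod_iff_nz_lim) (auto simp: less_imp_neq[symmetric])
  then have eq: "(\<Prod>k. rho \<mu> k) = L" by (rule prodinf_eq_prod_lim)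
  show lim: "rho_prod \<longlonglongrightarrow> (\<Prod>k. rho \<mu> k)"
    using L(1) by (simp add: eq LIMSEQ_lessThan_iff_atMost)
  have "0 \<le> L"
    using lim rho_prod_pos unfolding eq by (intro LIMSEQ_le_const) (auto intro: less_imp_le)
  then show "0 < (\<Prod>k. rho \<mu> k)" using L(2) eq by simp
  have "decseq rho_prod"
    using rho_prod_pos rho_le_1 by (intro decseq_SucI) (simp add: mult_left_le less_imp_le)
  then show "(\<Prod>k. rho \<mu> k) \<le> rho_prod n" using lim by (rule decseq_ge)
qed

lemma rho_prod_le_1: "rho_prod n \<le> 1"
  using rho_pos rho_le_1 by (intro prod_le_1) (auto intro: less_imp_le)

context
  fixes w :: "real \<Rightarrow> real" and \<mu>s :: "complex measure"
  assumes decomp: "circle_decomposition \<mu> w \<mu>s"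
    and summable: "summable (\<lambda>k. (norm (alpha \<mu> (int k)))\<^sup>2)"
begin

abbreviation rho_lim :: real where "rho_lim \<equiv> (\<Prod>k. rho \<mu> k)"

lemma log_w: "AE \<theta> in dtheta. 0 < w \<theta>" "integrable dtheta (\<lambda>\<theta>. ln (w \<theta>))"
  "rho_lim \<le> exp ((LINT \<theta>|dtheta. ln (w \<theta>)) / 2)"
proof -
  have c: "0 < rho_lim\<^sup>2" "rho_lim\<^sup>2 \<le> (rho_prod n)\<^sup>2" for n
    using rho_prod_limit[OF summable] by (auto intro: power_mono less_imp_le)
  show "AE \<theta> in dtheta. 0 < w \<theta>" "integrable dtheta (\<lambda>\<theta>. ln (w \<theta>))"
    using szego_lower_bound[OF decomp c] by auto
  have "ln (rho_lim\<^sup>2) \<le> (LINT \<theta>|dtheta. ln (w \<theta>))"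
    using szego_lower_bound[OF decomp c] by auto
  then have "ln rho_lim \<le> (LINT \<theta>|dtheta. ln (w \<theta>)) / 2"
    using rho_prod_limit(2)[OF summable] by (simp add: ln_realpow)
  then have "exp (ln rho_lim) \<le> exp ((LINT \<theta>|dtheta. ln (w \<theta>)) / 2)" by simp
  then show "rho_lim \<le> exp ((LINT \<theta>|dtheta. ln (w \<theta>)) / 2)"
    using rho_prod_limit(2)[OF summable] by simp
qed

text \<open>The exponent \<open>2 * log D\<close> of the squared Szego function.\<close>

definition log_w_transform :: "complex \<Rightarrow> complex" where
  "log_w_transform = herglotz (\<lambda>\<theta>. of_real (ln (w \<theta>)))"

lemma log_w_transform_holomorphic: "log_w_transform holomorphic_on ball 0 1"
  unfolding log_w_transform_def using log_w(2) by (intro herglotz_holomorphic) simp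

lemma log_w_transform_0: "log_w_transform 0 = of_real (LINT \<theta>|dtheta. ln (w \<theta>))"
  unfolding log_w_transform_def herglotz_def by (simp add: herglotz_kernel_def)

lemma Re_log_w_transform: "norm z < 1 \<Longrightarrow> Re (log_w_transform z) = (LINT \<theta>|dtheta. poisson_kernel z \<theta> * ln (w \<theta>))"
  unfolding log_w_transform_def using log_w(2) by (intro Re_herglotz)

text \<open>The product \<open>D * \<phi>\<^sub>n\<^sup>*\<close> with the normalised reversed polynomial \<open>\<phi>\<^sub>n\<^sup>* = \<Phi>\<^sub>n\<^sup>* / (\<Prod>k<n. \<rho>\<^sub>k)\<close>, that is,
  the quotient of \<open>\<phi>\<^sub>n\<^sup>*\<close> by its expected limit \<open>1 / D\<close>.\<close>

definition szego_quotient :: "nat \<Rightarrow> complex \<Rightarrow> complex" where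
  "szego_quotient n z = exp (log_w_transform z / 2) * poly (\<Phi>s n) z / rho_prod n"

lemma szego_quotient_0: "szego_quotient n 0 = of_real (exp ((LINT \<theta>|dtheta. ln (w \<theta>)) / 2) / rho_prod n)"
  by (simp add: szego_quotient_def log_w_transform_0 flip: exp_of_real)

text \<open>\<open>|D * \<phi>\<^sub>n\<^sup>*|\<^sup>2\<close> is the exponential of the Poisson integral of \<open>log (w * |\<phi>\<^sub>n\<^sup>*|\<^sup>2)\<close>, so by Jensen's
  inequality it is at most the Poisson integral of \<open>w * |\<phi>\<^sub>n\<^sup>*|\<^sup>2\<close>, whose value at the origin is at
  most \<open>\<integral>|\<phi>\<^sub>n\<^sup>*|\<^sup>2 d\<mu> = 1\<close>.\<close>

lemma szego_quotient_majorant: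
  obtains F where "F holomorphic_on ball 0 1" "\<And>z. norm z < 1 \<Longrightarrow> (norm (szego_quotient n z))\<^sup>2 \<le> Re (F z)" "Re (F 0) \<le> 1"
proof -
  define s where "s z = norm (poly (\<Phi>s n) z)" for z
  define u where "u \<theta> = w \<theta> * ((s (cis \<theta>))\<^sup>2 / (rho_prod n)\<^sup>2)" for \<theta>
  define g where "g \<theta> = ln (w \<theta>) + 2 * ln (s (cis \<theta>)) - 2 * ln (rho_prod n)" for \<theta>
  have s_pos: "0 < s z" if "norm z \<le> 1" for z
    using reversed_OP_nonzero[OF that] by (simp add: s_def)
  have sc: "continuous_on UNIV (\<lambda>z. (s z)\<^sup>2 / (rho_prod n)\<^sup>2)"
    unfolding s_def by (intro continuous_intros) simp
  note [measurable] = w_measurable[OF decomp]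
  have u_int: "integrable dtheta u"
    unfolding u_def by (rule integral_w_mult_le(1)[OF decomp sc]) simp
  have "integral\<^sup>L dtheta u \<le> (LINT z|\<mu>. (s z)\<^sup>2 / (rho_prod n)\<^sup>2)"
    unfolding u_def by (rule integral_w_mult_le(2)[OF decomp sc]) simp
  also have "\<dots> = nsq (\<Phi>s n) / (rho_prod n)\<^sup>2" by (simp add: nsq_def s_def)
  also have "\<dots> = 1" using rho_prod_pos[of n] by (simp add: nsq_reversed_OP nsq_OP)
  finally have u1: "integral\<^sup>L dtheta u \<le> 1" .
  have eg: "AE \<theta> in dtheta. exp (g \<theta>) = u \<theta>"
    using log_w(1)
  proof eventually_elim
    case (elim \<theta>)
    have "exp (2 * ln x) = x\<^sup>2" if "0 < x" for x :: real
      using that exp_of_nat_mult[of 2 "ln x"] by simp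
    then show ?case
      using elim s_pos[of "cis \<theta>"] rho_prod_pos[of n]
      by (simp add: g_def u_def exp_add exp_diff)
  qed
  have si: "integrable dtheta (\<lambda>\<theta>. ln (s (cis \<theta>)))"
    unfolding s_def using poisson_log_poly(1)[of "\<Phi>s n" 0] reversed_OP_nonzero by simp
  then have g_int: "integrable dtheta g" unfolding g_def using log_w(2) by auto
  note [measurable] = borel_measurable_integrable[OF u_int] borel_measurable_integrable[OF g_int]
  have eg_int: "integrable dtheta (\<lambda>\<theta>. exp (g \<theta>))"
    using u_int eg by (subst integrable_cong_AE[where g = u]) auto
  show ?thesis
  proof (rule that)
    show "herglotz (\<lambda>\<theta>. of_real (u \<theta>)) holomorphic_on ball 0 1"
      using u_int by (intro herglotz_holomorphic) simp
    show "Re (herglotz (\<lambda>\<theta>. of_real (u \<theta>)) 0) \<le> 1"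
      using u1 u_int by (simp add: Re_herglotz)
    fix z :: complex assume z: "norm z < 1"
    have "ln ((norm (szego_quotient n z))\<^sup>2) = Re (log_w_transform z) + 2 * ln (s z) - 2 * ln (rho_prod n)"
      using s_pos[of z] z rho_prod_pos[of n]
      by (simp add: szego_quotient_def norm_mult norm_divide s_def ln_mult ln_div ln_realpow del: of_real_prod)
    also have "\<dots> = (LINT \<theta>|dtheta. poisson_kernel z \<theta> * ln (w \<theta>) + 2 * (poisson_kernel z \<theta> * ln (s (cis \<theta>)))
        - 2 * ln (rho_prod n) * poisson_kernel z \<theta>)"
    proof -
      have "(LINT \<theta>|dtheta. poisson_kernel z \<theta> * ln (s (cis \<theta>))) = ln (s z)"
        unfolding s_def using reversed_OP_nonzero z by (intro poisson_log_poly(2))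
      moreover note integrable_poisson_kernel_mult[OF log_w(2) z] integrable_poisson_kernel_mult[OF si z]
        integrable_poisson_kernel_mult[of "\<lambda>_. 1", OF _ z, simplified]
      ultimately show ?thesis using z by (simp add: Re_log_w_transform integral_poisson_kernel)
    qed
    also have "\<dots> = (LINT \<theta>|dtheta. poisson_kernel z \<theta> * g \<theta>)"
      by (intro Bochner_Integration.integral_cong) (auto simp: g_def algebra_simps)
    finally have "ln ((norm (szego_quotient n z))\<^sup>2) = (LINT \<theta>|dtheta. poisson_kernel z \<theta> * g \<theta>)" .
    moreover have "0 < (norm (szego_quotient n z))\<^sup>2"
      using reversed_OP_nonzero[of z n] z by (simp add: szego_quotient_def)
    ultimately have "(norm (szego_quotient n z))\<^sup>2 = exp (LINT \<theta>|dtheta. poisson_kernel z \<theta> * g \<theta>)"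
      by (metis exp_ln)
    also have "\<dots> \<le> (LINT \<theta>|dtheta. poisson_kernel z \<theta> * exp (g \<theta>))"
      by (rule poisson_jensen[OF g_int eg_int z])
    also have "\<dots> = (LINT \<theta>|dtheta. poisson_kernel z \<theta> * u \<theta>)"
      using eg borel_measurable_integrable[OF integrable_poisson_kernel_mult[OF eg_int z]]
        borel_measurable_integrable[OF integrable_poisson_kernel_mult[OF u_int z]]
      by (intro integral_cong_AE) (auto elim!: eventually_mono)
    also have "\<dots> = Re (herglotz (\<lambda>\<theta>. of_real (u \<theta>)) z)"
      by (rule Re_herglotz[OF u_int z, symmetric])
    finally show "(norm (szego_quotient n z))\<^sup>2 \<le> Re (herglotz (\<lambda>\<theta>. of_real (u \<theta>)) z)" .
  qed
qed

text \<open>Szego's theorem, \<open>D 0 = (\<Prod>k. \<rho>\<^sub>k)\<close>.\<close>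

lemma exp_half_mean: "exp ((LINT \<theta>|dtheta. ln (w \<theta>)) / 2) = rho_lim"
proof (rule antisym)
  have "exp ((LINT \<theta>|dtheta. ln (w \<theta>)) / 2) \<le> rho_prod n" for n
  proof -
    obtain F where "\<And>z. norm z < 1 \<Longrightarrow> (norm (szego_quotient n z))\<^sup>2 \<le> Re (F z)" "Re (F 0) \<le> 1"
      using szego_quotient_majorant by blast
    from order_trans[OF this(1)[of 0] this(2)] have "(norm (szego_quotient n 0))\<^sup>2 \<le> 1" by simp
    then have "norm (szego_quotient n 0) \<le> 1" by (simp add: abs_square_le_1)
    then have "exp ((LINT \<theta>|dtheta. ln (w \<theta>)) / 2) / rho_prod n \<le> 1"
      unfolding szego_quotient_0 norm_of_real by linarith
    then show ?thesis using rho_prod_pos[of n] by simp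
  qed
  then show "exp ((LINT \<theta>|dtheta. ln (w \<theta>)) / 2) \<le> rho_lim"
    using rho_prod_limit(1)[OF summable] by (intro LIMSEQ_le_const) auto
qed (rule log_w(3))

text \<open>The function \<open>|D * \<phi>\<^sub>n\<^sup>* - g|\<^sup>2\<close>, where \<open>g\<close> is the value of \<open>D * \<phi>\<^sub>n\<^sup>*\<close> at the origin, has a harmonic
  majorant with value at most \<open>1 - g\<^sup>2\<close> at the origin. Harnack's inequality spreads this bound over
  the disc.\<close>

lemma szego_quotient_minus_le:
  assumes z: "norm z \<le> r" "r < 1"
  shows "(norm (szego_quotient n z - of_real (rho_lim / rho_prod n)))\<^sup>2 \<le> (3 + r) / (1 - r) * (1 - (rho_lim / rho_prod n)\<^sup>2)"
proof -
  define g where "g = rho_lim / rho_prod n"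
  have G0: "szego_quotient n 0 = of_real g" unfolding szego_quotient_0 exp_half_mean g_def ..
  obtain F where F: "F holomorphic_on ball 0 1" "\<And>z. norm z < 1 \<Longrightarrow> (norm (szego_quotient n z))\<^sup>2 \<le> Re (F z)" "Re (F 0) \<le> 1"
    using szego_quotient_majorant by blast
  define H where "H z = F z - 2 * of_real g * szego_quotient n z + of_real (g\<^sup>2)" for z
  have "H holomorphic_on ball 0 1"
    unfolding H_def[abs_def] szego_quotient_def[abs_def] using rho_prod_pos[of n]
    by (intro holomorphic_intros F log_w_transform_holomorphic) auto
  moreover have H: "(norm (szego_quotient n u - of_real g))\<^sup>2 \<le> Re (H u)" if "norm u < 1" for u
  proof -
    have "(norm (szego_quotient n u - of_real g))\<^sup>2 = (norm (szego_quotient n u))\<^sup>2 - 2 * g * Re (szego_quotient n u) + g\<^sup>2"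
      unfolding cmod_power2 by (simp add: power2_eq_square algebra_simps)
    also have "\<dots> \<le> Re (H u)" using F(2)[OF that] by (simp add: H_def)
    finally show ?thesis .
  qed
  then have "0 \<le> Re (H u)" if "norm u < 1" for u
    using that by (meson order_trans zero_le_power2)
  ultimately have "Re (H z) \<le> (3 + r) / (1 - r) * Re (H 0)" by (intro harnack z)
  moreover have "Re (H 0) \<le> 1 - g\<^sup>2"
    using F(3) by (simp add: H_def G0 power2_eq_square)
  then have "(3 + r) / (1 - r) * Re (H 0) \<le> (3 + r) / (1 - r) * (1 - g\<^sup>2)"
    using z order_trans[OF norm_ge_zero z(1)] by (intro mult_left_mono) auto
  ultimately show ?thesis
    using H[of z] z by (simp add: g_def)
qed

text \<open>The limit of the reversed polynomials.\<close>

definition szego_limit :: "complex \<Rightarrow> complex" where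
  "szego_limit z = of_real rho_lim / szego_function w z"

lemma szego_limit_eq: "szego_limit z = of_real rho_lim * exp (- log_w_transform z / 2)"
proof -
  have "szego_function w z = exp (log_w_transform z / 2)"
    unfolding log_w_transform_def by (rule szego_function_eq[OF w_measurable[OF decomp]])
  then have "szego_limit z = of_real rho_lim * exp (- (log_w_transform z / 2))"
    unfolding szego_limit_def divide_inverse by (simp only: exp_minus)
  then show ?thesis by simp
qed

lemma szego_limit_holomorphic: "szego_limit holomorphic_on ball 0 1"
  unfolding szego_limit_eq[abs_def] by (intro holomorphic_intros log_w_transform_holomorphic) auto

lemma szego_limit_0: "szego_limit 0 = 1"
proof -
  define I where "I = (LINT \<theta>|dtheta. ln (w \<theta>))"
  have "szego_limit 0 = of_real (rho_lim * exp (- (I / 2)))"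
    unfolding szego_limit_eq log_w_transform_0 I_def[symmetric] of_real_mult exp_of_real[symmetric] by simp
  also have "rho_lim * exp (- (I / 2)) = 1"
    unfolding exp_minus I_def exp_half_mean using rho_prod_limit(2)[OF summable] by simp
  finally show ?thesis by simp
qed

lemma reversed_OP_uniform_limit:
  assumes r: "0 < r" "r < 1"
  shows "uniform_limit (ball 0 r) (\<lambda>n. poly (\<Phi>s n)) szego_limit sequentially"
proof (rule uniform_limitI)
  fix e :: real assume e: "0 < e"
  define A where "A = (LINT \<theta>|dtheta. \<bar>ln (w \<theta>)\<bar>)"
  define B where "B = (1 + r) / (1 - r) * A"
  define C where "C = exp (B / 2)"
  define b where "b n = sqrt ((3 + r) / (1 - r) * (1 - (rho_lim / rho_prod n)\<^sup>2))" for n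
  have bound: "norm (poly (\<Phi>s n) z - szego_limit z) \<le> C * b n" if z: "z \<in> ball 0 r" for n z
  proof -
    have "norm (log_w_transform z) \<le> B"
      unfolding log_w_transform_def A_def B_def using norm_herglotz_le[of "\<lambda>\<theta>. of_real (ln (w \<theta>))" z r] log_w(2) z r by simp
    then have "- Re (log_w_transform z) \<le> B"
      using abs_Re_le_cmod[of "log_w_transform z"] by linarith
    then have C: "norm (exp (- log_w_transform z / 2)) \<le> C" by (simp add: C_def)
    have "poly (\<Phi>s n) z - szego_limit z = exp (- log_w_transform z / 2) * (rho_prod n * (szego_quotient n z - of_real (rho_lim / rho_prod n)))"
      using rho_prod_pos[of n] by (simp add: szego_limit_eq szego_quotient_def exp_minus field_simps)
    then have "norm (poly (\<Phi>s n) z - szego_limit z) = norm (exp (- log_w_transform z / 2)) * (rho_prod n * norm (szego_quotient n z - of_real (rho_lim / rho_prod n)))"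
      using rho_prod_pos[of n] by (simp add: norm_mult del: of_real_prod of_real_divide)
    also have "\<dots> \<le> C * (1 * norm (szego_quotient n z - of_real (rho_lim / rho_prod n)))"
      using C rho_prod_le_1[of n] rho_prod_pos[of n] by (intro mult_mono) (auto simp: C_def intro: less_imp_le)
    also have "norm (szego_quotient n z - of_real (rho_lim / rho_prod n)) \<le> b n"
      unfolding b_def using szego_quotient_minus_le[of z r n] z r by (intro real_le_rsqrt) auto
    finally show ?thesis by (simp add: C_def)
  qed
  have "(\<lambda>n. C * b n) \<longlonglongrightarrow> C * sqrt ((3 + r) / (1 - r) * (1 - (rho_lim / rho_lim)\<^sup>2))"
    unfolding b_def using rho_prod_limit[OF summable] by (intro tendsto_intros) auto
  then have "(\<lambda>n. C * b n) \<longlonglongrightarrow> 0"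
    using rho_prod_limit(2)[OF summable] by simp
  then have "\<forall>\<^sub>F n in sequentially. C * b n < e" using e by (rule order_tendstoD)
  then show "\<forall>\<^sub>F n in sequentially. \<forall>z\<in>ball 0 r. dist (poly (\<Phi>s n) z) (szego_limit z) < e"
    by eventually_elim (auto simp: dist_norm intro: le_less_trans[OF bound])
qed

lemma reversed_OP_coeff_tendsto_Taylor: "(\<lambda>n. coeff (\<Phi>s n) m) \<longlonglongrightarrow> (deriv ^^ m) szego_limit 0 / fact m"
proof -
  have "\<forall>\<^sub>F n in sequentially. poly (\<Phi>s n) holomorphic_on ball 0 (1 / 2)"
    by (intro always_eventually allI) (auto intro: holomorphic_intros)
  then have "(\<lambda>n. (deriv ^^ m) (poly (\<Phi>s n)) 0) \<longlonglongrightarrow> (deriv ^^ m) szego_limit 0"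
    by (intro higher_deriv_complex_uniform_limit[OF reversed_OP_uniform_limit[of "1/2"]])
      auto
  then have "(\<lambda>n. fact m * coeff (\<Phi>s n) m / fact m) \<longlonglongrightarrow> (deriv ^^ m) szego_limit 0 / fact m"
    unfolding coeff_eq_higher_deriv by (intro tendsto_divide tendsto_const) auto
  then show ?thesis by simp
qed

lemma inverse_szego_function_series:
  fixes d :: "nat \<Rightarrow> complex"
  assumes d: "\<And>m. 1 \<le> m \<Longrightarrow> d m = (\<Sum>a\<in>ordered_partitions m. \<Sum>\<^sub>\<infinity>k\<in>index_tuples a. alpha_product \<mu> a k)"
    and z: "z \<in> ball 0 1"
  shows "summable (\<lambda>m. d (Suc m) * z ^ Suc m)"
    and "inverse (szego_function w z) = inverse (complex_of_real rho_lim) * (1 + (\<Sum>m. d (Suc m) * z ^ Suc m))"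
proof -
  have d_eq: "d (Suc m) = (deriv ^^ Suc m) szego_limit 0 / fact (Suc m)" for m
    using LIMSEQ_unique[OF reversed_OP_coeff_tendsto[OF summable, of "Suc m"] reversed_OP_coeff_tendsto_Taylor] d[of "Suc m"]
    by simp
  have "(\<lambda>m. (deriv ^^ m) szego_limit 0 / fact m * (z - 0) ^ m) sums szego_limit z"
    by (rule holomorphic_power_series[OF szego_limit_holomorphic z])
  then have "(\<lambda>m. (deriv ^^ Suc m) szego_limit 0 / fact (Suc m) * z ^ Suc m) sums (szego_limit z - 1)"
    using sums_split_initial_segment[of _ "szego_limit z" 1] by (fastforce simp: szego_limit_0)
  then have *: "(\<lambda>m. d (Suc m) * z ^ Suc m) sums (szego_limit z - 1)" unfolding d_eq .
  then show "summable (\<lambda>m. d (Suc m) * z ^ Suc m)" by (rule sums_summable)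
  show "inverse (szego_function w z) = inverse (complex_of_real rho_lim) * (1 + (\<Sum>m. d (Suc m) * z ^ Suc m))"
    unfolding sums_unique[OF *, symmetric] using rho_prod_limit(2)[OF summable]
    by (simp add: szego_limit_def divide_inverse)
qed

end

end

section \<open>The coefficient formulas\<close>

theorem theorem1p1:
  fixes \<mu> :: "complex measure"
  assumes "prob_space \<mu>"
    and "sets \<mu> = sets circle_borel"
    and "infinite (circle_support \<mu>)"
  shows
    "(\<forall>(n::int) (m::nat). 1 \<le> m \<longrightarrow>
        cnj (kappa \<mu> n (n - int m)) = lambda \<mu> n m \<and>
        lambda \<mu> n m =
          (\<Sum>a\<in>ordered_partitions m.
             \<Sum>\<^sub>\<infinity>k\<in>{k \<in> index_tuples a. k ! 0 < n}. alpha_product \<mu> a k)) \<and>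
     (summable (\<lambda>k. (norm (alpha \<mu> (int k)))\<^sup>2) \<longrightarrow>
        (\<forall>w \<mu>s. circle_decomposition \<mu> w \<mu>s \<longrightarrow>
           (\<exists>d :: nat \<Rightarrow> complex.
              (\<forall>z\<in>ball 0 1.
                 summable (\<lambda>m. d (Suc m) * z ^ Suc m) \<and>
                 inverse (szego_function w z) =
                   inverse (complex_of_real (\<Prod>k. rho \<mu> k)) *
                     (1 + (\<Sum>m. d (Suc m) * z ^ Suc m))) \<and>
              (\<forall>m\<ge>1.
                 (\<forall>a\<in>ordered_partitions m.
                    (\<lambda>k. norm (alpha_product \<mu> a k)) summable_on index_tuples a) \<and>
                 d m =
                   (\<Sum>a\<in>ordered_partitions m.
                      \<Sum>\<^sub>\<infinity>k\<in>index_tuples a. alpha_product \<mu> a k)))))"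
proof -
  interpret nontrivial_circle_measure \<mu>
    using assms by (simp add: nontrivial_circle_measure_def nontrivial_circle_measure_axioms_def)
  show ?thesis
  proof (intro conjI allI impI)
    fix n :: int and m :: nat assume m: "1 \<le> m"
    show "cnj (kappa \<mu> n (n - int m)) = lambda \<mu> n m" by (rule cnj_kappa[OF m])
    show "lambda \<mu> n m = (\<Sum>a\<in>ordered_partitions m.
        \<Sum>\<^sub>\<infinity>k\<in>{k \<in> index_tuples a. k ! 0 < n}. alpha_product \<mu> a k)"
      by (rule lambda_formula[OF m])
  next
    fix w \<mu>s
    assume summable: "summable (\<lambda>k. (norm (alpha \<mu> (int k)))\<^sup>2)"
      and decomp: "circle_decomposition \<mu> w \<mu>s"
    define d where "d m = (\<Sum>a\<in>ordered_partitions m. \<Sum>\<^sub>\<infinity>k\<in>index_tuples a. alpha_product \<mu> a k)" for m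
    show "\<exists>d :: nat \<Rightarrow> complex.
        (\<forall>z\<in>ball 0 1. summable (\<lambda>m. d (Suc m) * z ^ Suc m) \<and>
           inverse (szego_function w z) = inverse (complex_of_real (\<Prod>k. rho \<mu> k)) *
             (1 + (\<Sum>m. d (Suc m) * z ^ Suc m))) \<and>
        (\<forall>m\<ge>1. (\<forall>a\<in>ordered_partitions m. (\<lambda>k. norm (alpha_product \<mu> a k)) summable_on index_tuples a) \<and>
           d m = (\<Sum>a\<in>ordered_partitions m. \<Sum>\<^sub>\<infinity>k\<in>index_tuples a. alpha_product \<mu> a k))"
      using inverse_szego_function_series[OF decomp summable, of d] alpha_product_abs_summable[OF summable]
      by (intro exI[of _ d]) (auto simp: d_def)
  qed
qed

end
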